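(* Let $(\gamma,\nu_1,\nu_2):I\to\mathbb{R}^3\times\Delta$ and $(\tilde\gamma,\tilde\nu_1,\tilde\nu_2):J\to\mathbb{R}^3\times\Delta$ be framed curves with curvatures $(\ell,m,n,\alpha)$ and $(\tilde\ell,\tilde m,\tilde n,\tilde\alpha)$, respectively, with frame matrix $T=(t_{ij})$; let $\mathbf{x}(u,v)=\gamma(u)+\tilde\gamma(v)$, let $p_0=(u_0,v_0)\in I\times J$, and let $\varphi:I\times J\to\mathbb{R}$ be the function defined in the context. (1) $\mathbf{x}$ has an $S_1^+$ singular point at $p_0$ if and only if $\alpha(u_0)\tilde\alpha(v_0)\neq0$, $|t_{33}(p_0)|=1$, $$m(u_0)\bigl(\tilde m(v_0)t_{21}(p_0)-\tilde n(v_0)t_{11}(p_0)\bigr)+n(u_0)\bigl(\tilde m(v_0)t_{22}(p_0)-\tilde n(v_0)t_{12}(p_0)\bigr)=0,$$ $\varphi_{uu}(p_0)\varphi_{vv}(p_0)-\varphi_{uv}(p_0)^2<0$, and $$\Bigl(\tilde\alpha(v_0)m(u_0)+\alpha(u_0)\bigl(\tilde m(v_0)t_{11}(p_0)+\tilde n(v_0)t_{21}(p_0)\bigr),\ \tilde\alpha(v_0)n(u_0)+\alpha(u_0)\bigl(\tilde m(v_0)t_{12}(p_0)+\tilde n(v_0)t_{22}(p_0)\bigr)\Bigr)\neq(0,0).$$ (2) $\mathbf{x}$ has an $S_1^-$ singular point at $p_0$ if and only if $\alpha(u_0)\tilde\alpha(v_0)\neq0$, $|t_{33}(p_0)|=1$,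 $$m(u_0)\bigl(\tilde m(v_0)t_{21}(p_0)-\tilde n(v_0)t_{11}(p_0)\bigr)+n(u_0)\bigl(\tilde m(v_0)t_{22}(p_0)-\tilde n(v_0)t_{12}(p_0)\bigr)=0$$ and $\varphi_{uu}(p_0)\varphi_{vv}(p_0)-\varphi_{uv}(p_0)^2>0$.
   Context: All maps are $C^\infty$. $I,J\subset\mathbb{R}$ are intervals, with parameters $u\in I$, $v\in J$; subscripts $u,v$ denote derivatives. $S^2$ is the unit sphere in $\mathbb{R}^3$ and $\Delta=\{(a,b)\in S^2\times S^2 : a\cdot b=0\}$. A framed curve is a smooth map $(\gamma,\nu_1,\nu_2):I\to\mathbb{R}^3\times\Delta$ with $\gamma_u\cdot\nu_1=\gamma_u\cdot\nu_2=0$ on $I$. Put $\mu=\nu_1\times\nu_2$. Its curvature is $(\ell,m,n,\alpha)$ with $\ell=\nu_{1u}\cdot\nu_2$, $m=\nu_{1u}\cdot\mu$, $n=\nu_{2u}\cdot\mu$, $\alpha=\gamma_u\cdot\mu$. The same notation with tildes is used for a framed curve on $J$ with parameter $v$. The frame matrix of the two framed curves is $T=(t_{ij}):I\times J\to SO(3)$ determined by $$\begin{pmatrix}\tilde\nu_1(v)\\ \tilde\nu_2(v)\\ \tilde\mu(v)\end{pmatrix}=T(u,v)\begin{pmatrix}\nu_1(u)\\ \nu_2(u)\\ \mu(u)\end{pmatrix}.$$ Define vector fields on $I\times J$ by $\xi=\partial/\partial u$ and $\eta=-\tilde\alpha\,\partial/\partial u+\alpha\,t_{33}\,\partial/\partial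 v$, and $\varphi=\det(\xi\mathbf{x},\eta\mathbf{x},\eta\eta\mathbf{x})$, where $\zeta g$ denotes the directional derivative of $g$ by $\zeta$. Explicitly, $$\varphi=-\alpha^3\tilde\alpha^3t_{33}(-m\,t_{32}+n\,t_{31})-\alpha^4\tilde\alpha^2t_{33}^3(\tilde m\,t_{23}-\tilde n\,t_{13}).$$ Two map germs $\mathbb{R}^2\to\mathbb{R}^3$ are $\mathcal{A}$-equivalent if they coincide up to diffeomorphism germs of the source and of the target. A point $p$ is an $S_1^{\pm}$ singular point (Chen–Matumoto–Mond $\pm$) of $\mathbf{x}$ if the germ of $\mathbf{x}$ at $p$ is $\mathcal{A}$-equivalent to $(u,v)\mapsto(u,v^2,v(u^2\pm v^2))$ at $0$. *)

theory Defs
  imports "HOL-Analysis.Analysis"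
begin

section \<open>Smooth maps and germs\<close>

text \<open>All derivatives are taken within the domain \<open>S\<close>: on an open set they are the ordinary ones,
  at the end points of an interval the one-sided ones.\<close>

primrec Ck_on :: "nat \<Rightarrow> 'a::real_normed_vector set \<Rightarrow> ('a \<Rightarrow> 'b::real_normed_vector) \<Rightarrow> bool" where
  "Ck_on 0 S f \<longleftrightarrow> continuous_on S f"
| "Ck_on (Suc k) S f \<longleftrightarrow>
     f differentiable_on S \<and> (\<forall>w. Ck_on k S (\<lambda>p. frechet_derivative f (at p within S) w))"

definition smooth_on :: "'a::real_normed_vector set \<Rightarrow> ('a \<Rightarrow> 'b::real_normed_vector) \<Rightarrow> bool" where
  "smooth_on S f \<longleftrightarrow> (\<forall>k. Ck_on k S f)"

definition diffeomorphism ::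
  "'a::real_normed_vector set \<Rightarrow> 'b::real_normed_vector set \<Rightarrow> ('a \<Rightarrow> 'b) \<Rightarrow> ('b \<Rightarrow> 'a) \<Rightarrow> bool" where
  "diffeomorphism U V f g \<longleftrightarrow>
     open U \<and> open V \<and> homeomorphism U V f g \<and> smooth_on U f \<and> smooth_on V g"

text \<open>\<open>A_equivalent f p g q\<close>: the germ of \<open>f\<close> at \<open>p\<close> and the germ of \<open>g\<close> at \<open>q\<close> coincide up to
  diffeomorphism germs \<open>\<sigma>\<close> of the source and \<open>\<tau>\<close> of the target.\<close>

definition A_equivalent ::
  "('a::real_normed_vector \<Rightarrow> 'b::real_normed_vector) \<Rightarrow> 'a \<Rightarrow> ('a \<Rightarrow> 'b) \<Rightarrow> 'a \<Rightarrow> bool" where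
  "A_equivalent f p g q \<longleftrightarrow>
     (\<exists>U V \<sigma> \<sigma>' U' V' \<tau> \<tau>'.
        diffeomorphism U V \<sigma> \<sigma>' \<and> p \<in> U \<and> \<sigma> p = q \<and>
        diffeomorphism U' V' \<tau> \<tau>' \<and> f p \<in> U' \<and> \<tau> (f p) = g q \<and>
        f ` U \<subseteq> U' \<and> (\<forall>z\<in>U. \<tau> (f z) = g (\<sigma> z)))"

definition S1_plus_germ :: "real \<times> real \<Rightarrow> real^3" where
  "S1_plus_germ = (\<lambda>(u, v). vector [u, v^2, v * (u^2 + v^2)])"

definition S1_minus_germ :: "real \<times> real \<Rightarrow> real^3" where
  "S1_minus_germ = (\<lambda>(u, v). vector [u, v^2, v * (u^2 - v^2)])"

definition S1_plus_singular_point :: "(real \<times> real \<Rightarrow> real^3) \<Rightarrow> real \<times> real \<Rightarrow> bool" where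
  "S1_plus_singular_point x p \<longleftrightarrow> A_equivalent x p S1_plus_germ (0, 0)"

definition S1_minus_singular_point :: "(real \<times> real \<Rightarrow> real^3) \<Rightarrow> real \<times> real \<Rightarrow> bool" where
  "S1_minus_singular_point x p \<longleftrightarrow> A_equivalent x p S1_minus_germ (0, 0)"

section \<open>Framed curves\<close>

definition Delta :: "((real^3) \<times> (real^3)) set" where
  "Delta = {(a, b). a \<in> sphere 0 1 \<and> b \<in> sphere 0 1 \<and> a \<bullet> b = 0}"

definition framed_curve ::
  "real set \<Rightarrow> (real \<Rightarrow> real^3) \<Rightarrow> (real \<Rightarrow> real^3) \<Rightarrow> (real \<Rightarrow> real^3) \<Rightarrow> bool" where
  "framed_curve I \<gamma> \<nu>\<^sub>1 \<nu>\<^sub>2 \<longleftrightarrow>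
     smooth_on I (\<lambda>u. (\<gamma> u, \<nu>\<^sub>1 u, \<nu>\<^sub>2 u)) \<and>
     (\<forall>u\<in>I. (\<nu>\<^sub>1 u, \<nu>\<^sub>2 u) \<in> Delta \<and>
        vector_derivative \<gamma> (at u within I) \<bullet> \<nu>\<^sub>1 u = 0 \<and>
        vector_derivative \<gamma> (at u within I) \<bullet> \<nu>\<^sub>2 u = 0)"

definition frame_mu :: "(real \<Rightarrow> real^3) \<Rightarrow> (real \<Rightarrow> real^3) \<Rightarrow> real \<Rightarrow> real^3" where
  "frame_mu \<nu>\<^sub>1 \<nu>\<^sub>2 u = cross3 (\<nu>\<^sub>1 u) (\<nu>\<^sub>2 u)"

definition framed_curvature ::
  "real set \<Rightarrow> (real \<Rightarrow> real^3) \<Rightarrow> (real \<Rightarrow> real^3) \<Rightarrow> (real \<Rightarrow> real^3) \<Rightarrow>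
   real \<Rightarrow> real \<times> real \<times> real \<times> real" where
  "framed_curvature I \<gamma> \<nu>\<^sub>1 \<nu>\<^sub>2 u =
     (vector_derivative \<nu>\<^sub>1 (at u within I) \<bullet> \<nu>\<^sub>2 u,
      vector_derivative \<nu>\<^sub>1 (at u within I) \<bullet> frame_mu \<nu>\<^sub>1 \<nu>\<^sub>2 u,
      vector_derivative \<nu>\<^sub>2 (at u within I) \<bullet> frame_mu \<nu>\<^sub>1 \<nu>\<^sub>2 u,
      vector_derivative \<gamma> (at u within I) \<bullet> frame_mu \<nu>\<^sub>1 \<nu>\<^sub>2 u)"

text \<open>The frame as the matrix with rows \<open>\<nu>\<^sub>1, \<nu>\<^sub>2, \<mu>\<close>.\<close>

definition frame_rows :: "(real \<Rightarrow> real^3) \<Rightarrow> (real \<Rightarrow> real^3) \<Rightarrow> real \<Rightarrow> real^3^3" where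
  "frame_rows \<nu>\<^sub>1 \<nu>\<^sub>2 u = vector [\<nu>\<^sub>1 u, \<nu>\<^sub>2 u, frame_mu \<nu>\<^sub>1 \<nu>\<^sub>2 u]"

text \<open>\<open>T u v $ i $ j\<close> is the entry \<open>t\<^sub>i\<^sub>j(u,v)\<close>. The last equation determines \<open>T\<close> on \<open>I \<times> J\<close>.\<close>

definition frame_matrix ::
  "real set \<Rightarrow> real set \<Rightarrow> (real \<Rightarrow> real^3) \<Rightarrow> (real \<Rightarrow> real^3) \<Rightarrow>
   (real \<Rightarrow> real^3) \<Rightarrow> (real \<Rightarrow> real^3) \<Rightarrow> (real \<Rightarrow> real \<Rightarrow> real^3^3) \<Rightarrow> bool" where
  "frame_matrix I J \<nu>\<^sub>1 \<nu>\<^sub>2 \<nu>\<^sub>1' \<nu>\<^sub>2' T \<longleftrightarrow>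
     (\<forall>u\<in>I. \<forall>v\<in>J. rotation_matrix (T u v) \<and>
        frame_rows \<nu>\<^sub>1' \<nu>\<^sub>2' v = T u v ** frame_rows \<nu>\<^sub>1 \<nu>\<^sub>2 u)"

section \<open>The function phi\<close>

definition dir_deriv ::
  "'a::real_normed_vector set \<Rightarrow> ('a \<Rightarrow> 'a) \<Rightarrow> ('a \<Rightarrow> 'b::real_normed_vector) \<Rightarrow> 'a \<Rightarrow> 'b" where
  "dir_deriv S \<zeta> g p = frechet_derivative g (at p within S) (\<zeta> p)"

definition xi_field :: "real \<times> real \<Rightarrow> real \<times> real" where
  "xi_field = (\<lambda>(u, v). (1, 0))"

definition eta_field ::
  "(real \<Rightarrow> real) \<Rightarrow> (real \<Rightarrow> real) \<Rightarrow> (real \<Rightarrow> real \<Rightarrow> real^3^3) \<Rightarrow> real \<times> real \<Rightarrow> real \<times> real" where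
  "eta_field \<alpha> \<alpha>' T = (\<lambda>(u, v). (- \<alpha>' v, \<alpha> u * T u v $ 3 $ 3))"

definition phi ::
  "real set \<Rightarrow> real set \<Rightarrow> (real \<Rightarrow> real) \<Rightarrow> (real \<Rightarrow> real) \<Rightarrow> (real \<Rightarrow> real \<Rightarrow> real^3^3) \<Rightarrow>
   (real \<times> real \<Rightarrow> real^3) \<Rightarrow> real \<times> real \<Rightarrow> real" where
  "phi I J \<alpha> \<alpha>' T x p =
     (let D = dir_deriv (I \<times> J); \<xi> = xi_field; \<eta> = eta_field \<alpha> \<alpha>' T
      in det (vector [D \<xi> x p, D \<eta> x p, D \<eta> (D \<eta> x) p] :: real^3^3))"

definition partial_u :: "(real \<times> real \<Rightarrow> real) \<Rightarrow> real \<times> real \<Rightarrow> real" where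
  "partial_u f = (\<lambda>(u, v). deriv (\<lambda>s. f (s, v)) u)"

definition partial_v :: "(real \<times> real \<Rightarrow> real) \<Rightarrow> real \<times> real \<Rightarrow> real" where
  "partial_v f = (\<lambda>(u, v). deriv (\<lambda>s. f (u, s)) v)"

text \<open>\<open>f\<^sub>u\<^sub>u f\<^sub>v\<^sub>v - f\<^sub>u\<^sub>v\<^sup>2\<close>\<close>

definition hess_det :: "(real \<times> real \<Rightarrow> real) \<Rightarrow> real \<times> real \<Rightarrow> real" where
  "hess_det f p = partial_u (partial_u f) p * partial_v (partial_v f) p
                    - (partial_v (partial_u f) p)^2"

end

theory Submission
  imports Defs
begin

text \<open>The proof goes through a general criterion for a map germ \<open>f\<close> of the plane into
  3-space with \<open>f\<^sub>u \<noteq> 0\<close> and \<open>f\<^sub>v = 0\<close> at the origin, in terms of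
  \<open>\<Phi> = det(f\<^sub>u, f\<^sub>v, f\<^sub>v\<^sub>v)\<close>. Under changes of the vector fields and under diffeomorphisms of
  source and target, \<open>\<Phi>\<close> is multiplied by a nonzero factor up to terms of order 3 at a critical
  point of \<open>\<Phi>\<close>, because the error terms are products of three functions vanishing there; hence
  criticality and the sign of the Hessian determinant are invariants of the germ. Conversely, when
  \<open>f\<^sub>u\<close> and \<open>f\<^sub>v\<^sub>v\<close> are independent, a fibrewise Morse argument makes the second component
  \<open>v\<^sup>2\<close>, and splitting the third component into its even and odd parts in \<open>v\<close> and applying
  Whitney's theorem on even functions gives the form \<open>(u, v\<^sup>2, v K(u,v\<^sup>2))\<close>. If \<open>K\<^sub>u = 0\<close> and
  \<open>K\<^sub>u\<^sub>u K\<^sub>y \<noteq> 0\<close> at the origin, rescaling turns \<open>K(u,y)\<close> into \<open>u\<^sup>2 \<plusminus> y\<close>. Whitney's theorem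
  is proved by Seeley's extension across \<open>v\<^sup>2 = 0\<close>. For sums of two curves, a singular point at
  which one of the curves is singular has degenerate Hessian, and at the others the
  invariants are computed from the frames.\<close>


section \<open>Calculus of smooth maps\<close>

text \<open>When f_u and f_vv are dependent at a point with f_v = 0, Phi_vv vanishes there and the
  Hessian determinant is at most 0. A positive Hessian thus forces independence while a negative one
  does not, which is why only S_1^+ carries the extra pair of numbers; the pair is nonzero exactly
  when \<eta>\<eta>x is not parallel to \<xi>x. The condition bilinear in the curvatures of the two
  curves is criticality: at such a point det(f_u, f_uv, f_vv) is all that survives of the value and
  gradient of Phi.

  The obstacle is that \<eta> need kill x only at the point and not along a curve, so determinants
  built from different fields are not multiples of each other; only their 2-jets at a critical point
  are proportional. The factor enters the Hessian determinant squared, so its sign is harmless.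

  The curves live on intervals, with one-sided derivatives at end points. All calculus is therefore
  done with maps smooth on the whole space that agree with the given ones near the base
  point.\<close>

lemma Ck_on_cong:
  assumes "Ck_on k S f" "\<And>p. p \<in> S \<Longrightarrow> f p = g p"
  shows "Ck_on k S g"
  using assms
proof (induction k arbitrary: f g)
  case 0
  then show ?case by (auto cong: continuous_on_cong)
next
  case (Suc k)
  have tr: "(f has_derivative D) (at p within S) \<longleftrightarrow> (g has_derivative D) (at p within S)"
    if "p \<in> S" for p D
    using that Suc.prems(2) by (metis has_derivative_transform)
  \<comment> \<open>\<open>frechet_derivative\<close> is chosen among all derivatives within S,
    which need not be unique on an arbitrary S; since f and g have the same candidates, the same one
    is chosen.\<close>
  have eq: "frechet_derivative f (at p within S) = frechet_derivative g (at p within S)"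
    if "p \<in> S" for p
    unfolding frechet_derivative_def by (simp only: tr[OF that])
  have "Ck_on k S (\<lambda>p. frechet_derivative g (at p within S) w)" for w
  proof (rule Suc.IH)
    show "Ck_on k S (\<lambda>p. frechet_derivative f (at p within S) w)"
      using Suc.prems(1) by simp
  qed (simp only: eq)
  moreover have "g differentiable_on S"
    unfolding differentiable_on_def differentiable_def
  proof
    fix p assume "p \<in> S"
    then obtain D where "(f has_derivative D) (at p within S)"
      using Suc.prems(1) unfolding Ck_on.simps differentiable_on_def differentiable_def by blast
    then show "\<exists>D. (g has_derivative D) (at p within S)"
      using tr[OF \<open>p \<in> S\<close>] by blast
  qed
  ultimately show ?case by simp
qed

lemma Ck_on_SucI:
  assumes "open S" "\<And>p. p \<in> S \<Longrightarrow> (f has_derivative D p) (at p)"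
    "\<And>w. Ck_on k S (\<lambda>p. D p w)"
  shows "Ck_on (Suc k) S f"
proof -
  have "frechet_derivative f (at p within S) = D p" if "p \<in> S" for p
    using frechet_derivative_at[OF assms(2)[OF that]] at_within_open[OF that assms(1)] by simp
  moreover have "f differentiable_on S"
    unfolding differentiable_on_def differentiable_def
    by (metis assms(1,2) at_within_open)
  moreover have "Ck_on k S (\<lambda>p. frechet_derivative f (at p within S) w)" for w
    by (rule Ck_on_cong[OF assms(3)[of w]]) (simp add: calculation(1))
  ultimately show ?thesis by simp
qed

lemma Ck_on_SucD:
  assumes "open S" "Ck_on (Suc k) S f"
  shows "\<And>p. p \<in> S \<Longrightarrow> (f has_derivative frechet_derivative f (at p)) (at p)"
    and "\<And>w. Ck_on k S (\<lambda>p. frechet_derivative f (at p) w)"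
proof -
  show "(f has_derivative frechet_derivative f (at p)) (at p)" if "p \<in> S" for p
    using assms that by (auto simp: differentiable_on_def at_within_open_NO_MATCH frechet_derivative_works)
  show "Ck_on k S (\<lambda>p. frechet_derivative f (at p) w)" for w
  proof (rule Ck_on_cong)
    show "Ck_on k S (\<lambda>p. frechet_derivative f (at p within S) w)"
      using assms(2) by simp
  qed (simp only: at_within_open[OF _ assms(1)])
qed

lemma Ck_on_imp_continuous_on: "Ck_on k S f \<Longrightarrow> continuous_on S f"
  by (cases k) (auto intro: differentiable_imp_continuous_on)

lemma Ck_on_Suc_imp: "open S \<Longrightarrow> Ck_on (Suc k) S f \<Longrightarrow> Ck_on k S f"
proof (induction k arbitrary: f)
  case 0
  then show ?case using Ck_on_imp_continuous_on[of "Suc 0" S f] by simp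
next
  case (Suc k)
  show ?case
    by (rule Ck_on_SucI[OF Suc.prems(1)], erule Ck_on_SucD[OF Suc.prems])
      (rule Suc.IH[OF Suc.prems(1)], rule Ck_on_SucD(2)[OF Suc.prems])
qed

text \<open>At a point of an open subset the filter \<open>at p within S\<close> is already
  \<open>at p\<close>, so the derivatives taken in S and in T coincide. Applied to the interior of
  an interval, this removes one-sided derivatives.\<close>

lemma Ck_on_interior_subset:
  assumes "open T" "T \<subseteq> S" "Ck_on k S f"
  shows "Ck_on k T f"
  using assms(3)
proof (induction k arbitrary: f)
  case 0
  then show ?case using assms(2) continuous_on_subset by auto
next
  case (Suc k)
  have at: "at p within S = at p" if "p \<in> T" for p
    using that assms by (meson at_within_interior interior_maximal subsetD)
  show ?case
  proof (rule Ck_on_SucI[OF assms(1)])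
    fix p assume "p \<in> T"
    then show "(f has_derivative frechet_derivative f (at p within S)) (at p)"
      using Suc.prems assms(2) at
      by (metis Ck_on.simps(2) differentiable_on_def frechet_derivative_works subsetD)
  qed (use Suc in auto)
qed

lemma Ck_on_local:
  assumes "open S" "\<And>p. p \<in> S \<Longrightarrow> \<exists>T. open T \<and> p \<in> T \<and> Ck_on k T f"
  shows "Ck_on k S f"
  using assms(2)
proof (induction k arbitrary: f)
  case 0
  have "continuous (at p within S) f" if p: "p \<in> S" for p
  proof -
    obtain T where "open T" "p \<in> T" "continuous_on T f"
      using 0[OF p] unfolding Ck_on.simps by blast
    then show ?thesis
      using continuous_on_eq_continuous_at continuous_at_imp_continuous_at_within by blast
  qed
  then show ?case by (simp add: continuous_on_eq_continuous_within)
next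
  case (Suc k)
  show ?case
  proof (rule Ck_on_SucI[OF assms(1)])
    fix p assume "p \<in> S"
    then obtain T where "open T" "p \<in> T" "Ck_on (Suc k) T f"
      using Suc.prems by blast
    then show "(f has_derivative frechet_derivative f (at p)) (at p)"
      using Ck_on_SucD(1) by blast
  next
    fix w show "Ck_on k S (\<lambda>p. frechet_derivative f (at p) w)"
    proof (rule Suc.IH)
      fix p assume "p \<in> S"
      then obtain T where "open T" "p \<in> T" "Ck_on (Suc k) T f"
        using Suc.prems by blast
      then show "\<exists>T. open T \<and> p \<in> T \<and> Ck_on k T (\<lambda>p. frechet_derivative f (at p) w)"
        using Ck_on_SucD(2) by blast
    qed
  qed
qed

section \<open>Closure properties of C^k and smooth maps\<close>

lemma Ck_on_const: "open S \<Longrightarrow> Ck_on k S (\<lambda>_. c)"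
proof (induction k arbitrary: c)
  case (Suc k)
  then show ?case by (intro Ck_on_SucI[where D="\<lambda>_ _. 0"]) auto
qed auto

lemma Ck_on_linear: "open S \<Longrightarrow> bounded_linear L \<Longrightarrow> Ck_on k S L"
proof (induction k)
  case 0
  then show ?case by (simp add: linear_continuous_on)
next
  case (Suc k)
  then show ?case
    by (intro Ck_on_SucI[where D="\<lambda>_. L"]) (auto intro: bounded_linear_imp_has_derivative Ck_on_const)
qed

lemma Ck_on_add:
  "open S \<Longrightarrow> Ck_on k S f \<Longrightarrow> Ck_on k S g \<Longrightarrow> Ck_on k S (\<lambda>p. f p + g p)"
proof (induction k arbitrary: f g)
  case 0
  then show ?case by (simp add: continuous_on_add)
next
  case (Suc k)
  note f = Ck_on_SucD[OF Suc.prems(1,2)] and g = Ck_on_SucD[OF Suc.prems(1,3)]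
  show ?case
    by (rule Ck_on_SucI[OF Suc.prems(1)], rule has_derivative_add, erule f, erule g)
      (rule Suc.IH[OF Suc.prems(1) f(2) g(2)])
qed

lemma Ck_on_bilinear:
  assumes "bounded_bilinear P" "open S"
  shows "Ck_on k S f \<Longrightarrow> Ck_on k S g \<Longrightarrow> Ck_on k S (\<lambda>p. P (f p) (g p))"
proof (induction k arbitrary: f g)
  case 0
  then show ?case using bounded_bilinear.continuous_on[OF assms(1)] by auto
next
  case (Suc k)
  note f = Ck_on_SucD[OF assms(2) Suc.prems(1)] and g = Ck_on_SucD[OF assms(2) Suc.prems(2)]
  note f0 = Ck_on_Suc_imp[OF assms(2) Suc.prems(1)] and g0 = Ck_on_Suc_imp[OF assms(2) Suc.prems(2)]
  show ?case
    by (rule Ck_on_SucI[OF assms(2)], rule bounded_bilinear.FDERIV[OF assms(1)], erule f, erule g)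
      (intro Ck_on_add Suc.IH assms f0 g0 f(2) g(2))
qed

lemma Ck_on_sum:
  "open S \<Longrightarrow> (\<And>i. i \<in> A \<Longrightarrow> Ck_on k S (f i)) \<Longrightarrow> Ck_on k S (\<lambda>p. \<Sum>i\<in>A. f i p)"
  by (induction A rule: infinite_finite_induct) (auto intro: Ck_on_const Ck_on_add)

text \<open>Regularity is stated for derivatives in a fixed direction, but in the chain rule the
  direction in which f is differentiated moves with p. Expanding it in a basis of the middle space
  gives a finite sum of coordinate functions of g' times derivatives of f in fixed directions, to
  which the induction hypothesis applies.\<close>

lemma Ck_on_compose:
  fixes g :: "'a::real_normed_vector \<Rightarrow> 'b::euclidean_space"
    and f :: "'b \<Rightarrow> 'c::real_normed_vector"
  assumes "open S" "open T" "\<And>p. p \<in> S \<Longrightarrow> g p \<in> T"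
  shows "Ck_on k S g \<Longrightarrow> Ck_on k T f \<Longrightarrow> Ck_on k S (\<lambda>p. f (g p))"
proof (induction k arbitrary: f)
  case 0
  then show ?case
    using assms(3) by (auto intro!: continuous_on_compose2[of T f S g])
next
  case (Suc k)
  note g = Ck_on_SucD[OF assms(1) Suc.prems(1)] and f = Ck_on_SucD[OF assms(2) Suc.prems(2)]
  note g0 = Ck_on_Suc_imp[OF assms(1) Suc.prems(1)]
  show ?case
  proof (rule Ck_on_SucI[OF assms(1)])
    fix p assume p: "p \<in> S"
    show "((\<lambda>p. f (g p)) has_derivative
      (\<lambda>w. \<Sum>i\<in>Basis. (frechet_derivative g (at p) w \<bullet> i) *\<^sub>R frechet_derivative f (at (g p)) i)) (at p)"
    proof (rule has_derivative_eq_rhs[OF has_derivative_compose[OF g(1)[OF p] f(1)[OF assms(3)[OF p]]]])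
      interpret linear "frechet_derivative f (at (g p))"
        using f(1)[OF assms(3)[OF p]] has_derivative_linear by blast
      show "(\<lambda>w. frechet_derivative f (at (g p)) (frechet_derivative g (at p) w)) =
        (\<lambda>w. \<Sum>i\<in>Basis. (frechet_derivative g (at p) w \<bullet> i) *\<^sub>R frechet_derivative f (at (g p)) i)"
        by (subst (1) euclidean_representation[symmetric]) (simp add: sum scale)
    qed
  next
    fix w
    show "Ck_on k S (\<lambda>p. \<Sum>i\<in>Basis. (frechet_derivative g (at p) w \<bullet> i) *\<^sub>R frechet_derivative f (at (g p)) i)"
      by (intro Ck_on_sum Ck_on_bilinear[OF bounded_bilinear_scaleR]
            Ck_on_bilinear[OF bounded_bilinear_inner] Ck_on_const assms g(2) Suc.IH[OF g0 f(2)])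
  qed
qed

lemma Ck_on_linear_compose:
  assumes "bounded_linear L" "open S"
  shows "Ck_on k S f \<Longrightarrow> Ck_on k S (\<lambda>p. L (f p))"
proof (induction k arbitrary: f)
  case 0
  then show ?case by (simp add: bounded_linear.continuous_on[OF assms(1)])
next
  case (Suc k)
  note f = Ck_on_SucD[OF assms(2) Suc.prems]
  show ?case
    by (rule Ck_on_SucI[OF assms(2)], rule bounded_linear.has_derivative[OF assms(1)], erule f)
      (rule Suc.IH[OF f(2)])
qed

lemma smooth_on_linear_compose:
  "bounded_linear L \<Longrightarrow> open S \<Longrightarrow> smooth_on S f \<Longrightarrow> smooth_on S (\<lambda>p. L (f p))"
  by (simp add: smooth_on_def Ck_on_linear_compose)

lemma smooth_on_subset: "smooth_on S f \<Longrightarrow> open T \<Longrightarrow> T \<subseteq> S \<Longrightarrow> smooth_on T f"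
  unfolding smooth_on_def using Ck_on_interior_subset by blast

lemma smooth_on_cong: "smooth_on S f \<Longrightarrow> (\<And>p. p \<in> S \<Longrightarrow> f p = g p) \<Longrightarrow> smooth_on S g"
  unfolding smooth_on_def using Ck_on_cong by metis

lemma smooth_on_imp_continuous_on: "smooth_on S f \<Longrightarrow> continuous_on S f"
  using Ck_on_imp_continuous_on by (auto simp: smooth_on_def)

lemma smooth_on_local:
  assumes "open S" "\<And>p. p \<in> S \<Longrightarrow> \<exists>T. open T \<and> p \<in> T \<and> smooth_on T f"
  shows "smooth_on S f"
  unfolding smooth_on_def
  by (intro allI Ck_on_local assms(1)) (use assms(2) in \<open>auto simp: smooth_on_def\<close>)

lemma smooth_on_has_derivative:
  "smooth_on S f \<Longrightarrow> open S \<Longrightarrow> p \<in> S \<Longrightarrow> (f has_derivative frechet_derivative f (at p)) (at p)"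
  unfolding smooth_on_def using Ck_on_SucD(1) by blast

lemma smooth_on_derivative:
  "smooth_on S f \<Longrightarrow> open S \<Longrightarrow> smooth_on S (\<lambda>p. frechet_derivative f (at p) w)"
  unfolding smooth_on_def using Ck_on_SucD(2) by blast

lemma smooth_on_const: "open S \<Longrightarrow> smooth_on S (\<lambda>_. c)"
  by (simp add: smooth_on_def Ck_on_const)

lemma smooth_on_linear: "open S \<Longrightarrow> bounded_linear L \<Longrightarrow> smooth_on S L"
  by (simp add: smooth_on_def Ck_on_linear)

lemma smooth_on_add:
  "open S \<Longrightarrow> smooth_on S f \<Longrightarrow> smooth_on S g \<Longrightarrow> smooth_on S (\<lambda>p. f p + g p)"
  by (simp add: smooth_on_def Ck_on_add)

lemma smooth_on_bilinear:
  "bounded_bilinear P \<Longrightarrow> open S \<Longrightarrow> smooth_on S f \<Longrightarrow> smooth_on S g \<Longrightarrow> smooth_on S (\<lambda>p. P (f p) (g p))"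
  by (simp add: smooth_on_def Ck_on_bilinear)

lemma smooth_on_sum:
  "open S \<Longrightarrow> (\<And>i. i \<in> A \<Longrightarrow> smooth_on S (f i)) \<Longrightarrow> smooth_on S (\<lambda>p. \<Sum>i\<in>A. f i p)"
  by (simp add: smooth_on_def Ck_on_sum)

lemma smooth_on_compose:
  fixes g :: "'a::real_normed_vector \<Rightarrow> 'b::euclidean_space"
    and f :: "'b \<Rightarrow> 'c::real_normed_vector"
  assumes "smooth_on T f" "smooth_on S g" "open S" "open T" "\<And>p. p \<in> S \<Longrightarrow> g p \<in> T"
  shows "smooth_on S (\<lambda>p. f (g p))"
  using assms Ck_on_compose[of S T g _ f] by (simp add: smooth_on_def)

lemma smooth_on_componentwise:
  fixes f :: "'a::real_normed_vector \<Rightarrow> 'b::euclidean_space"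
  assumes "open S" "\<And>i. i \<in> Basis \<Longrightarrow> smooth_on S (\<lambda>p. f p \<bullet> i)"
  shows "smooth_on S f"
proof -
  have "smooth_on S (\<lambda>p. \<Sum>i\<in>Basis. (f p \<bullet> i) *\<^sub>R i)"
    by (intro smooth_on_sum smooth_on_bilinear[OF bounded_bilinear_scaleR] smooth_on_const assms)
  then show ?thesis by (simp add: euclidean_representation)
qed

text \<open>Induction on k runs over the whole class at once: if all members are C^k and every
  directional derivative is a combination of two members, all members are C^(k+1). It serves for
  functions whose derivatives stay in an explicit family; in the plane the two members are the two
  partial derivatives.\<close>

lemma smooth_on_coinduct:
  fixes f :: "'a::real_normed_vector \<Rightarrow> 'b::real_normed_vector"
  assumes "open S" "f \<in> C"
    and step: "\<And>f. f \<in> C \<Longrightarrow> \<exists>D. (\<forall>p\<in>S. (f has_derivative D p) (at p)) \<and>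
      (\<forall>w. \<exists>g\<in>C. \<exists>h\<in>C. \<exists>a b. \<forall>p\<in>S. D p w = a *\<^sub>R g p + b *\<^sub>R h p)"
  shows "smooth_on S f"
proof -
  have "\<forall>f\<in>C. Ck_on k S f" for k
  proof (induction k)
    case 0
    show ?case
      using step has_derivative_continuous
      by (metis Ck_on.simps(1) continuous_at_imp_continuous_on)
  next
    case (Suc k)
    show ?case
    proof
      fix f assume "f \<in> C"
      from step[OF this] obtain D where D: "\<And>p. p \<in> S \<Longrightarrow> (f has_derivative D p) (at p)"
        and D': "\<And>w. \<exists>g\<in>C. \<exists>h\<in>C. \<exists>a b. \<forall>p\<in>S. D p w = a *\<^sub>R g p + b *\<^sub>R h p"
        by blast
      show "Ck_on (Suc k) S f"
      proof (rule Ck_on_SucI[OF assms(1) D])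
        fix w
        from D'[of w] obtain g h a b where "g \<in> C" "h \<in> C"
          and eq: "\<And>p. p \<in> S \<Longrightarrow> D p w = a *\<^sub>R g p + b *\<^sub>R h p" by blast
        then have "Ck_on k S (\<lambda>p. a *\<^sub>R g p + b *\<^sub>R h p)"
          using Suc assms(1)
          by (intro Ck_on_add Ck_on_linear_compose[OF bounded_linear_scaleR_right]) auto
        then show "Ck_on k S (\<lambda>p. D p w)"
          by (rule Ck_on_cong) (simp add: eq)
      qed
    qed
  qed
  then show ?thesis
    using assms(2) by (auto simp: smooth_on_def)
qed

section \<open>Globally smooth maps and bump functions\<close>

abbreviation smooth :: "('a::real_normed_vector \<Rightarrow> 'b::real_normed_vector) \<Rightarrow> bool" where
  "smooth f \<equiv> smooth_on UNIV f"

lemma smooth_const: "smooth (\<lambda>_. c)" by (simp add: smooth_on_const)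
lemma smooth_linear: "bounded_linear L \<Longrightarrow> smooth L" by (simp add: smooth_on_linear)
lemma smooth_ident: "smooth (\<lambda>p. p)" by (rule smooth_linear[OF bounded_linear_ident])
lemma smooth_fst: "smooth (\<lambda>p. fst p)" by (rule smooth_linear[OF bounded_linear_fst])
lemma smooth_snd: "smooth (\<lambda>p. snd p)" by (rule smooth_linear[OF bounded_linear_snd])
lemma smooth_add: "smooth f \<Longrightarrow> smooth g \<Longrightarrow> smooth (\<lambda>p. f p + g p)" by (simp add: smooth_on_add)
lemma smooth_minus: "smooth f \<Longrightarrow> smooth (\<lambda>p. - f p)"
  by (rule smooth_on_linear_compose[OF bounded_linear_minus[OF bounded_linear_ident]]) auto
lemma smooth_diff: "smooth f \<Longrightarrow> smooth g \<Longrightarrow> smooth (\<lambda>p. f p - g p)"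
  using smooth_add[of f "\<lambda>p. - g p"] smooth_minus[of g] by simp
lemma smooth_mult: "smooth f \<Longrightarrow> smooth g \<Longrightarrow> smooth (\<lambda>p. f p * g p)"
  for f g :: "'a::real_normed_vector \<Rightarrow> 'b::real_normed_algebra"
  by (rule smooth_on_bilinear[OF bounded_bilinear_mult open_UNIV])
lemma smooth_scaleR: "smooth f \<Longrightarrow> smooth g \<Longrightarrow> smooth (\<lambda>p. f p *\<^sub>R g p)"
  by (rule smooth_on_bilinear[OF bounded_bilinear_scaleR open_UNIV])
lemma smooth_inner: "smooth f \<Longrightarrow> smooth g \<Longrightarrow> smooth (\<lambda>p. f p \<bullet> g p)"
  by (rule smooth_on_bilinear[OF bounded_bilinear_inner open_UNIV])
lemma smooth_power: "smooth f \<Longrightarrow> smooth (\<lambda>p. f p ^ k)"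
  for f :: "'a::real_normed_vector \<Rightarrow> real"
  by (induction k) (auto intro: smooth_mult smooth_const)
lemma smooth_nth: "smooth f \<Longrightarrow> smooth (\<lambda>p. f p $ i)"
  by (rule smooth_on_linear_compose[OF bounded_linear_vec_nth open_UNIV])
lemma smooth_fst_compose: "smooth f \<Longrightarrow> smooth (\<lambda>p. fst (f p))"
  by (rule smooth_on_linear_compose[OF bounded_linear_fst open_UNIV])
lemma smooth_snd_compose: "smooth f \<Longrightarrow> smooth (\<lambda>p. snd (f p))"
  by (rule smooth_on_linear_compose[OF bounded_linear_snd open_UNIV])
lemma smooth_Pair: "smooth f \<Longrightarrow> smooth g \<Longrightarrow> smooth (\<lambda>p. (f p, g p))"
  for f :: "'a::real_normed_vector \<Rightarrow> 'b::euclidean_space"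
    and g :: "'a \<Rightarrow> 'c::euclidean_space"
proof (rule smooth_on_componentwise)
  fix i :: "'b \<times> 'c" assume "smooth f" "smooth g"
  then show "smooth (\<lambda>p. (f p, g p) \<bullet> i)"
    unfolding inner_prod_def by (intro smooth_add smooth_inner smooth_const) auto
qed auto
lemma smooth_componentwise: "(\<And>i. smooth (\<lambda>p. f p $ i)) \<Longrightarrow> smooth f"
  for f :: "'a::real_normed_vector \<Rightarrow> real^'n"
  by (rule smooth_on_componentwise)
     (auto simp: Basis_vec_def inner_axis)
lemma smooth_vector_3: "smooth f \<Longrightarrow> smooth g \<Longrightarrow> smooth h \<Longrightarrow> smooth (\<lambda>p. vector [f p, g p, h p] :: real^3)"
proof (rule smooth_componentwise)
  fix i :: 3 assume "smooth f" "smooth g" "smooth h"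
  then show "smooth (\<lambda>p. (vector [f p, g p, h p] :: real^3) $ i)"
    using exhaust_3[of i] by auto
qed
lemma smooth_compose: "smooth f \<Longrightarrow> smooth g \<Longrightarrow> smooth (\<lambda>p. f (g p))"
  for g :: "'a::real_normed_vector \<Rightarrow> 'b::euclidean_space"
  by (rule smooth_on_compose) auto

lemmas smooth_intros = smooth_const smooth_ident smooth_fst smooth_snd smooth_add smooth_minus smooth_diff
  smooth_mult smooth_scaleR smooth_inner smooth_power smooth_nth smooth_fst_compose smooth_snd_compose
  smooth_Pair smooth_vector_3

lemma smooth_isCont: "smooth f \<Longrightarrow> isCont f p"
  using smooth_on_imp_continuous_on continuous_on_eq_continuous_at open_UNIV by blast

lemma smooth_tendsto: "smooth f \<Longrightarrow> filterlim f (nhds (f p)) (nhds p)"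
  using smooth_isCont[of f p] by (simp add: continuous_at tendsto_nhds_iff)

lemma smooth_eventually: "smooth f \<Longrightarrow> eventually P (nhds (f p)) \<Longrightarrow> \<forall>\<^sub>F z in nhds p. P (f z)"
  using smooth_tendsto by (auto simp: filterlim_iff)

lemma smooth_has_derivative: "smooth f \<Longrightarrow> (f has_derivative frechet_derivative f (at p)) (at p)"
  by (rule smooth_on_has_derivative) auto

section \<open>Flat functions, roots and cutoffs\<close>

text \<open>The exponent k makes the family closed under differentiation: the derivative of member k
  is a combination of members k + 1 and k + 2.\<close>

definition flat_exp :: "nat \<Rightarrow> real \<Rightarrow> real" where
  "flat_exp k x = (if x > 0 then exp (- (1 / x)) / x ^ k else 0)"

lemma tendsto_flat_exp: "(flat_exp k \<longlongrightarrow> 0) (at 0)"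
proof -
  have "((\<lambda>x::real. inverse x ^ k / exp (inverse x)) \<longlongrightarrow> 0) (at_right 0)"
    by (rule filterlim_compose[OF tendsto_power_div_exp_0 filterlim_inverse_at_top_right])
  then have "(flat_exp k \<longlongrightarrow> 0) (at_right 0)"
  proof (rule Lim_transform_eventually)
    show "\<forall>\<^sub>F x in at_right 0. inverse x ^ k / exp (inverse x) = flat_exp k x"
      by (rule eventually_at_right_less[THEN eventually_mono])
         (simp add: flat_exp_def exp_minus field_simps)
  qed
  moreover have "(flat_exp k \<longlongrightarrow> 0) (at_left 0)"
    by (rule tendsto_eventually, rule eventually_at_leftI[of "-1"]) (auto simp: flat_exp_def)
  ultimately show ?thesis
    by (simp add: filterlim_at_split)
qed

lemma DERIV_inverse_power:
  "x \<noteq> 0 \<Longrightarrow> ((\<lambda>x::real. inverse x ^ k) has_real_derivative - real k * inverse x ^ (k + 1)) (at x)"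
proof (induction k)
  case (Suc k)
  from DERIV_mult[OF DERIV_inverse[OF Suc.prems] Suc.IH[OF Suc.prems]]
  show ?case by (simp add: algebra_simps)
qed simp

lemma DERIV_flat_exp:
  "(flat_exp k has_real_derivative flat_exp (k + 2) x - real k * flat_exp (k + 1) x) (at x)"
proof (cases x "0::real" rule: linorder_cases)
  case less
  have "((\<lambda>_. 0) has_real_derivative flat_exp (k + 2) x - real k * flat_exp (k + 1) x) (at x)"
    using less by (simp add: flat_exp_def)
  then show ?thesis
    by (rule has_field_derivative_transform_within_open[of _ _ _ "{..<0}"])
       (use less in \<open>auto simp: flat_exp_def\<close>)
next
  case equal
  \<comment> \<open>The difference quotient of \<open>flat_exp k\<close> at 0 is
    \<open>flat_exp (Suc k)\<close>, whose limit is already known.\<close>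
  have "((\<lambda>h. (flat_exp k (0 + h) - flat_exp k 0) / h) \<longlongrightarrow> 0) (at 0)"
    by (rule Lim_transform_eventually[OF tendsto_flat_exp[of "Suc k"]])
       (auto simp: flat_exp_def eventually_at_filter)
  then show ?thesis
    using equal by (simp add: DERIV_def flat_exp_def)
next
  case greater
  have "((\<lambda>x. exp (- inverse x)) has_real_derivative exp (- inverse x) * inverse x ^ 2) (at x)"
    using greater by (auto intro!: derivative_eq_intros simp: power2_eq_square)
  from DERIV_mult[OF this DERIV_inverse_power[of x k]]
  have "((\<lambda>x. exp (- inverse x) * inverse x ^ k) has_real_derivative
     flat_exp (k + 2) x - real k * flat_exp (k + 1) x) (at x)"
    using greater by (simp add: flat_exp_def divide_inverse power_inverse power2_eq_square algebra_simps)
  then show ?thesis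
    by (rule has_field_derivative_transform_within_open[of _ _ _ "{0<..}"])
       (use greater in \<open>auto simp: flat_exp_def divide_inverse power_inverse\<close>)
qed

lemma smooth_on_coinduct_real:
  fixes f :: "real \<Rightarrow> real"
  assumes "open S" "f \<in> C"
    and step: "\<And>f. f \<in> C \<Longrightarrow>
      \<exists>g\<in>C. \<exists>h\<in>C. \<exists>a b. \<forall>x\<in>S. (f has_real_derivative a * g x + b * h x) (at x)"
  shows "smooth_on S f"
proof (rule smooth_on_coinduct[OF assms(1,2)])
  fix f assume "f \<in> C"
  from step[OF this] obtain g h a b where gh: "g \<in> C" "h \<in> C"
    and D: "\<And>x. x \<in> S \<Longrightarrow> (f has_real_derivative a * g x + b * h x) (at x)" by blast
  show "\<exists>D. (\<forall>p\<in>S. (f has_derivative D p) (at p)) \<and>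
      (\<forall>w. \<exists>g\<in>C. \<exists>h\<in>C. \<exists>a b. \<forall>p\<in>S. D p w = a *\<^sub>R g p + b *\<^sub>R h p)"
  proof (intro exI conjI ballI allI)
    show "(f has_derivative (*) (a * g p + b * h p)) (at p)" if "p \<in> S" for p
      using D[OF that] by (simp add: has_field_derivative_def)
    show "\<exists>g'\<in>C. \<exists>h'\<in>C. \<exists>a' b'. \<forall>p\<in>S. (a * g p + b * h p) * w = a' *\<^sub>R g' p + b' *\<^sub>R h' p" for w
      by (intro bexI[OF _ gh(1)] bexI[OF _ gh(2)] exI[of _ "a * w"] exI[of _ "b * w"])
         (simp add: algebra_simps)
  qed
qed

lemma smooth_flat_exp: "smooth (flat_exp k)"
proof (rule smooth_on_coinduct_real[of _ _ "range flat_exp"])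
  fix f assume "f \<in> range flat_exp"
  then obtain k where f: "f = flat_exp k" by auto
  show "\<exists>g\<in>range flat_exp. \<exists>h\<in>range flat_exp. \<exists>a b. \<forall>x\<in>UNIV. (f has_real_derivative a * g x + b * h x) (at x)"
    by (rule bexI[of _ "flat_exp (k+2)"], rule bexI[of _ "flat_exp (k+1)"],
        rule exI[of _ 1], rule exI[of _ "- real k"])
       (use DERIV_flat_exp[of k] f in auto)
qed auto

lemma smooth_on_inverse: "smooth_on (- {0}) (inverse :: real \<Rightarrow> real)"
proof (rule smooth_on_coinduct_real[of _ _ "range (\<lambda>k x. inverse x ^ k)"])
  show "inverse \<in> range (\<lambda>k (x::real). inverse x ^ k)"
    by (rule range_eqI[of _ _ 1]) auto
  fix f :: "real \<Rightarrow> real" assume "f \<in> range (\<lambda>k x. inverse x ^ k)"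
  then obtain k where f: "f = (\<lambda>x. inverse x ^ k)" by auto
  show "\<exists>g\<in>range (\<lambda>k x. inverse x ^ k). \<exists>h\<in>range (\<lambda>k x. inverse x ^ k).
      \<exists>a b. \<forall>x\<in>-{0}. (f has_real_derivative a * g x + b * h x) (at x)"
    by (rule bexI[OF _ rangeI[of _ "k + 1"]], rule bexI[OF _ rangeI[of _ 0]],
        rule exI[of _ "- real k"], rule exI[of _ 0])
       (use DERIV_inverse_power[of _ k] f in auto)
qed auto

lemma smooth_on_sqrt: "smooth_on {0<..} sqrt"
proof (rule smooth_on_coinduct_real[of _ _ "range (\<lambda>k x. sqrt x * inverse x ^ k)"])
  show "sqrt \<in> range (\<lambda>k x. sqrt x * inverse x ^ k)"
    by (rule range_eqI[of _ _ 0]) auto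
  fix f :: "real \<Rightarrow> real" assume "f \<in> range (\<lambda>k x. sqrt x * inverse x ^ k)"
  then obtain k where f: "f = (\<lambda>x. sqrt x * inverse x ^ k)" by auto
  have D: "(f has_real_derivative (1/2 - real k) * (sqrt p * inverse p ^ (k + 1))) (at p)" if p: "p > 0" for p
  proof -
    \<comment> \<open>This rewriting brings the derivative of the root back into the family sqrt x /
      x^k.\<close>
    have s: "inverse (sqrt p) = sqrt p * inverse p"
      using p real_sqrt_mult_self[of p] by (simp add: field_simps)
    from DERIV_mult[OF DERIV_real_sqrt[OF p] DERIV_inverse_power[of p k]] p
    show ?thesis unfolding f s by (simp add: algebra_simps)
  qed
  show "\<exists>g\<in>range (\<lambda>k x. sqrt x * inverse x ^ k). \<exists>h\<in>range (\<lambda>k x. sqrt x * inverse x ^ k).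
      \<exists>a b. \<forall>x\<in>{0<..}. (f has_real_derivative a * g x + b * h x) (at x)"
    by (rule bexI[OF _ rangeI[of _ "k + 1"]], rule bexI[OF _ rangeI[of _ 0]],
        rule exI[of _ "1/2 - real k"], rule exI[of _ 0])
       (use D in auto)
qed auto

lemma smooth_divide:
  fixes f g :: "'a::real_normed_vector \<Rightarrow> real"
  assumes "smooth f" "smooth g" "\<And>p. g p \<noteq> 0"
  shows "smooth (\<lambda>p. f p / g p)"
proof -
  have "smooth (\<lambda>p. inverse (g p))"
    by (rule smooth_on_compose[OF smooth_on_inverse assms(2)]) (use assms(3) in auto)
  from smooth_mult[OF assms(1) this] show ?thesis by (simp add: field_simps)
qed

definition bump :: "real \<Rightarrow> real" where
  "bump t = flat_exp 0 (2 - t) / (flat_exp 0 (2 - t) + flat_exp 0 (t - 1))"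

lemma bump_1: "t \<le> 1 \<Longrightarrow> bump t = 1" and bump_0: "t \<ge> 2 \<Longrightarrow> bump t = 0"
  by (auto simp: bump_def flat_exp_def)

lemma smooth_bump: "smooth bump"
proof -
  \<comment> \<open>The arguments 2 - t and t - 1 add up to 1, so at least one of them is
    positive.\<close>
  have "flat_exp 0 (2 - t) + flat_exp 0 (t - 1) \<noteq> 0" for t
    by (smt (verit) exp_gt_zero flat_exp_def div_by_1 power_0)
  then show ?thesis
    unfolding bump_def
    by (intro smooth_divide smooth_add smooth_compose[OF smooth_flat_exp] smooth_intros)
qed

section \<open>Globally smooth representatives of germs\<close>

text \<open>Multiplication by a cutoff in the squared distance from p, which unlike the distance is
  smooth at p. The factor 2 / e^2 brings the argument of \<open>bump\<close> to at least 2 outside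
  the ball of radius e and below 1 inside the ball of radius e / 2.\<close>

lemma ex_smooth_eq_near:
  fixes f :: "'a::euclidean_space \<Rightarrow> 'b::real_normed_vector"
  assumes "smooth_on S f" "open S" "p \<in> S"
  shows "\<exists>F. smooth F \<and> (\<forall>\<^sub>F z in nhds p. F z = f z)"
proof -
  obtain e where e: "e > 0" "cball p e \<subseteq> S"
    using assms open_contains_cball by blast
  define b where "b z = bump (2 / e^2 * ((z - p) \<bullet> (z - p)))" for z
  define F where "F z = b z *\<^sub>R f z" for z
  have b: "smooth b"
    unfolding b_def by (intro smooth_compose[OF smooth_bump] smooth_intros)
  have "smooth F"
  proof (rule smooth_on_local)
    fix q :: 'a
    show "\<exists>T. open T \<and> q \<in> T \<and> smooth_on T F"
    proof (cases "q \<in> S")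
      case True
      then show ?thesis
        unfolding F_def using assms b
        by (intro exI[of _ S] conjI smooth_on_bilinear[OF bounded_bilinear_scaleR])
           (auto intro: smooth_on_subset)
    next
      case False
      have "smooth_on (- cball p e) F"
      proof (rule smooth_on_cong[of _ "\<lambda>_. 0"])
        show "smooth_on (- cball p e) (\<lambda>_. 0)" by (rule smooth_on_const) auto
        fix z assume "z \<in> - cball p e"
        then have "e^2 \<le> (z - p) \<bullet> (z - p)"
          using e by (simp add: dist_norm norm_minus_commute dot_square_norm power_mono)
        then show "0 = F z"
          using e by (simp add: F_def b_def bump_0 field_simps)
      qed
      then show ?thesis
        using False e by (intro exI[of _ "- cball p e"]) auto
    qed
  qed auto
  moreover have "\<forall>\<^sub>F z in nhds p. F z = f z"
  proof -
    have "\<forall>\<^sub>F z in nhds p. dist z p < e / 2"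
      using e by (intro eventually_nhds_metric[THEN iffD2] exI[of _ "e / 2"]) auto
    then show ?thesis
    proof eventually_elim
      case (elim z)
      have "(z - p) \<bullet> (z - p) \<le> (e / 2)^2"
        unfolding dot_square_norm using elim by (intro power_mono) (auto simp: dist_norm)
      also have "\<dots> \<le> e^2 / 2" using e by (simp add: power2_eq_square)
      finally show ?case
        using e by (simp add: F_def b_def bump_1 field_simps)
    qed
  qed
  ultimately show ?thesis by blast
qed

lemma ex_smooth_inverse_near:
  fixes h :: "'a::euclidean_space \<Rightarrow> real"
  assumes "smooth h" "h p \<noteq> 0"
  shows "\<exists>r. smooth r \<and> (\<forall>\<^sub>F z in nhds p. r z * h z = 1)"
proof -
  have o: "open (h -` (- {0}))"
    using smooth_on_imp_continuous_on[OF assms(1)] by (intro open_vimage) auto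
  have "smooth_on (h -` (- {0})) (\<lambda>z. inverse (h z))"
    by (rule smooth_on_compose[OF smooth_on_inverse smooth_on_subset[OF assms(1)]]) (use o in auto)
  from ex_smooth_eq_near[OF this o, of p] assms obtain r
    where r: "smooth r" "\<forall>\<^sub>F z in nhds p. r z = inverse (h z)" by auto
  have "\<forall>\<^sub>F z in nhds p. h z \<noteq> 0"
    using eventually_nhds_in_open[OF o, of p] assms(2) by simp
  with r(2) have "\<forall>\<^sub>F z in nhds p. r z * h z = 1"
    by eventually_elim auto
  with r(1) show ?thesis by blast
qed

lemma ex_smooth_sqrt_near:
  fixes h :: "'a::euclidean_space \<Rightarrow> real"
  assumes "smooth h" "h p > 0"
  shows "\<exists>r. smooth r \<and> r p > 0 \<and> (\<forall>\<^sub>F z in nhds p. r z * r z = h z)"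
proof -
  have o: "open (h -` {0<..})"
    using smooth_on_imp_continuous_on[OF assms(1)] by (intro open_vimage) auto
  have "smooth_on (h -` {0<..}) (\<lambda>z. sqrt (h z))"
    by (rule smooth_on_compose[OF smooth_on_sqrt smooth_on_subset[OF assms(1)]]) (use o in auto)
  from ex_smooth_eq_near[OF this o, of p] assms obtain r
    where r: "smooth r" "\<forall>\<^sub>F z in nhds p. r z = sqrt (h z)" by auto
  have "\<forall>\<^sub>F z in nhds p. h z > 0"
    using eventually_nhds_in_open[OF o, of p] assms(2) by simp
  with r(2) have "\<forall>\<^sub>F z in nhds p. r z * r z = h z"
    by eventually_elim auto
  moreover have "r p > 0" using eventually_nhds_x_imp_x[OF r(2)] assms(2) by simp
  ultimately show ?thesis using r(1) by blast
qed

section \<open>Partial derivatives in the plane\<close>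

definition pu :: "(real \<times> real \<Rightarrow> 'b::real_normed_vector) \<Rightarrow> real \<times> real \<Rightarrow> 'b" where
  "pu f z = frechet_derivative f (at z) (1, 0)"

definition pv :: "(real \<times> real \<Rightarrow> 'b::real_normed_vector) \<Rightarrow> real \<times> real \<Rightarrow> 'b" where
  "pv f z = frechet_derivative f (at z) (0, 1)"

lemma smooth_pu: "smooth f \<Longrightarrow> smooth (\<lambda>z. pu f z)"
  and smooth_pv: "smooth f \<Longrightarrow> smooth (\<lambda>z. pv f z)"
  unfolding pu_def pv_def by (intro smooth_on_derivative open_UNIV; assumption)+

lemma has_derivative_pu_pv:
  assumes "(f has_derivative D) (at z)"
  shows "pu f z = D (1, 0)" "pv f z = D (0, 1)" "D = (\<lambda>w. fst w *\<^sub>R pu f z + snd w *\<^sub>R pv f z)"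
proof -
  show *: "pu f z = D (1, 0)" "pv f z = D (0, 1)"
    using frechet_derivative_at[OF assms] by (simp_all add: pu_def pv_def)
  interpret linear D using assms has_derivative_linear by blast
  have "D w = fst w *\<^sub>R pu f z + snd w *\<^sub>R pv f z" for w
  proof -
    have "w = fst w *\<^sub>R (1, 0) + snd w *\<^sub>R (0, 1)"
      by (cases w) simp
    then have "D w = D (fst w *\<^sub>R (1, 0) + snd w *\<^sub>R (0, 1))" by simp
    then show ?thesis unfolding add scale * .
  qed
  then show "D = (\<lambda>w. fst w *\<^sub>R pu f z + snd w *\<^sub>R pv f z)" by auto
qed

lemma smooth_has_derivative_pu_pv:
  "smooth f \<Longrightarrow> (f has_derivative (\<lambda>w. fst w *\<^sub>R pu f z + snd w *\<^sub>R pv f z)) (at z)"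
  by (rule has_derivative_eq_rhs[OF smooth_has_derivative has_derivative_pu_pv(3)[OF smooth_has_derivative]])

lemma smooth_slice_u: "smooth f \<Longrightarrow> ((\<lambda>s. f (s, v)) has_vector_derivative pu f (u, v)) (at u)"
proof -
  assume f: "smooth f"
  have "((\<lambda>s. (s, v)) has_derivative (\<lambda>h. (h, 0))) (at u)"
    by (auto intro!: derivative_eq_intros)
  from has_derivative_compose[OF this smooth_has_derivative_pu_pv[OF f]]
  show ?thesis by (simp add: has_vector_derivative_def)
qed

lemma smooth_slice_v: "smooth f \<Longrightarrow> ((\<lambda>s. f (u, s)) has_vector_derivative pv f (u, v)) (at v)"
proof -
  assume f: "smooth f"
  have "((\<lambda>s. (u, s)) has_derivative (\<lambda>h. (0, h))) (at v)"
    by (auto intro!: derivative_eq_intros)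
  from has_derivative_compose[OF this smooth_has_derivative_pu_pv[OF f]]
  show ?thesis by (simp add: has_vector_derivative_def)
qed

lemma smooth_DERIV_u: "smooth f \<Longrightarrow> ((\<lambda>s. f (s, v)) has_real_derivative pu f (u, v)) (at u)"
  and smooth_DERIV_v: "smooth f \<Longrightarrow> ((\<lambda>s. f (u, s)) has_real_derivative pv f (u, v)) (at v)"
  using smooth_slice_u smooth_slice_v by (simp_all add: has_real_derivative_iff_has_vector_derivative)

lemma pu_eventually_cong:
  assumes "\<forall>\<^sub>F z in nhds p. f z = g z"
  shows "\<forall>\<^sub>F z in nhds p. pu f z = pu g z" "\<forall>\<^sub>F z in nhds p. pv f z = pv g z"
proof -
  obtain S where S: "open S" "p \<in> S" "\<And>z. z \<in> S \<Longrightarrow> f z = g z"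
    using assms by (auto simp: eventually_nhds)
  have "(f has_derivative D) (at z) \<longleftrightarrow> (g has_derivative D) (at z)" if "z \<in> S" for z D
    using S that by (metis has_derivative_transform_within_open)
  then have "frechet_derivative f (at z) = frechet_derivative g (at z)" if "z \<in> S" for z
    unfolding frechet_derivative_def using that by simp
  then show "\<forall>\<^sub>F z in nhds p. pu f z = pu g z" "\<forall>\<^sub>F z in nhds p. pv f z = pv g z"
    unfolding pu_def pv_def using S(1,2) by (auto simp: eventually_nhds)
qed

lemma pu_const: "pu (\<lambda>_. c) = (\<lambda>_. 0)" and pv_const: "pv (\<lambda>_. c) = (\<lambda>_. 0)"
  by (auto intro!: ext has_derivative_pu_pv(1,2)[OF has_derivative_const, THEN trans])

lemma pu_fst: "pu (\<lambda>z. fst z) = (\<lambda>_. 1)" and pv_fst: "pv (\<lambda>z. fst z) = (\<lambda>_. 0)"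
  and pu_snd: "pu (\<lambda>z. snd z) = (\<lambda>_. 0)" and pv_snd: "pv (\<lambda>z. snd z) = (\<lambda>_. 1)"
  by (auto intro!: ext has_derivative_pu_pv(1,2)[OF bounded_linear_imp_has_derivative[OF bounded_linear_fst], THEN trans]
       has_derivative_pu_pv(1,2)[OF bounded_linear_imp_has_derivative[OF bounded_linear_snd], THEN trans])

context
  fixes f g :: "real \<times> real \<Rightarrow> 'b::real_normed_vector"
  assumes fg: "smooth f" "smooth g"
begin

lemma pu_add: "pu (\<lambda>z. f z + g z) = (\<lambda>z. pu f z + pu g z)"
  and pv_add: "pv (\<lambda>z. f z + g z) = (\<lambda>z. pv f z + pv g z)"
  using has_derivative_pu_pv(1,2)[OF has_derivative_add[OF fg[THEN smooth_has_derivative_pu_pv]]] by auto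

lemma pu_diff: "pu (\<lambda>z. f z - g z) = (\<lambda>z. pu f z - pu g z)"
  and pv_diff: "pv (\<lambda>z. f z - g z) = (\<lambda>z. pv f z - pv g z)"
  using has_derivative_pu_pv(1,2)[OF has_derivative_diff[OF fg[THEN smooth_has_derivative_pu_pv]]] by auto

end

lemma pu_linear_compose: "smooth f \<Longrightarrow> bounded_linear L \<Longrightarrow> pu (\<lambda>z. L (f z)) = (\<lambda>z. L (pu f z))"
  and pv_linear_compose: "smooth f \<Longrightarrow> bounded_linear L \<Longrightarrow> pv (\<lambda>z. L (f z)) = (\<lambda>z. L (pv f z))"
  using has_derivative_pu_pv(1,2)[OF bounded_linear.has_derivative[OF _ smooth_has_derivative_pu_pv]]
  by (auto simp: fun_eq_iff)

lemma pu_minus: "smooth f \<Longrightarrow> pu (\<lambda>z. - f z) = (\<lambda>z. - pu f z)"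
  and pv_minus: "smooth f \<Longrightarrow> pv (\<lambda>z. - f z) = (\<lambda>z. - pv f z)"
  using pu_linear_compose[OF _ bounded_linear_minus[OF bounded_linear_ident]]
   pv_linear_compose[OF _ bounded_linear_minus[OF bounded_linear_ident]] by auto

lemma pu_nth: "smooth f \<Longrightarrow> pu (\<lambda>z. f z $ i) = (\<lambda>z. pu f z $ i)"
  and pv_nth: "smooth f \<Longrightarrow> pv (\<lambda>z. f z $ i) = (\<lambda>z. pv f z $ i)"
  by (intro pu_linear_compose pv_linear_compose bounded_linear_vec_nth; assumption)+

lemma pu_mult: "smooth f \<Longrightarrow> smooth g \<Longrightarrow> pu (\<lambda>z. f z * g z) = (\<lambda>z. pu f z * g z + f z * pu g z)"
  and pv_mult: "smooth f \<Longrightarrow> smooth g \<Longrightarrow> pv (\<lambda>z. f z * g z) = (\<lambda>z. pv f z * g z + f z * pv g z)"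
  for f g :: "real \<times> real \<Rightarrow> real"
  using has_derivative_pu_pv(1,2)[OF has_derivative_mult[OF smooth_has_derivative_pu_pv smooth_has_derivative_pu_pv]]
  by (auto simp: fun_eq_iff add.commute)

lemma pu_compose_plane:
  assumes "smooth F" "smooth a" "smooth b"
  shows "pu (\<lambda>z. F (a z, b z)) = (\<lambda>z. pu a z *\<^sub>R pu F (a z, b z) + pu b z *\<^sub>R pv F (a z, b z))"
    and "pv (\<lambda>z. F (a z, b z)) = (\<lambda>z. pv a z *\<^sub>R pu F (a z, b z) + pv b z *\<^sub>R pv F (a z, b z))"
proof -
  have "((\<lambda>z. F (a z, b z)) has_derivative (\<lambda>w. (fst w *\<^sub>R pu a z + snd w *\<^sub>R pv a z) *\<^sub>R pu F (a z, b z) +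
      (fst w *\<^sub>R pu b z + snd w *\<^sub>R pv b z) *\<^sub>R pv F (a z, b z))) (at z)" for z
    using has_derivative_compose[OF has_derivative_Pair[OF assms(2,3)[THEN smooth_has_derivative_pu_pv]]
        smooth_has_derivative_pu_pv[OF assms(1)]] by simp
  note * = has_derivative_pu_pv(1,2)[OF this]
  show "pu (\<lambda>z. F (a z, b z)) = (\<lambda>z. pu a z *\<^sub>R pu F (a z, b z) + pu b z *\<^sub>R pv F (a z, b z))"
    and "pv (\<lambda>z. F (a z, b z)) = (\<lambda>z. pv a z *\<^sub>R pu F (a z, b z) + pv b z *\<^sub>R pv F (a z, b z))"
    using * by (auto simp: fun_eq_iff)
qed

lemmas partial_simps = pu_const pv_const pu_fst pv_fst pu_snd pv_snd pu_add pv_add pu_diff pv_diff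
  pu_minus pv_minus pu_nth pv_nth pu_mult pv_mult
lemmas smooth_partial_intros = smooth_intros smooth_pu smooth_pv

text \<open>Differentiation under the integral sign: f is recovered by integrating f_v from (x, c)
  to (x, y); this is differentiated in x, and the result in y by the fundamental theorem.\<close>

lemma pv_pu_commute:
  fixes f :: "real \<times> real \<Rightarrow> real"
  assumes "smooth f"
  shows "pv (pu f) = pu (pv f)"
proof
  fix z :: "real \<times> real"
  obtain u v where z: "z = (u, v)" by (cases z)
  \<comment> \<open>A base point to the left of v makes v interior to \<open>{c..v+1}\<close>, so
    that the derivative of the integral is two-sided.\<close>
  define c where "c = v - 1"
  have s: "smooth (pv f)" "smooth (pu (pv f))" "smooth (pu f)"
    using assms smooth_pu smooth_pv by auto
  have cont: "continuous_on A (\<lambda>x. g (h x))" if "smooth g" "continuous_on A h" for g :: "real \<times> real \<Rightarrow> real" and A and h :: "'c::t2_space \<Rightarrow> real \<times> real"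
    using continuous_on_compose2[OF smooth_on_imp_continuous_on[OF that(1)] that(2)] by auto
  have eq: "pu f (u, y) = pu f (u, c) + integral {c..y} (\<lambda>t. pu (pv f) (u, t))" if "c \<le> y" for y
  proof -
    have fy: "f (x, y) = f (x, c) + integral {c..y} (\<lambda>t. pv f (x, t))" for x
    proof -
      have "((\<lambda>t. pv f (x, t)) has_integral f (x, y) - f (x, c)) {c..y}"
        by (rule fundamental_theorem_of_calculus[OF that])
          (rule has_vector_derivative_at_within[OF smooth_slice_v[OF assms]])
      then show ?thesis by (simp add: integral_unique)
    qed
    have "((\<lambda>x. integral (cbox c y) (\<lambda>t. pv f (x, t))) has_real_derivative
        integral (cbox c y) (\<lambda>t. pu (pv f) (u, t))) (at u)"
      by (rule leibniz_rule_field_derivative[where U=UNIV and fx="\<lambda>x t. pu (pv f) (x, t)"])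
        (auto intro!: smooth_DERIV_u s integrable_continuous_real cont continuous_intros)
    from DERIV_add[OF smooth_DERIV_u[OF assms, of c u] this]
    have "((\<lambda>x. f (x, y)) has_real_derivative pu f (u, c) + integral {c..y} (\<lambda>t. pu (pv f) (u, t))) (at u)"
      unfolding fy by simp
    from DERIV_unique[OF smooth_DERIV_u[OF assms] this] show ?thesis .
  qed
  have "((\<lambda>y. integral {c..y} (\<lambda>t. pu (pv f) (u, t))) has_real_derivative pu (pv f) (u, v)) (at v within {c..v+1})"
    by (rule integral_has_real_derivative) (auto intro!: cont s continuous_intros simp: c_def)
  then have "((\<lambda>y. integral {c..y} (\<lambda>t. pu (pv f) (u, t))) has_real_derivative pu (pv f) (u, v)) (at v)"
    by (subst (asm) at_within_interior) (auto simp: c_def)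
  from DERIV_add[OF DERIV_const[of "pu f (u, c)"] this]
  have "((\<lambda>y. pu f (u, c) + integral {c..y} (\<lambda>t. pu (pv f) (u, t))) has_real_derivative pu (pv f) (u, v)) (at v)"
    by simp
  then have "((\<lambda>y. pu f (u, y)) has_real_derivative pu (pv f) (u, v)) (at v)"
  proof (rule has_field_derivative_transform_within_open[of _ _ _ "{c<..}"])
    show "pu f (u, c) + integral {c..y} (\<lambda>t. pu (pv f) (u, t)) = pu f (u, y)" if "y \<in> {c<..}" for y
      using eq[of y] that by simp
  qed (auto simp: c_def)
  from DERIV_unique[OF smooth_DERIV_v[OF s(3)] this]
  show "pv (pu f) z = pu (pv f) z" by (simp add: z)
qed

text \<open>Total differentiability follows from the two partial derivatives because the
  v-derivative belongs to the class and is therefore continuous. So derivatives only have to be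
  checked along the coordinate axes.\<close>

lemma smooth_coinduct_plane:
  fixes f :: "real \<times> real \<Rightarrow> real"
  assumes "f \<in> C"
    and step: "\<And>f. f \<in> C \<Longrightarrow> continuous_on UNIV f \<and> (\<exists>g\<in>C. \<exists>h\<in>C. \<forall>u v.
      ((\<lambda>s. f (s, v)) has_real_derivative g (u, v)) (at u) \<and>
      ((\<lambda>s. f (u, s)) has_real_derivative h (u, v)) (at v))"
  shows "smooth f"
proof (rule smooth_on_coinduct[OF open_UNIV assms(1)])
  fix f assume "f \<in> C"
  from step[OF this] obtain g h where gh: "g \<in> C" "h \<in> C"
    and Du: "\<And>u v. ((\<lambda>s. f (s, v)) has_real_derivative g (u, v)) (at u)"
    and Dv: "\<And>u v. ((\<lambda>s. f (u, s)) has_real_derivative h (u, v)) (at v)" by blast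
  have D: "(f has_derivative (\<lambda>(a, b). a * g p + b * h p)) (at p)" for p
  proof -
    obtain u v where p: "p = (u, v)" by (cases p)
    have ch: "continuous_on UNIV h" using step[OF gh(2)] by blast
    have "((\<lambda>(x, y). f (x, y)) has_derivative (\<lambda>(a, b). g (u, v) * a + blinfun_mult_right (h (u, v)) b))
        (at (u, v) within UNIV \<times> UNIV)"
    proof (rule has_derivative_partialsI[where fy="\<lambda>x y. blinfun_mult_right (h (x, y))"])
      show "((\<lambda>x. f (x, v)) has_derivative (\<lambda>a. g (u, v) * a)) (at u)"
        using Du by (simp add: has_field_derivative_def)
      show "((\<lambda>y. f (x, y)) has_derivative blinfun_apply (blinfun_mult_right (h (x, y)))) (at y)" for x y
        using Dv[of x y] by (simp add: has_field_derivative_def)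
      show "continuous (at (u, v) within UNIV \<times> UNIV) (\<lambda>(x, y). blinfun_mult_right (h (x, y)))"
        using ch bounded_linear.continuous[OF bounded_linear_blinfun_mult_right, of "at (u, v)" h]
        by (simp add: continuous_on_eq_continuous_at case_prod_unfold)
    qed auto
    then show ?thesis by (simp add: p case_prod_unfold mult.commute)
  qed
  show "\<exists>D. (\<forall>p\<in>UNIV. (f has_derivative D p) (at p)) \<and>
      (\<forall>w. \<exists>g\<in>C. \<exists>h\<in>C. \<exists>a b. \<forall>p\<in>UNIV. D p w = a *\<^sub>R g p + b *\<^sub>R h p)"
  proof (intro exI[of _ "\<lambda>p (a, b). a * g p + b * h p"] conjI ballI allI D)
    show "\<exists>g'\<in>C. \<exists>h'\<in>C. \<exists>a b. \<forall>p\<in>UNIV. (case w of (a, b) \<Rightarrow> a * g p + b * h p) = a *\<^sub>R g' p + b *\<^sub>R h' p" for w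
      by (intro bexI[OF _ gh(1)] bexI[OF _ gh(2)] exI[of _ "fst w"] exI[of _ "snd w"])
         (simp add: case_prod_unfold)
  qed
qed

section \<open>Means along rays and Hadamard division\<close>

text \<open>The weight t^j closes the family under differentiation, since a v-derivative of g(u, t
  v) brings down a factor t. For j = 0 and g = f_v this is the quotient (f(u,v) - f(u,0)) / v,
  continued smoothly to v = 0.\<close>

definition ray_mean :: "nat \<Rightarrow> (real \<times> real \<Rightarrow> real) \<Rightarrow> real \<times> real \<Rightarrow> real" where
  "ray_mean j g z = integral {0..1} (\<lambda>t. t ^ j * g (fst z, t * snd z))"

lemma smooth_ray_mean:
  assumes "smooth g"
  shows "smooth (ray_mean j g)"
proof (rule smooth_coinduct_plane[of _ "{ray_mean j g |j g. smooth g}"])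
  show "ray_mean j g \<in> {ray_mean j g |j g. smooth g}" using assms by blast
  fix f assume "f \<in> {ray_mean j g |j g. smooth g}"
  then obtain j g where f: "f = ray_mean j g" and g: "smooth g" by blast
  have cont: "continuous_on A (\<lambda>x. k (h x))" if "smooth k" "continuous_on A h"
    for k :: "real \<times> real \<Rightarrow> real" and A and h :: "'c::t2_space \<Rightarrow> real \<times> real"
    using continuous_on_compose2[OF smooth_on_imp_continuous_on[OF that(1)] that(2)] by auto
  have 1: "continuous_on UNIV f"
    unfolding f ray_mean_def interval_cbox
    by (rule integral_continuous_on_param)
       (auto simp: split_beta intro!: continuous_intros cont[OF g])
  have 2: "((\<lambda>s. f (s, v)) has_real_derivative ray_mean j (pu g) (u, v)) (at u)" for u v
    unfolding f ray_mean_def interval_cbox fst_conv snd_conv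
    by (rule leibniz_rule_field_derivative[where U=UNIV and fx="\<lambda>x t. t ^ j * pu g (x, t * v)"])
       (auto simp: split_beta intro!: continuous_intros cont[OF g] cont[OF smooth_pu[OF g]]
          smooth_DERIV_u g integrable_continuous_real DERIV_cmult)
  have 3: "((\<lambda>s. f (u, s)) has_real_derivative ray_mean (j + 1) (pv g) (u, v)) (at v)" for u v
    unfolding f ray_mean_def interval_cbox fst_conv snd_conv
  proof (rule leibniz_rule_field_derivative[where U=UNIV and fx="\<lambda>x t. t ^ (j + 1) * pv g (u, t * x)"])
    fix x t :: real
    have "((\<lambda>x. g (u, t * x)) has_real_derivative pv g (u, t * x) * t) (at x)"
      by (rule DERIV_chain2[OF smooth_DERIV_v[OF g]]) (auto intro!: derivative_eq_intros)
    from DERIV_cmult[OF this, of "t ^ j"]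
    show "((\<lambda>x. t ^ j * g (u, t * x)) has_real_derivative t ^ (j + 1) * pv g (u, t * x)) (at x)"
      by (simp add: mult_ac)
  qed (auto simp: split_beta intro!: continuous_intros cont[OF g] cont[OF smooth_pv[OF g]]
        integrable_continuous_real)
  show "continuous_on UNIV f \<and> (\<exists>g\<in>{ray_mean j g |j g. smooth g}. \<exists>h\<in>{ray_mean j g |j g. smooth g}. \<forall>u v.
      ((\<lambda>s. f (s, v)) has_real_derivative g (u, v)) (at u) \<and>
      ((\<lambda>s. f (u, s)) has_real_derivative h (u, v)) (at v))"
    using 1 2 3 smooth_pu[OF g] smooth_pv[OF g] by blast
qed

lemma hadamard:
  assumes "smooth g"
  shows "g (u, v) = g (u, 0) + v * ray_mean 0 (pv g) (u, v)"
proof -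
  have "((\<lambda>t. v * pv g (u, t * v)) has_integral g (u, 1 * v) - g (u, 0 * v)) {0..1}"
  proof (rule fundamental_theorem_of_calculus)
    fix t :: real
    have "((\<lambda>t. g (u, t * v)) has_real_derivative pv g (u, t * v) * v) (at t)"
      by (rule DERIV_chain2[OF smooth_DERIV_v[OF assms]]) (auto intro!: derivative_eq_intros)
    then show "((\<lambda>t. g (u, t * v)) has_vector_derivative v * pv g (u, t * v)) (at t within {0..1})"
      by (simp add: has_real_derivative_iff_has_vector_derivative mult.commute has_vector_derivative_at_within)
  qed simp
  then show ?thesis by (simp add: ray_mean_def integral_unique flip: integral_mult_right)
qed

lemma ray_mean_zero: "ray_mean 0 g (u, 0) = g (u, 0)"
  by (simp add: ray_mean_def)

section \<open>Whitney's theorem on even functions\<close>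

text \<open>Taylor coefficients of the infinite product of the factors 1 - x / 2^j over j \<ge> 0,
  an entire function with zeros 1, 2, 4, and so on. The recursion is its functional equation under
  doubling of x, read off on coefficients.\<close>

primrec seeley_b :: "nat \<Rightarrow> real" where
  "seeley_b 0 = 1"
| "seeley_b (Suc k) = - 2 * seeley_b k / (2 ^ Suc k - 1)"

lemma summable_seeley_b:
  assumes "x \<ge> 0"
  shows "summable (\<lambda>k. \<bar>seeley_b k\<bar> * x ^ k)"
proof -
  \<comment> \<open>The ratio of consecutive terms is 2 x / (2^(n+1) - 1). As n + 1 \<le> 2^(n+1) -
    1, the bound 4 x \<le> N makes it at most 1/2 for n \<ge> N.\<close>
  obtain N :: nat where N: "4 * x \<le> real N" using real_arch_simple by blast
  show ?thesis
  proof (rule summable_ratio_test[of "1/2" N])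
    fix n assume "N \<le> n"
    then have "4 * x \<le> real n" using N by linarith
    also have "real n + 1 \<le> 2 ^ Suc n - 1"
    proof (induction n)
      case (Suc n)
      then show ?case by (simp add: algebra_simps)
    qed simp
    finally have *: "4 * x \<le> 2 ^ Suc n - 1" by simp
    have p: "(0::real) < 2 ^ Suc n - 1" using one_less_power[of "2::real" "Suc n"] by simp
    have "\<bar>seeley_b (Suc n)\<bar> * x ^ Suc n = (2 * x / (2 ^ Suc n - 1)) * (\<bar>seeley_b n\<bar> * x ^ n)"
      using p by (simp add: abs_mult abs_divide del: power_Suc) (simp add: field_simps)
    also have "2 * x / (2 ^ Suc n - 1) \<le> 1 / 2"
      using * p by (simp add: divide_le_eq)
    finally show "norm (\<bar>seeley_b (Suc n)\<bar> * x ^ Suc n) \<le> 1 / 2 * norm (\<bar>seeley_b n\<bar> * x ^ n)"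
      using assms by (simp add: abs_mult mult_right_mono)
  qed simp
qed

lemma summable_seeley_b': "summable (\<lambda>k. seeley_b k * x ^ k)"
  by (rule summable_norm_cancel) (use summable_seeley_b[of "\<bar>x\<bar>"] in \<open>simp add: abs_mult power_abs\<close>)

text \<open>Comparing coefficients shows \<open>E(2x) = (1 - 2x) E(x)\<close> for the entire function
  \<open>E(x) = \<Sum>k. seeley_b k * x ^ k\<close>, so that \<open>E\<close> vanishes at all powers of 2.\<close>

lemma seeley_b_double:
  "(\<Sum>k. seeley_b k * (2 * x) ^ k) = (1 - 2 * x) * (\<Sum>k. seeley_b k * x ^ k)"
proof -
  note s = summable_seeley_b'
  have h: "(\<Sum>k. seeley_b k * y ^ k) = 1 + (\<Sum>k. seeley_b (Suc k) * y ^ Suc k)" for y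
    using suminf_split_head[OF s[of y]] by simp
  have s1: "summable (\<lambda>k. seeley_b (Suc k) * x ^ Suc k)"
    using s[of x] summable_Suc_iff[of "\<lambda>k. seeley_b k * x ^ k"] by blast
  have rec: "seeley_b (Suc k) * (2 * x) ^ Suc k = seeley_b (Suc k) * x ^ Suc k - 2 * x * (seeley_b k * x ^ k)" for k
  proof -
    have "(2::real) ^ Suc k - 1 \<noteq> 0" using one_less_power[of "2::real" "Suc k"] by simp
    then have "seeley_b (Suc k) * (2 ^ Suc k - 1) = - 2 * seeley_b k" by simp
    then have "seeley_b (Suc k) * 2 ^ Suc k = seeley_b (Suc k) - 2 * seeley_b k"
      by (simp add: algebra_simps del: seeley_b.simps)
    then have "seeley_b (Suc k) * 2 ^ Suc k * x ^ Suc k = (seeley_b (Suc k) - 2 * seeley_b k) * x ^ Suc k"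
      by simp
    then show ?thesis by (simp add: algebra_simps power_mult_distrib del: seeley_b.simps)
  qed
  have "(\<Sum>k. seeley_b (Suc k) * (2 * x) ^ Suc k) =
      (\<Sum>k. seeley_b (Suc k) * x ^ Suc k) - 2 * x * (\<Sum>k. seeley_b k * x ^ k)"
    unfolding rec by (subst suminf_diff[OF s1 summable_mult[OF s], symmetric])
      (simp_all add: suminf_mult[OF s])
  then show ?thesis by (simp only: h[of "2 * x"] h[of x]) (simp add: algebra_simps)
qed

lemma seeley_b_power_two: "(\<Sum>k. seeley_b k * (2 ^ m) ^ k) = 0"
proof (induction m)
  case 0
  \<comment> \<open>At x = 1/2 the factor 1 - 2 x vanishes; doubling then carries the zero from 2^m
    to 2^(m+1).\<close>
  show ?case using seeley_b_double[of "1/2"] by simp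
next
  case (Suc m)
  then show ?case using seeley_b_double[of "2 ^ m"] by simp
qed

text \<open>The divisor makes the moments at the nodes -2^k telescope: the n-th minus the (n+1)-st
  moment is (-1)^n times the sum of b_k (2^n)^k, which is 0 because 2^n is a root of the entire
  function. So all moments agree and only a normalisation remains.\<close>

definition seeley_c :: "nat \<Rightarrow> real" where
  "seeley_c k = seeley_b k / (1 + 2 ^ k)"

lemma summable_seeley_c: "summable (\<lambda>k. \<bar>seeley_c k\<bar> * (2 ^ k) ^ n)"
proof (rule summable_comparison_test'[of _ 0])
  show "summable (\<lambda>k. \<bar>seeley_b k\<bar> * (2 ^ n) ^ k)" by (rule summable_seeley_b) simp
  fix k :: nat
  have "(0::real) < 1 + 2 ^ k" by (simp add: add_pos_pos)
  then have "\<bar>seeley_c k\<bar> \<le> \<bar>seeley_b k\<bar>"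
    by (simp add: seeley_c_def divide_le_eq algebra_simps)
  then show "norm (\<bar>seeley_c k\<bar> * (2 ^ k) ^ n) \<le> \<bar>seeley_b k\<bar> * (2 ^ n) ^ k"
    by (simp add: abs_mult mult_right_mono flip: power_mult) (simp add: mult.commute mult_right_mono)
qed

lemma summable_seeley_c': "summable (\<lambda>k. seeley_c k * (- (2 ^ k)) ^ n)"
  by (rule summable_norm_cancel) (use summable_seeley_c[of n] in \<open>simp add: abs_mult power_abs\<close>)

lemma suminf_seeley_c: "(\<Sum>k. seeley_c k * (- (2 ^ k)) ^ n) = (\<Sum>k. seeley_c k)"
proof (induction n)
  case (Suc n)
  have "(\<Sum>k. seeley_c k * (- (2 ^ k)) ^ n) - (\<Sum>k. seeley_c k * (- (2 ^ k)) ^ Suc n) =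
      (\<Sum>k. seeley_c k * (- (2 ^ k)) ^ n - seeley_c k * (- (2 ^ k)) ^ Suc n)"
    by (rule suminf_diff[OF summable_seeley_c' summable_seeley_c'])
  also have "(\<lambda>k. seeley_c k * (- (2 ^ k)) ^ n - seeley_c k * (- (2 ^ k)) ^ Suc n) =
      (\<lambda>k. (- 1) ^ n * (seeley_b k * (2 ^ n) ^ k))"
  proof
    fix k
    have "(1::real) + 2 ^ k > 0" by (simp add: add_pos_pos)
    then have "seeley_c k * (1 + 2 ^ k) = seeley_b k" by (simp add: seeley_c_def)
    moreover have "seeley_c k * (- (2 ^ k)) ^ n - seeley_c k * (- (2 ^ k)) ^ Suc n
        = (seeley_c k * (1 + 2 ^ k)) * (- (2 ^ k)) ^ n" by (simp add: algebra_simps)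
    moreover have "(- (2 ^ k)) ^ n = (- 1) ^ n * ((2::real) ^ n) ^ k"
      by (subst power_minus) (simp add: mult.commute flip: power_mult)
    ultimately show "seeley_c k * (- (2 ^ k)) ^ n - seeley_c k * (- (2 ^ k)) ^ Suc n =
      (- 1) ^ n * (seeley_b k * (2 ^ n) ^ k)" by (simp add: mult_ac)
  qed
  also have "(\<Sum>k. (- 1) ^ n * (seeley_b k * (2 ^ n) ^ k)) = 0"
    by (subst suminf_mult[OF summable_seeley_b']) (simp add: seeley_b_power_two)
  finally show ?case using Suc by simp
qed simp

text \<open>The common moment must be nonzero in order to be normalised to 1. Its first four terms
  add up to 109/1890. The next one, 16/5355, is below 1/315, and from there on consecutive terms
  shrink at least by half, so the tail is at most 2/315 = 12/1890.\<close>

lemma suminf_seeley_c_pos: "(\<Sum>k. seeley_c k) > 0"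
proof -
  have s: "summable seeley_c" using summable_seeley_c'[of 0] by simp
  have b: "\<bar>seeley_c (k + 4)\<bar> \<le> 1 / 315 * (1 / 2) ^ k" for k
  proof (induction k)
    case 0
    show ?case by (simp add: seeley_c_def eval_nat_numeral)
  next
    case (Suc k)
    define t :: real where "t = 2 ^ (k + 4)"
    have t: "t \<ge> 1" by (simp add: t_def)
    have "seeley_c (Suc k + 4) = - 2 * (1 + t) / ((2 * t - 1) * (1 + 2 * t)) * seeley_c (k + 4)"
    proof -
      have "seeley_b (Suc k + 4) = - 2 * seeley_b (k + 4) / (2 * t - 1)" "2 ^ (Suc k + 4) = 2 * t"
        unfolding t_def add_Suc by (simp_all only: seeley_b.simps power_Suc)
      moreover have "seeley_b (k + 4) = seeley_c (k + 4) * (1 + t)"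
        using t unfolding seeley_c_def t_def[symmetric] by simp
      ultimately show ?thesis using t unfolding seeley_c_def[of "Suc k + 4"]
        by (simp only:) (simp add: algebra_simps)
    qed
    then have "\<bar>seeley_c (Suc k + 4)\<bar> = 2 * (1 + t) / ((2 * t - 1) * (1 + 2 * t)) * \<bar>seeley_c (k + 4)\<bar>"
      using t by (simp add: abs_mult abs_divide)
    also have "2 * (1 + t) / ((2 * t - 1) * (1 + 2 * t)) \<le> 1 / 2"
    proof -
      have "t \<ge> 16" by (simp add: t_def power_add)
      define r where "r = t * t"
      have "16 * t \<le> r" unfolding r_def using \<open>t \<ge> 16\<close> by (intro mult_right_mono) auto
      then have "4 * (1 + t) \<le> 4 * r - 1" using \<open>t \<ge> 16\<close> by simp
      also have "\<dots> = (2 * t - 1) * (1 + 2 * t)" by (simp add: r_def algebra_simps)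
      finally have "4 * (1 + t) \<le> (2 * t - 1) * (1 + 2 * t)" .
      then show ?thesis using t by (simp add: divide_le_eq mult_pos_pos)
    qed
    finally show ?case using Suc by (simp add: mult_right_mono)
  qed
  have "\<bar>\<Sum>k. seeley_c (k + 4)\<bar> \<le> (\<Sum>k. 1 / 315 * (1 / 2) ^ k)"
    using b by (intro norm_suminf_le[where 'a=real, unfolded real_norm_def]) (auto intro!: summable_mult)
  also have "\<dots> = 2 / 315" by (subst suminf_mult) (auto simp: suminf_geometric)
  finally have "(\<Sum>k. seeley_c (k + 4)) \<ge> - 2 / 315" by linarith
  moreover have "(\<Sum>k. seeley_c k) = (\<Sum>k. seeley_c (k + 4)) + (\<Sum>k<4. seeley_c k)"
    by (rule suminf_split_initial_segment[OF s])
  moreover have "(\<Sum>k<4. seeley_c k) = 1/2 - 2/3 + 4/15 - 8/189"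
    by (simp add: seeley_c_def eval_nat_numeral)
  ultimately show ?thesis by simp
qed

definition seeley_weight :: "(nat \<Rightarrow> real) \<Rightarrow> bool" where
  "seeley_weight w \<longleftrightarrow> (\<forall>n. summable (\<lambda>k. \<bar>w k\<bar> * (2 ^ k) ^ n)) \<and>
     (\<forall>n. (\<Sum>k. w k * (- (2 ^ k)) ^ n) = 1)"

lemma ex_seeley_weight: "\<exists>w. seeley_weight w"
proof
  define S where "S = (\<Sum>k. seeley_c k)"
  have S: "S > 0" using suminf_seeley_c_pos by (simp add: S_def)
  have "(\<Sum>k. seeley_c k / S * (- (2 ^ k)) ^ n) = 1" for n
    using suminf_divide[OF summable_seeley_c'[of n], of S] suminf_seeley_c[of n] S by (simp add: S_def)
  moreover have "summable (\<lambda>k. \<bar>seeley_c k / S\<bar> * (2 ^ k) ^ n)" for n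
    using summable_divide[OF summable_seeley_c[of n], of S] S by (simp add: abs_divide)
  ultimately show "seeley_weight (\<lambda>k. seeley_c k / S)"
    by (simp add: seeley_weight_def)
qed

text \<open>A y-derivative of h(u, -2^k y) produces the factor -2^k. Absorbed into the weight it
  shifts the moments by one, and since all of them are 1 nothing changes: derivatives of an
  extension are extensions of the same kind.\<close>

lemma seeley_weight_step: "seeley_weight w \<Longrightarrow> seeley_weight (\<lambda>k. w k * - (2 ^ k))"
  unfolding seeley_weight_def
proof safe
  fix n
  assume a: "\<forall>n. summable (\<lambda>k. \<bar>w k\<bar> * (2 ^ k) ^ n)" "\<forall>n. (\<Sum>k. w k * (- (2 ^ k)) ^ n) = 1"
  show "summable (\<lambda>k. \<bar>w k * - (2 ^ k)\<bar> * (2 ^ k) ^ n)"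
    using a(1)[rule_format, of "Suc n"] by (simp add: abs_mult mult_ac)
  show "(\<Sum>k. w k * - (2 ^ k) * (- (2 ^ k)) ^ n) = 1"
    using a(2)[rule_format, of "Suc n"] by (simp add: mult_ac)
qed

text \<open>For \<open>g\<close> even in the second variable, \<open>h(u,y) = g(u,\<surd>y)\<close> is extended to \<open>y < 0\<close> by a combination
  of the values \<open>h(u,-2\<^sup>ky)\<close> whose weights make all \<open>y\<close>-derivatives match at \<open>y = 0\<close>.\<close>

definition seeley_ext :: "(nat \<Rightarrow> real) \<Rightarrow> (real \<times> real \<Rightarrow> real) \<Rightarrow> real \<times> real \<Rightarrow> real" where
  "seeley_ext w g z = (if snd z \<le> 0 then \<Sum>k. w k * g (fst z, sqrt (2 ^ k * - snd z))
                        else g (fst z, sqrt (snd z)))"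

text \<open>The arguments sqrt (2^k * -y) of the series run off to infinity with k, so boundedness
  on the whole plane is needed. Compact support provides it and passes to derivatives, and evenness
  is what makes g_v divisible by v.\<close>

definition even_compact :: "(real \<times> real \<Rightarrow> real) \<Rightarrow> bool" where
  "even_compact g \<longleftrightarrow> smooth g \<and> (\<forall>u v. g (u, - v) = g (u, v)) \<and>
     (\<exists>R\<ge>0. \<forall>u v. \<bar>u\<bar> > R \<or> \<bar>v\<bar> > R \<longrightarrow> g (u, v) = 0)"

lemma partial_zero_on_open:
  assumes "open S" "\<And>z. z \<in> S \<Longrightarrow> g z = 0" "z \<in> S"
  shows "pu g z = 0" "pv g z = 0"
proof -
  have "\<forall>\<^sub>F z in nhds z. g z = 0" using assms by (auto simp: eventually_nhds)
  from eventually_nhds_x_imp_x[OF pu_eventually_cong(1)[OF this]] eventually_nhds_x_imp_x[OF pu_eventually_cong(2)[OF this]]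
  show "pu g z = 0" "pv g z = 0" by (simp_all add: pu_const pv_const)
qed

lemma open_support: "open {z :: real \<times> real. \<bar>fst z\<bar> > R \<or> \<bar>snd z\<bar> > R}"
  by (intro open_Collect_disj open_Collect_less continuous_intros)

lemma even_compact_bounded:
  assumes "even_compact g"
  shows "\<exists>B\<ge>0. \<forall>z. \<bar>g z\<bar> \<le> B"
proof -
  obtain R where R: "R \<ge> 0" "\<And>u v. \<bar>u\<bar> > R \<or> \<bar>v\<bar> > R \<Longrightarrow> g (u, v) = 0" and g: "smooth g"
    using assms unfolding even_compact_def by blast
  have "compact (g ` cbox (-R, -R) (R, R))"
    by (rule compact_continuous_image[OF continuous_on_subset[OF smooth_on_imp_continuous_on[OF g]]]) auto
  then obtain B where B: "B > 0" "\<And>z. z \<in> cbox (-R, -R) (R, R) \<Longrightarrow> \<bar>g z\<bar> \<le> B"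
    using compact_imp_bounded bounded_pos by (metis imageI real_norm_def)
  have "\<bar>g (u, v)\<bar> \<le> B" for u v
  proof (cases "\<bar>u\<bar> > R \<or> \<bar>v\<bar> > R")
    case True
    then show ?thesis using R(2) B(1) by auto
  next
    case False
    then show ?thesis by (intro B(2)) (auto simp: cbox_Pair_eq)
  qed
  then show ?thesis using B(1) by (intro exI[of _ B]) auto
qed

lemma even_compact_pu:
  assumes "even_compact g"
  shows "even_compact (pu g)"
proof -
  obtain R where R: "R \<ge> 0" "\<And>u v. \<bar>u\<bar> > R \<or> \<bar>v\<bar> > R \<Longrightarrow> g (u, v) = 0"
    and g: "smooth g" and ev: "\<And>u v. g (u, - v) = g (u, v)"
    using assms unfolding even_compact_def by blast
  have "pu g (u, - v) = pu g (u, v)" for u v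
    using smooth_DERIV_u[OF g, of "- v" u] smooth_DERIV_u[OF g, of v u] unfolding ev
    by (rule DERIV_unique)
  moreover have "pu g (u, v) = 0" if "\<bar>u\<bar> > R \<or> \<bar>v\<bar> > R" for u v
    by (rule partial_zero_on_open(1)[OF open_support[of R]]) (use R that in auto)
  ultimately show ?thesis
    using R(1) smooth_pu[OF g] unfolding even_compact_def by blast
qed

text \<open>In the variable y = v^2 the derivative of g is g_v / (2 v). As g_v is odd in v it
  vanishes on v = 0, so Hadamard division makes the quotient smooth, and it is even again.\<close>

lemma even_compact_quotient:
  assumes "even_compact g"
  shows "\<exists>h. even_compact h \<and> (\<forall>u v. pv g (u, v) = 2 * v * h (u, v))"
proof -
  obtain R where R: "R \<ge> 0" "\<And>u v. \<bar>u\<bar> > R \<or> \<bar>v\<bar> > R \<Longrightarrow> g (u, v) = 0"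
    and g: "smooth g" and ev: "\<And>u v. g (u, - v) = g (u, v)"
    using assms unfolding even_compact_def by blast
  define h where "h z = 1 / 2 * ray_mean 0 (pv (pv g)) z" for z
  have sg: "smooth (pv g)" "smooth (pv (pv g))" using g smooth_pv by auto
  have h: "smooth h"
    unfolding h_def by (intro smooth_mult smooth_const smooth_ray_mean sg)
  have odd: "pv g (u, - v) = - pv g (u, v)" for u v
  proof -
    have "((\<lambda>s. g (u, - s)) has_real_derivative pv g (u, - v) * - 1) (at v)"
      by (rule DERIV_chain2[OF smooth_DERIV_v[OF g]]) (auto intro!: derivative_eq_intros)
    from DERIV_unique[OF this[unfolded ev] smooth_DERIV_v[OF g]] show ?thesis by simp
  qed
  have eq: "pv g (u, v) = 2 * v * h (u, v)" for u v
    using hadamard[OF sg(1), of u v] odd[of u 0] by (simp add: h_def)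
  have "h (u, - v) = h (u, v)" for u v
    using eq[of u v] eq[of u "- v"] odd[of u v] by (cases "v = 0") auto
  moreover have "h (u, v) = 0" if "\<bar>u\<bar> > R \<or> \<bar>v\<bar> > R" for u v
  proof (cases "v = 0")
    case True
    \<comment> \<open>On v = 0 the quotient cannot be read off from g_v; its value there is g_vv /
      2.\<close>
    have 1: "pv g z = 0" if "\<bar>fst z\<bar> > R \<or> \<bar>snd z\<bar> > R" for z
      by (rule partial_zero_on_open(2)[OF open_support[of R]]) (use R that in auto)
    have "pv (pv g) (u, 0) = 0"
      by (rule partial_zero_on_open(2)[OF open_support[of R]]) (use 1 that True R in auto)
    then show ?thesis using True by (simp add: h_def ray_mean_zero)
  next
    case False
    have "pv g (u, v) = 0"
      by (rule partial_zero_on_open(2)[OF open_support[of R]]) (use R that in auto)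
    then show ?thesis using eq[of u v] False by simp
  qed
  ultimately have "even_compact h"
    using R(1) h unfolding even_compact_def by blast
  then show ?thesis using eq by blast
qed

text \<open>The fundamental theorem of calculus tolerates an exceptional point for a continuous F,
  so F is an integral of the continuous F' also across 0. This glues the two branches of the
  extension.\<close>

lemma DERIV_at_zero_of_continuous:
  fixes F F' :: "real \<Rightarrow> real"
  assumes "continuous_on UNIV F" "continuous_on UNIV F'"
    and D: "\<And>y. y \<noteq> 0 \<Longrightarrow> (F has_real_derivative F' y) (at y)"
  shows "(F has_real_derivative F' 0) (at 0)"
proof -
  have eq: "F y = F (- 1) + integral {-1..y} F'" if "- 1 \<le> y" for y
  proof -
    have "(F' has_integral F y - F (- 1)) {-1..y}"
      by (rule fundamental_theorem_of_calculus_strong[of "{0}"])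
         (use that D assms(1) in \<open>auto intro: continuous_on_subset simp flip: has_real_derivative_iff_has_vector_derivative\<close>)
    then show ?thesis by (simp add: integral_unique)
  qed
  have "((\<lambda>y. F (- 1) + integral {-1..y} F') has_real_derivative F' 0) (at 0)"
  proof -
    have "((\<lambda>y. integral {-1..y} F') has_real_derivative F' 0) (at 0 within {-1..1})"
      by (rule integral_has_real_derivative) (auto intro: continuous_on_subset[OF assms(2)])
    then have "((\<lambda>y. integral {-1..y} F') has_real_derivative F' 0) (at 0)"
      by (subst (asm) at_within_interior) auto
    from DERIV_add[OF DERIV_const this] show ?thesis by simp
  qed
  then show ?thesis
  proof (rule has_field_derivative_transform_within_open[of _ _ _ "{-1<..}"])
    show "F (- 1) + integral {-1..y} F' = F y" if "y \<in> {-1<..}" for y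
      using eq[of y] that by simp
  qed auto
qed

section \<open>Smoothness of the extension across y = 0\<close>

context
  fixes w :: "nat \<Rightarrow> real" and g :: "real \<times> real \<Rightarrow> real"
  assumes w: "seeley_weight w" and g: "even_compact g"
begin

lemma seeley_smooth: "smooth g"
  using g by (simp add: even_compact_def)

lemma seeley_cont: "continuous_on A h \<Longrightarrow> continuous_on A (\<lambda>x. g (h x))"
  for h :: "'c::t2_space \<Rightarrow> real \<times> real"
  using continuous_on_compose2[OF smooth_on_imp_continuous_on[OF seeley_smooth]] by auto

text \<open>The majorant \<open>\<bar>w k\<bar> * B\<close> uses only a bound B of g, so the
  arguments \<open>c k x\<close> may be arbitrary; this covers the series of the extension and, with
  the shifted weight, that of its derivative.\<close>

lemma seeley_uniform: "uniform_limit X (\<lambda>n x. \<Sum>k<n. w k * g (c k x)) (\<lambda>x. \<Sum>k. w k * g (c k x)) sequentially"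
proof -
  obtain B where B: "B \<ge> 0" "\<And>z. \<bar>g z\<bar> \<le> B"
    using even_compact_bounded[OF g] by blast
  show ?thesis
  proof (rule Weierstrass_m_test)
    show "norm (w k * g (c k x)) \<le> \<bar>w k\<bar> * B" for k x
      using B by (simp add: abs_mult mult_left_mono)
    show "summable (\<lambda>k. \<bar>w k\<bar> * B)"
      using w[unfolded seeley_weight_def, THEN conjunct1, rule_format, of 0]
      by (intro summable_mult2) simp
  qed
qed

lemma seeley_summable: "summable (\<lambda>k. w k * g (c k))"
  using tendsto_uniform_limitI[OF seeley_uniform[where X="{0::real}" and c="\<lambda>k _. c k"], of 0]
  by (auto simp: summable_def sums_def)

lemma seeley_at_zero: "(\<Sum>k. w k * g (u, 0)) = g (u, 0)"
proof -
  have "summable w"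
    using w[unfolded seeley_weight_def, THEN conjunct1, rule_format, of 0]
    by (simp add: summable_rabs_cancel)
  moreover have "(\<Sum>k. w k) = 1"
    using w[unfolded seeley_weight_def, THEN conjunct2, rule_format, of 0] by simp
  ultimately show ?thesis by (simp flip: suminf_mult2)
qed

lemma continuous_on_seeley_ext: "continuous_on UNIV (seeley_ext w g)"
proof -
  have "continuous_on {z \<in> UNIV. snd z \<le> 0} (\<lambda>z::real\<times>real. \<Sum>k. w k * g (fst z, sqrt (2 ^ k * - snd z)))"
    by (rule uniform_limit_theorem[OF _ seeley_uniform])
       (auto intro!: always_eventually continuous_intros seeley_cont)
  moreover have "continuous_on {z \<in> UNIV. 0 \<le> snd z} (\<lambda>z::real\<times>real. g (fst z, sqrt (snd z)))"
    by (intro continuous_intros seeley_cont)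
  ultimately show ?thesis
    unfolding seeley_ext_def[abs_def]
    by (intro continuous_on_cases_le) (auto simp: seeley_at_zero intro!: continuous_intros)
qed

text \<open>For v \<noteq> 0 the root of v^2 is |v| and evenness finishes; v = 0 falls into the
  series branch, where the zeroth moment gives the value.\<close>

lemma seeley_ext_square: "seeley_ext w g (u, v\<^sup>2) = g (u, v)"
  using g seeley_at_zero by (cases "v \<ge> 0") (auto simp: seeley_ext_def even_compact_def)

end

lemma DERIV_seeley_ext_u:
  assumes w: "seeley_weight w" and g: "even_compact g"
  shows "((\<lambda>s. seeley_ext w g (s, y)) has_real_derivative seeley_ext w (pu g) (u, y)) (at u)"
proof (cases "y \<le> 0")
  case True
  have "((\<lambda>s. \<Sum>k. w k * g (s, sqrt (2 ^ k * - y))) has_real_derivative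
      (\<Sum>k. w k * pu g (u, sqrt (2 ^ k * - y)))) (at u)"
  proof (rule has_field_derivative_series'(2)[of UNIV _ _ u])
    show "uniformly_convergent_on UNIV (\<lambda>n x. \<Sum>k<n. w k * pu g (x, sqrt (2 ^ k * - y)))"
      using seeley_uniform[OF w even_compact_pu[OF g]] by (rule uniformly_convergentI)
    show "summable (\<lambda>n. w n * g (u, sqrt (2 ^ n * - y)))"
      by (rule seeley_summable[OF w g])
  qed (auto intro!: DERIV_cmult smooth_DERIV_u seeley_smooth[OF w g])
  then show ?thesis using True by (simp add: seeley_ext_def)
next
  case False
  then show ?thesis
    using smooth_DERIV_u[OF seeley_smooth[OF w g]] by (simp add: seeley_ext_def)
qed

text \<open>The derivative of g(u, sqrt(c s)) is c h(u, sqrt(c s)), because the factor 2 v in g_v =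
  2 v h cancels the derivative of the root. With c = -2^k this is the shifted weight. The point y =
  0 is reached by continuity of both extensions, without one-sided estimates.\<close>

lemma DERIV_seeley_ext_v:
  assumes w: "seeley_weight w" and g: "even_compact g" and h: "even_compact h"
    and gh: "\<And>u v. pv g (u, v) = 2 * v * h (u, v)"
  shows "((\<lambda>s. seeley_ext w g (u, s)) has_real_derivative seeley_ext (\<lambda>k. w k * - (2 ^ k)) h (u, y)) (at y)"
proof -
  let ?w = "\<lambda>k. w k * - (2 ^ k)"
  note w' = seeley_weight_step[OF w]
  have D: "((\<lambda>s. g (u, sqrt (c * s))) has_real_derivative c * h (u, sqrt (c * s))) (at s)"
    if "c * s > 0" for c s
  proof -
    have "((\<lambda>s. sqrt (c * s)) has_real_derivative c * (inverse (sqrt (c * s)) / 2)) (at s)"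
      using that by (auto intro!: derivative_eq_intros)
    from DERIV_chain2[OF smooth_DERIV_v[OF seeley_smooth[OF w g]] this]
    have "((\<lambda>s. g (u, sqrt (c * s))) has_real_derivative
        2 * sqrt (c * s) * h (u, sqrt (c * s)) * (c * (inverse (sqrt (c * s)) / 2))) (at s)"
      unfolding gh .
    moreover have "2 * r * x * (c * (inverse r / 2)) = c * x" if "r > 0" for r x :: real
      using that by simp
    moreover have "sqrt (c * s) > 0" using that by simp
    ultimately show ?thesis by metis
  qed
  have neq: "((\<lambda>s. seeley_ext w g (u, s)) has_real_derivative seeley_ext ?w h (u, y)) (at y)" if "y \<noteq> 0" for y
  proof (cases "y < 0")
    case True
    have "((\<lambda>s. \<Sum>k. w k * g (u, sqrt (2 ^ k * - s))) has_real_derivative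
        (\<Sum>k. ?w k * h (u, sqrt (2 ^ k * - y)))) (at y)"
    proof (rule has_field_derivative_series'(2)[of "{..<0}" _ _ y])
      show "uniformly_convergent_on {..<0} (\<lambda>n x. \<Sum>k<n. ?w k * h (u, sqrt (2 ^ k * - x)))"
        using seeley_uniform[OF w' h] by (rule uniformly_convergentI)
      show "summable (\<lambda>n. w n * g (u, sqrt (2 ^ n * - y)))"
        by (rule seeley_summable[OF w g])
      fix k and x :: real assume "x \<in> {..<0}"
      then have "- (2 ^ k) * x > 0" by (simp add: mult_pos_neg)
      from DERIV_cmult[OF D[OF this], of "w k"]
      have "((\<lambda>s. w k * g (u, sqrt (2 ^ k * - s))) has_real_derivative ?w k * h (u, sqrt (2 ^ k * - x))) (at x)"
        by (simp add: mult_ac)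
      then show "((\<lambda>s. w k * g (u, sqrt (2 ^ k * - s))) has_real_derivative ?w k * h (u, sqrt (2 ^ k * - x)))
          (at x within {..<0})"
        by (rule has_field_derivative_at_within)
    qed (use True in \<open>auto simp: interior_open\<close>)
    then have "((\<lambda>s. \<Sum>k. w k * g (u, sqrt (2 ^ k * - s))) has_real_derivative seeley_ext ?w h (u, y)) (at y)"
      using True by (simp add: seeley_ext_def)
    then show ?thesis
      by (rule has_field_derivative_transform_within_open[of _ _ _ "{..<0}"])
         (use True in \<open>auto simp: seeley_ext_def\<close>)
  next
    case False
    then have "y > 0" using that by simp
    with D[of 1 y] have "((\<lambda>s. g (u, sqrt s)) has_real_derivative seeley_ext ?w h (u, y)) (at y)"
      by (simp add: seeley_ext_def)
    then show ?thesis
      by (rule has_field_derivative_transform_within_open[of _ _ _ "{0<..}"])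
         (use \<open>y > 0\<close> in \<open>auto simp: seeley_ext_def\<close>)
  qed
  have slice: "continuous_on UNIV (\<lambda>s::real. f (u, s))" if "continuous_on UNIV f" for f :: "real \<times> real \<Rightarrow> real"
    by (rule continuous_on_compose2[OF that]) (auto intro!: continuous_intros)
  show ?thesis
  proof (cases "y = 0")
    case True
    show ?thesis unfolding True
      by (rule DERIV_at_zero_of_continuous[of _ "\<lambda>y. seeley_ext ?w h (u, y)"])
         (rule slice, rule continuous_on_seeley_ext[OF w g], rule slice,
          rule continuous_on_seeley_ext[OF w' h], rule neq)
  qed (rule neq)
qed

text \<open>The class ranges over all weights and all functions together, because a v-derivative
  replaces both.\<close>

lemma smooth_seeley_ext:
  assumes "seeley_weight w" "even_compact g"
  shows "smooth (seeley_ext w g)"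
proof (rule smooth_coinduct_plane[of _ "{seeley_ext w g |w g. seeley_weight w \<and> even_compact g}"])
  show "seeley_ext w g \<in> {seeley_ext w g |w g. seeley_weight w \<and> even_compact g}"
    using assms by blast
  fix f assume "f \<in> {seeley_ext w g |w g. seeley_weight w \<and> even_compact g}"
  then obtain w g where f: "f = seeley_ext w g" and w: "seeley_weight w" and g: "even_compact g" by blast
  obtain h where h: "even_compact h" "\<And>u v. pv g (u, v) = 2 * v * h (u, v)"
    using even_compact_quotient[OF g] by blast
  have "seeley_ext w (pu g) \<in> {seeley_ext w g |w g. seeley_weight w \<and> even_compact g}"
    "seeley_ext (\<lambda>k. w k * - (2 ^ k)) h \<in> {seeley_ext w g |w g. seeley_weight w \<and> even_compact g}"
    using w seeley_weight_step[OF w] even_compact_pu[OF g] h(1) by blast+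
  then show "continuous_on UNIV f \<and> (\<exists>fu\<in>{seeley_ext w g |w g. seeley_weight w \<and> even_compact g}.
      \<exists>fv\<in>{seeley_ext w g |w g. seeley_weight w \<and> even_compact g}. \<forall>u v.
      ((\<lambda>s. f (s, v)) has_real_derivative fu (u, v)) (at u) \<and>
      ((\<lambda>s. f (u, s)) has_real_derivative fv (u, v)) (at v))"
    unfolding f
    using continuous_on_seeley_ext[OF w g] DERIV_seeley_ext_u[OF w g] DERIV_seeley_ext_v[OF w g h]
    by blast
qed

theorem whitney_even:
  fixes e :: "real \<times> real \<Rightarrow> real"
  assumes "smooth e" "\<And>u v. e (u, - v) = e (u, v)"
  shows "\<exists>H. smooth H \<and> (\<forall>u v. \<bar>u\<bar> \<le> 1 \<longrightarrow> \<bar>v\<bar> \<le> 1 \<longrightarrow> e (u, v) = H (u, v\<^sup>2))"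
proof -
  \<comment> \<open>A cutoff in v^2 preserves evenness; both cutoffs are 1 on the unit square, where
    the conclusion is claimed.\<close>
  define g where "g z = e z * (bump (fst z * fst z) * bump (snd z * snd z))" for z :: "real \<times> real"
  have "smooth g"
    unfolding g_def by (intro smooth_mult assms smooth_compose[OF smooth_bump] smooth_intros)
  moreover have "g (u, v) = 0" if "\<bar>u\<bar> > 2 \<or> \<bar>v\<bar> > 2" for u v
  proof -
    have "t * t \<ge> 2" if "\<bar>t\<bar> > 2" for t :: real
      using that mult_mono[of 2 "\<bar>t\<bar>" 1 "\<bar>t\<bar>"] by simp
    with that show ?thesis by (auto simp: g_def bump_0)
  qed
  ultimately have g: "even_compact g"
    unfolding even_compact_def using assms(2) by (auto simp: g_def intro!: exI[of _ 2])
  obtain w where w: "seeley_weight w" using ex_seeley_weight by blast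
  have "g (u, v) = e (u, v)" if "\<bar>u\<bar> \<le> 1" "\<bar>v\<bar> \<le> 1" for u v
  proof -
    have "t * t \<le> 1" if "\<bar>t\<bar> \<le> 1" for t :: real
      using that mult_mono[of "\<bar>t\<bar>" 1 "\<bar>t\<bar>" 1] by simp
    with that show ?thesis by (simp add: g_def bump_1)
  qed
  with seeley_ext_square[OF w g] smooth_seeley_ext[OF w g] show ?thesis
    by (intro exI[of _ "seeley_ext w g"]) auto
qed

section \<open>Local diffeomorphisms and equivalence of germs\<close>

text \<open>Germs are represented by globally smooth maps, which are inverse to each other only near the
  base points.\<close>

definition local_diffeo ::
  "('a::real_normed_vector \<Rightarrow> 'b::real_normed_vector) \<Rightarrow> ('b \<Rightarrow> 'a) \<Rightarrow> 'a \<Rightarrow> 'b \<Rightarrow> bool" where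
  "local_diffeo \<sigma> \<sigma>' p q \<longleftrightarrow> smooth \<sigma> \<and> smooth \<sigma>' \<and> \<sigma> p = q \<and> \<sigma>' q = p \<and>
     (\<forall>\<^sub>F z in nhds p. \<sigma>' (\<sigma> z) = z) \<and> (\<forall>\<^sub>F y in nhds q. \<sigma> (\<sigma>' y) = y)"

definition germ_equiv ::
  "('a::real_normed_vector \<Rightarrow> 'b::real_normed_vector) \<Rightarrow> 'a \<Rightarrow> ('a \<Rightarrow> 'b) \<Rightarrow> 'a \<Rightarrow> bool" where
  "germ_equiv f p g q \<longleftrightarrow> (\<exists>\<sigma> \<sigma>' \<tau> \<tau>'. local_diffeo \<sigma> \<sigma>' p q \<and> local_diffeo \<tau> \<tau>' (f p) (g q) \<and>
     (\<forall>\<^sub>F z in nhds p. \<tau> (f z) = g (\<sigma> z)))"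

lemma local_diffeo_sym: "local_diffeo \<sigma> \<sigma>' p q \<Longrightarrow> local_diffeo \<sigma>' \<sigma> q p"
  by (auto simp: local_diffeo_def)

lemma local_diffeo_global:
  "smooth \<sigma> \<Longrightarrow> smooth \<sigma>' \<Longrightarrow> (\<And>z. \<sigma>' (\<sigma> z) = z) \<Longrightarrow> (\<And>y. \<sigma> (\<sigma>' y) = y) \<Longrightarrow> \<sigma> p = q \<Longrightarrow> local_diffeo \<sigma> \<sigma>' p q"
  by (auto simp: local_diffeo_def)

lemma local_diffeo_compose:
  fixes \<sigma> :: "'a::euclidean_space \<Rightarrow> 'b::euclidean_space" and \<rho> :: "'b \<Rightarrow> 'c::euclidean_space"
  assumes "local_diffeo \<sigma> \<sigma>' p q" "local_diffeo \<rho> \<rho>' q r"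
  shows "local_diffeo (\<lambda>z. \<rho> (\<sigma> z)) (\<lambda>y. \<sigma>' (\<rho>' y)) p r"
proof -
  have 1: "\<forall>\<^sub>F z in nhds p. \<rho>' (\<rho> (\<sigma> z)) = \<sigma> z"
    by (rule smooth_eventually[of \<sigma> _ p]) (use assms in \<open>auto simp: local_diffeo_def\<close>)
  have 2: "\<forall>\<^sub>F y in nhds r. \<sigma> (\<sigma>' (\<rho>' y)) = \<rho>' y"
    by (rule smooth_eventually[of \<rho>' _ r]) (use assms in \<open>auto simp: local_diffeo_def\<close>)
  have "\<forall>\<^sub>F z in nhds p. \<sigma>' (\<rho>' (\<rho> (\<sigma> z))) = z"
    using 1 assms(1)[unfolded local_diffeo_def, THEN conjunct2, THEN conjunct2, THEN conjunct2, THEN conjunct2, THEN conjunct1]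
    by eventually_elim simp
  moreover have "\<forall>\<^sub>F y in nhds r. \<rho> (\<sigma> (\<sigma>' (\<rho>' y))) = y"
    using 2 assms(2)[unfolded local_diffeo_def, THEN conjunct2, THEN conjunct2, THEN conjunct2, THEN conjunct2, THEN conjunct2]
    by eventually_elim simp
  ultimately show ?thesis
    using assms by (simp add: local_diffeo_def smooth_compose)
qed

lemma local_diffeo_diffeomorphism:
  fixes \<sigma> :: "'a::euclidean_space \<Rightarrow> 'b::euclidean_space"
  assumes "local_diffeo \<sigma> \<sigma>' p q" "open W" "p \<in> W"
  shows "\<exists>U V. diffeomorphism U V \<sigma> \<sigma>' \<and> p \<in> U \<and> U \<subseteq> W"
proof -
  have s: "smooth \<sigma>" "smooth \<sigma>'" and pq: "\<sigma> p = q" "\<sigma>' q = p"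
    using assms by (auto simp: local_diffeo_def)
  obtain A where A: "open A" "p \<in> A" "\<And>z. z \<in> A \<Longrightarrow> \<sigma>' (\<sigma> z) = z"
    using assms(1) by (auto simp: local_diffeo_def eventually_nhds)
  obtain B where B: "open B" "q \<in> B" "\<And>y. y \<in> B \<Longrightarrow> \<sigma> (\<sigma>' y) = y"
    using assms(1) by (auto simp: local_diffeo_def eventually_nhds)
  \<comment> \<open>U is trimmed so that \<sigma> maps it into B, and V is pulled back from U
    afterwards; in this order each map sends its set into the other.\<close>
  define U where "U = A \<inter> \<sigma> -` B \<inter> W"
  define V where "V = B \<inter> \<sigma>' -` U"
  have oU: "open U"
    unfolding U_def using A B assms smooth_on_imp_continuous_on[OF s(1)] by (auto intro!: open_Int open_vimage)
  have oV: "open V"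
    unfolding V_def using B oU smooth_on_imp_continuous_on[OF s(2)] by (auto intro!: open_Int open_vimage)
  have "homeomorphism U V \<sigma> \<sigma>'"
  proof (rule homeomorphismI)
    show "continuous_on U \<sigma>" "continuous_on V \<sigma>'"
      using s smooth_on_imp_continuous_on continuous_on_subset by blast+
  qed (use A B in \<open>auto simp: U_def V_def\<close>)
  then have "diffeomorphism U V \<sigma> \<sigma>'"
    unfolding diffeomorphism_def
    by (intro conjI oU oV smooth_on_subset[OF s(1)] smooth_on_subset[OF s(2)]) auto
  moreover have "p \<in> U" "U \<subseteq> W" using A B pq assms by (auto simp: U_def)
  ultimately show ?thesis by blast
qed

lemma diffeomorphism_local_diffeo:
  fixes \<sigma> :: "'a::euclidean_space \<Rightarrow> 'b::euclidean_space"
  assumes "diffeomorphism U V \<sigma> \<sigma>'" "p \<in> U"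
  shows "\<exists>S S'. local_diffeo S S' p (\<sigma> p) \<and> (\<forall>\<^sub>F z in nhds p. S z = \<sigma> z)"
proof -
  have U: "open U" "open V" and h: "homeomorphism U V \<sigma> \<sigma>'" and s: "smooth_on U \<sigma>" "smooth_on V \<sigma>'"
    using assms(1) by (auto simp: diffeomorphism_def)
  have q: "\<sigma> p \<in> V" and p: "\<sigma>' (\<sigma> p) = p" and i: "\<And>z. z \<in> U \<Longrightarrow> \<sigma>' (\<sigma> z) = z" "\<And>y. y \<in> V \<Longrightarrow> \<sigma> (\<sigma>' y) = y"
    using h assms(2) by (auto simp: homeomorphism_def)
  obtain S where S: "smooth S" "\<forall>\<^sub>F z in nhds p. S z = \<sigma> z"
    using ex_smooth_eq_near[OF s(1) U(1) assms(2)] by blast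
  obtain S' where S': "smooth S'" "\<forall>\<^sub>F y in nhds (\<sigma> p). S' y = \<sigma>' y"
    using ex_smooth_eq_near[OF s(2) U(2) q] by blast
  have pq: "S p = \<sigma> p" "S' (\<sigma> p) = p"
    using eventually_nhds_x_imp_x[OF S(2)] eventually_nhds_x_imp_x[OF S'(2)] p by auto
  have 1: "\<forall>\<^sub>F z in nhds p. S' (S z) = \<sigma>' (S z)"
    by (rule smooth_eventually[OF S(1)]) (use S'(2) pq in simp)
  have 2: "\<forall>\<^sub>F y in nhds (\<sigma> p). S (S' y) = \<sigma> (S' y)"
    by (rule smooth_eventually[OF S'(1)]) (use S(2) pq in simp)
  have "\<forall>\<^sub>F z in nhds p. S' (S z) = z"
    using 1 S(2) eventually_nhds_in_open[OF U(1) assms(2)] by eventually_elim (simp add: i)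
  moreover have "\<forall>\<^sub>F y in nhds (\<sigma> p). S (S' y) = y"
    using 2 S'(2) eventually_nhds_in_open[OF U(2) q] by eventually_elim (simp add: i)
  ultimately show ?thesis using S S' pq unfolding local_diffeo_def by blast
qed

text \<open>In one direction the image of U must lie in the domain of the target diffeomorphism, in
  the other an identity valid near f p must be used at f z. Both rest on continuity of f at
  p.\<close>

lemma A_equivalent_iff_germ_equiv:
  fixes f :: "'a::euclidean_space \<Rightarrow> 'b::euclidean_space"
  assumes "isCont f p"
  shows "A_equivalent f p g q \<longleftrightarrow> germ_equiv f p g q"
proof
  assume "A_equivalent f p g q"
  then obtain U V \<sigma> \<sigma>' U' V' \<tau> \<tau>' where 1: "diffeomorphism U V \<sigma> \<sigma>'" "p \<in> U" "\<sigma> p = q"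
    and 2: "diffeomorphism U' V' \<tau> \<tau>'" "f p \<in> U'" "\<tau> (f p) = g q"
    and 3: "\<forall>z\<in>U. \<tau> (f z) = g (\<sigma> z)"
    unfolding A_equivalent_def by (elim exE conjE) rule
  obtain S S' where S: "local_diffeo S S' p q" "\<forall>\<^sub>F z in nhds p. S z = \<sigma> z"
    using diffeomorphism_local_diffeo[OF 1(1,2)] 1(3) by blast
  obtain T T' where T: "local_diffeo T T' (f p) (g q)" "\<forall>\<^sub>F z in nhds (f p). T z = \<tau> z"
    using diffeomorphism_local_diffeo[OF 2(1,2)] 2(3) by metis
  have "filterlim f (nhds (f p)) (nhds p)"
    using assms by (simp add: continuous_at tendsto_nhds_iff)
  then have "\<forall>\<^sub>F z in nhds p. T (f z) = \<tau> (f z)"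
    by (rule eventually_compose_filterlim[OF T(2)])
  moreover have "\<forall>\<^sub>F z in nhds p. z \<in> U"
    using 1 by (intro eventually_nhds_in_open) (auto simp: diffeomorphism_def)
  ultimately have "\<forall>\<^sub>F z in nhds p. T (f z) = g (S z)"
    using S(2) by eventually_elim (simp add: 3)
  then show "germ_equiv f p g q"
    using S T unfolding germ_equiv_def by blast
next
  assume "germ_equiv f p g q"
  then obtain \<sigma> \<sigma>' \<tau> \<tau>' where S: "local_diffeo \<sigma> \<sigma>' p q" and T: "local_diffeo \<tau> \<tau>' (f p) (g q)"
    and e: "\<forall>\<^sub>F z in nhds p. \<tau> (f z) = g (\<sigma> z)"
    unfolding germ_equiv_def by blast
  obtain U' V' where T': "diffeomorphism U' V' \<tau> \<tau>'" "f p \<in> U'"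
    using local_diffeo_diffeomorphism[OF T open_UNIV] by blast
  have "filterlim f (nhds (f p)) (nhds p)"
    using assms by (simp add: continuous_at tendsto_nhds_iff)
  moreover have "\<forall>\<^sub>F y in nhds (f p). y \<in> U'"
    using T' by (intro eventually_nhds_in_open) (auto simp: diffeomorphism_def)
  ultimately have "\<forall>\<^sub>F z in nhds p. f z \<in> U'"
    using eventually_compose_filterlim by blast
  with e have "\<forall>\<^sub>F z in nhds p. f z \<in> U' \<and> \<tau> (f z) = g (\<sigma> z)"
    by eventually_elim simp
  then obtain W where W: "open W" "p \<in> W" "\<And>z. z \<in> W \<Longrightarrow> f z \<in> U' \<and> \<tau> (f z) = g (\<sigma> z)"
    by (auto simp: eventually_nhds)
  obtain U V where U: "diffeomorphism U V \<sigma> \<sigma>'" "p \<in> U" "U \<subseteq> W"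
    using local_diffeo_diffeomorphism[OF S W(1,2)] by blast
  have "\<sigma> p = q" "\<tau> (f p) = g q" using S T by (auto simp: local_diffeo_def)
  moreover have "f ` U \<subseteq> U'" "\<forall>z\<in>U. \<tau> (f z) = g (\<sigma> z)" using W U by blast+
  ultimately show "A_equivalent f p g q"
    unfolding A_equivalent_def using U T' by blast
qed

lemma germ_equiv_trans:
  fixes f g h :: "'a::euclidean_space \<Rightarrow> 'b::euclidean_space"
  assumes "germ_equiv f p g q" "germ_equiv g q h r"
  shows "germ_equiv f p h r"
proof -
  obtain \<sigma> \<sigma>' \<tau> \<tau>' where 1: "local_diffeo \<sigma> \<sigma>' p q" "local_diffeo \<tau> \<tau>' (f p) (g q)"
    "\<forall>\<^sub>F z in nhds p. \<tau> (f z) = g (\<sigma> z)" using assms(1) unfolding germ_equiv_def by blast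
  obtain \<rho> \<rho>' \<upsilon> \<upsilon>' where 2: "local_diffeo \<rho> \<rho>' q r" "local_diffeo \<upsilon> \<upsilon>' (g q) (h r)"
    "\<forall>\<^sub>F z in nhds q. \<upsilon> (g z) = h (\<rho> z)" using assms(2) unfolding germ_equiv_def by blast
  have "\<forall>\<^sub>F z in nhds p. \<upsilon> (g (\<sigma> z)) = h (\<rho> (\<sigma> z))"
    by (rule smooth_eventually[of \<sigma>]) (use 1 2 in \<open>auto simp: local_diffeo_def\<close>)
  with 1(3) have "\<forall>\<^sub>F z in nhds p. \<upsilon> (\<tau> (f z)) = h (\<rho> (\<sigma> z))"
    by eventually_elim simp
  with local_diffeo_compose[OF 1(1) 2(1)] local_diffeo_compose[OF 1(2) 2(2)] show ?thesis
    unfolding germ_equiv_def by blast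
qed

lemma germ_equiv_source:
  fixes f g :: "'a::euclidean_space \<Rightarrow> 'b::euclidean_space"
  assumes "local_diffeo \<sigma> \<sigma>' p q" "\<forall>\<^sub>F z in nhds p. f z = g (\<sigma> z)"
  shows "germ_equiv f p g q"
proof -
  have "f p = g q" using eventually_nhds_x_imp_x[OF assms(2)] assms(1) by (simp add: local_diffeo_def)
  then have "local_diffeo (\<lambda>y. y) (\<lambda>y. y) (f p) (g q)" by (auto intro: local_diffeo_global smooth_ident)
  with assms show ?thesis unfolding germ_equiv_def by blast
qed

lemma germ_equiv_target:
  fixes f g :: "'a::euclidean_space \<Rightarrow> 'b::euclidean_space"
  assumes "local_diffeo \<tau> \<tau>' (f p) (g p)" "\<forall>\<^sub>F z in nhds p. \<tau> (f z) = g z"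
  shows "germ_equiv f p g p"
proof -
  have "local_diffeo (\<lambda>y. y) (\<lambda>y. y) p p" by (auto intro: local_diffeo_global smooth_ident)
  with assms show ?thesis unfolding germ_equiv_def by blast
qed

section \<open>Inverse functions of smooth plane maps\<close>

definition jacobian :: "(real \<times> real \<Rightarrow> real \<times> real) \<Rightarrow> real \<times> real \<Rightarrow> real" where
  "jacobian \<sigma> z = fst (pu \<sigma> z) * snd (pv \<sigma> z) - fst (pv \<sigma> z) * snd (pu \<sigma> z)"

lemma smooth_jacobian: "smooth \<sigma> \<Longrightarrow> smooth (jacobian \<sigma>)"
  unfolding jacobian_def[abs_def] by (intro smooth_partial_intros; assumption)

text \<open>The inverse function theorem yields a differentiable inverse g whose derivative is the
  inverse Jacobian matrix at g y. By Cramer's rule this is a smooth function of g y, so if g is C^k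
  then so is its derivative, and smoothness follows by bootstrapping.\<close>

lemma ex_local_diffeo:
  assumes s: "smooth \<sigma>" and J: "jacobian \<sigma> p \<noteq> 0"
  shows "\<exists>\<sigma>'. local_diffeo \<sigma> \<sigma>' p (\<sigma> p)"
proof -
  define U where "U = jacobian \<sigma> -` (- {0})"
  have U: "open U" "p \<in> U"
    unfolding U_def using J smooth_on_imp_continuous_on[OF smooth_jacobian[OF s]] by (auto intro!: open_vimage)
  define D where "D z w = fst w *\<^sub>R pu \<sigma> z + snd w *\<^sub>R pv \<sigma> z" for z w
  have D: "(\<sigma> has_derivative D z) (at z)" for z
    unfolding D_def by (rule smooth_has_derivative_pu_pv[OF s])
  define E where "E z w = (inverse (jacobian \<sigma> z) * (snd (pv \<sigma> z) * fst w - fst (pv \<sigma> z) * snd w),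
    inverse (jacobian \<sigma> z) * (fst (pu \<sigma> z) * snd w - snd (pu \<sigma> z) * fst w))" for z and w :: "real \<times> real"
  have ED: "E z (D z w) = w" if "z \<in> U" for z w
    using that unfolding E_def D_def U_def
    by (auto simp: prod_eq_iff field_simps) (auto simp: jacobian_def algebra_simps)
  have DE: "D z (E z w) = w" if "z \<in> U" for z w
    using that unfolding E_def D_def U_def
    by (auto simp: prod_eq_iff field_simps) (auto simp: jacobian_def algebra_simps)
  have bE: "bounded_linear (E z)" for z
    unfolding linear_conv_bounded_linear[symmetric]
    by (rule linearI) (auto simp: E_def algebra_simps)
  define f' where "f' z = Blinfun (D z)" for z
  have f': "blinfun_apply (f' z) = D z" for z
    unfolding f'_def by (rule bounded_linear_Blinfun_apply[OF has_derivative_bounded_linear[OF D]])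
  have cf': "continuous_on U f'"
  proof (rule continuous_on_blinfun_componentwise)
    show "continuous_on U (\<lambda>z. blinfun_apply (f' z) i)" for i
      unfolding f' D_def
      by (intro continuous_on_subset[OF smooth_on_imp_continuous_on, of UNIV] smooth_partial_intros s) auto
  qed
  have inv_f': "Blinfun (E p) o\<^sub>L f' p = id_blinfun"
    by (rule blinfun_eqI) (simp add: f' bounded_linear_Blinfun_apply[OF bE] ED[OF U(2)])
  have df': "(\<sigma> has_derivative blinfun_apply (f' z)) (at z)" for z
    unfolding f' by (rule D)
  obtain U' V g g' where g: "open U'" "U' \<subseteq> U" "p \<in> U'" "open V" "\<sigma> p \<in> V"
    "homeomorphism U' V \<sigma> g" "\<And>y. y \<in> V \<Longrightarrow> (g has_derivative (g' y)) (at y)"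
    "\<And>y. y \<in> V \<Longrightarrow> g' y = inv (blinfun_apply (f' (g y)))"
    by (rule inverse_function_theorem[OF U(1) df' cf' U(2) inv_f']) rule
  have gU: "g y \<in> U'" "\<sigma> (g y) = y" if "y \<in> V" for y
    using g(6) that by (auto simp: homeomorphism_def)
  have gd: "(g has_derivative E (g y)) (at y)" if "y \<in> V" for y
  proof -
    have "g y \<in> U" using gU that g(2) by blast
    then have "inv (D (g y)) = E (g y)"
      using ED DE by (intro inv_equality) auto
    then show ?thesis using g(7,8)[OF that] by (simp add: f')
  qed
  have "Ck_on k V g" for k
  proof (induction k)
    case 0
    show ?case using g(6) by (simp add: homeomorphism_def)
  next
    case (Suc k)
    show ?case
    proof (rule Ck_on_SucI[OF g(4) gd])
      fix w
      have "smooth_on U (\<lambda>z. inverse (jacobian \<sigma> z))"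
        by (rule smooth_on_compose[OF smooth_on_inverse smooth_on_subset[OF smooth_jacobian[OF s]]])
           (use U in \<open>auto simp: U_def\<close>)
      moreover have "smooth_on U (\<lambda>z. (snd (pv \<sigma> z) * fst w - fst (pv \<sigma> z) * snd w,
          fst (pu \<sigma> z) * snd w - snd (pu \<sigma> z) * fst w))"
        by (rule smooth_on_subset[of UNIV]) (intro smooth_partial_intros s U | simp)+
      ultimately have "smooth_on U (\<lambda>z. inverse (jacobian \<sigma> z) *\<^sub>R (snd (pv \<sigma> z) * fst w - fst (pv \<sigma> z) * snd w,
          fst (pu \<sigma> z) * snd w - snd (pu \<sigma> z) * fst w))"
        by (rule smooth_on_bilinear[OF bounded_bilinear_scaleR U(1)])
      then have "smooth_on U (\<lambda>z. E z w)"
        by (simp add: E_def)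
      then show "Ck_on k V (\<lambda>y. E (g y) w)"
        by (intro Ck_on_compose[OF g(4) U(1) _ Suc]) (use gU g(2) in \<open>auto simp: smooth_on_def\<close>)
    qed
  qed
  then have "diffeomorphism U' V \<sigma> g"
    unfolding diffeomorphism_def using g smooth_on_subset[OF s] by (auto simp: smooth_on_def)
  then have sg: "smooth_on V g" and hom: "homeomorphism U' V \<sigma> g" by (auto simp: diffeomorphism_def)
  obtain G where G: "smooth G" "\<forall>\<^sub>F y in nhds (\<sigma> p). G y = g y"
    using ex_smooth_eq_near[OF sg g(4,5)] by blast
  have "\<forall>\<^sub>F z in nhds p. G (\<sigma> z) = g (\<sigma> z)"
    by (rule smooth_eventually[OF s G(2)])
  then have 1: "\<forall>\<^sub>F z in nhds p. G (\<sigma> z) = z"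
    using eventually_nhds_in_open[OF g(1,3)] by eventually_elim (use hom in \<open>auto simp: homeomorphism_def\<close>)
  have "\<forall>\<^sub>F y in nhds (\<sigma> p). \<sigma> (G y) = y"
    using G(2) eventually_nhds_in_open[OF g(4,5)] by eventually_elim (use gU in auto)
  then have "local_diffeo \<sigma> G p (\<sigma> p)"
    using s G(1) 1 eventually_nhds_x_imp_x[OF 1] by (simp add: local_diffeo_def)
  then show ?thesis by blast
qed

text \<open>For germs (u, v^2, w), rescaling u in the source by a function of u and v^2 is visible
  in the first two target coordinates; this is the matching target change.\<close>

definition lift3 :: "(real \<times> real \<Rightarrow> real \<times> real) \<Rightarrow> real^3 \<Rightarrow> real^3" where
  "lift3 \<kappa> x = vector [fst (\<kappa> (x $ 1, x $ 2)), snd (\<kappa> (x $ 1, x $ 2)), x $ 3]"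

lemma smooth_lift3:
  assumes "smooth \<kappa>"
  shows "smooth (lift3 \<kappa>)"
proof -
  have "smooth (\<lambda>x::real^3. \<kappa> (x $ 1, x $ 2))"
    by (rule smooth_compose[OF assms]) (intro smooth_intros)
  then show ?thesis
    unfolding lift3_def[abs_def] by (intro smooth_vector_3 smooth_fst_compose smooth_snd_compose smooth_intros)
qed

lemma local_diffeo_lift3:
  assumes "local_diffeo \<kappa> \<kappa>' (x $ 1, x $ 2) q"
  shows "local_diffeo (lift3 \<kappa>) (lift3 \<kappa>') x (lift3 \<kappa> x)"
proof -
  have s: "smooth \<kappa>" "smooth \<kappa>'" and q: "\<kappa> (x $ 1, x $ 2) = q" "\<kappa>' q = (x $ 1, x $ 2)"
    using assms by (auto simp: local_diffeo_def)
  have sp: "smooth (\<lambda>y::real^3. (y $ 1, y $ 2))" by (intro smooth_intros)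
  have "\<forall>\<^sub>F y in nhds x. \<kappa>' (\<kappa> (y $ 1, y $ 2)) = (y $ 1, y $ 2)"
    by (rule smooth_eventually[OF sp]) (use assms in \<open>simp add: local_diffeo_def\<close>)
  then have 1: "\<forall>\<^sub>F y in nhds x. lift3 \<kappa>' (lift3 \<kappa> y) = y"
    by eventually_elim (simp add: lift3_def vec_eq_iff forall_3)
  have "\<forall>\<^sub>F y in nhds (lift3 \<kappa> x). \<kappa> (\<kappa>' (y $ 1, y $ 2)) = (y $ 1, y $ 2)"
    by (rule smooth_eventually[OF sp]) (use assms q in \<open>simp add: local_diffeo_def lift3_def\<close>)
  then have "\<forall>\<^sub>F y in nhds (lift3 \<kappa> x). lift3 \<kappa> (lift3 \<kappa>' y) = y"
    by eventually_elim (simp add: lift3_def vec_eq_iff forall_3)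
  with 1 s show ?thesis
    using eventually_nhds_x_imp_x[OF 1] by (simp add: local_diffeo_def smooth_lift3)
qed

section \<open>Invariance of the 2-jet of the discriminant function\<close>

definition det3 :: "real^3 \<Rightarrow> real^3 \<Rightarrow> real^3 \<Rightarrow> real" where
  "det3 a b c = a$1 * b$2 * c$3 + a$2 * b$3 * c$1 + a$3 * b$1 * c$2
              - a$1 * b$3 * c$2 - a$2 * b$1 * c$3 - a$3 * b$2 * c$1"

lemma det_vector_3: "det (vector [a, b, c] :: real^3^3) = det3 a b c"
  by (simp add: det_3 det3_def)

lemma smooth_det3:
  assumes "smooth a" "smooth b" "smooth c"
  shows "smooth (\<lambda>z. det3 (a z) (b z) (c z))"
  unfolding det3_def by (intro smooth_intros assms)

lemma partial_det3:
  assumes "smooth a" "smooth b" "smooth c"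
  shows "pu (\<lambda>z. det3 (a z) (b z) (c z)) =
      (\<lambda>z. det3 (pu a z) (b z) (c z) + det3 (a z) (pu b z) (c z) + det3 (a z) (b z) (pu c z))"
    and "pv (\<lambda>z. det3 (a z) (b z) (c z)) =
      (\<lambda>z. det3 (pv a z) (b z) (c z) + det3 (a z) (pv b z) (c z) + det3 (a z) (b z) (pv c z))"
  unfolding det3_def
  by (simp_all add: partial_simps smooth_intros assms) (simp_all add: algebra_simps)

lemma pv_pu_commute_vec:
  fixes f :: "real \<times> real \<Rightarrow> real^'n"
  assumes "smooth f"
  shows "pv (pu f) = pu (pv f)"
proof
  fix z
  have "pv (pu f) z $ i = pu (pv f) z $ i" for i
    using fun_cong[OF pv_pu_commute[OF smooth_nth[OF assms]], of i z]
    by (simp add: pu_nth pv_nth assms smooth_pu smooth_pv)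
  then show "pv (pu f) z = pu (pv f) z" by (simp add: vec_eq_iff)
qed

section \<open>Order of vanishing and Hessian determinants\<close>

text \<open>Membership in the k-th power of the ideal of functions vanishing at p, phrased through
  all partial derivatives of order below k. In this form products follow from Leibniz's rule without
  Taylor expansions. A critical point with value 0 is \<open>vanishes 2\<close>, and equality of
  2-jets is \<open>vanishes 3\<close> of the difference.\<close>

primrec vanishes :: "nat \<Rightarrow> (real \<times> real \<Rightarrow> real) \<Rightarrow> real \<times> real \<Rightarrow> bool" where
  "vanishes 0 f p \<longleftrightarrow> True"
| "vanishes (Suc k) f p \<longleftrightarrow> f p = 0 \<and> vanishes k (pu f) p \<and> vanishes k (pv f) p"

lemma vanishes_mono: "vanishes (Suc k) f p \<Longrightarrow> vanishes k f p"
proof (induction k arbitrary: f)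
  case (Suc k)
  have "f p = 0" "vanishes (Suc k) (pu f) p" "vanishes (Suc k) (pv f) p"
    using Suc.prems unfolding vanishes.simps(2)[of "Suc k"] by blast+
  with Suc.IH show ?case unfolding vanishes.simps(2)[of k] by blast
qed simp

lemma vanishes_cong:
  "\<forall>\<^sub>F z in nhds p. f z = g z \<Longrightarrow> vanishes k f p \<longleftrightarrow> vanishes k g p"
proof (induction k arbitrary: f g)
  case (Suc k)
  show ?case
    by (simp only: vanishes.simps Suc.IH[OF pu_eventually_cong(1)[OF Suc.prems]]
        Suc.IH[OF pu_eventually_cong(2)[OF Suc.prems]] eventually_nhds_x_imp_x[OF Suc.prems])
qed simp

lemma vanishes_add:
  "smooth f \<Longrightarrow> smooth g \<Longrightarrow> vanishes k f p \<Longrightarrow> vanishes k g p \<Longrightarrow> vanishes k (\<lambda>z. f z + g z) p"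
  by (induction k arbitrary: f g) (auto simp: partial_simps smooth_pu smooth_pv)

text \<open>A derivative falls on one factor and lowers its order by one. A factor of order 0 has
  nothing to lose, but then the other factor has one order to spare.\<close>

lemma vanishes_mult:
  "smooth f \<Longrightarrow> smooth g \<Longrightarrow> vanishes i f p \<Longrightarrow> vanishes j g p \<Longrightarrow> vanishes (i + j) (\<lambda>z. f z * g z) p"
proof (induction "i + j" arbitrary: i j f g)
  case (Suc n)
  note s = Suc.prems(1,2) Suc.prems(1,2)[THEN smooth_pu] Suc.prems(1,2)[THEN smooth_pv]
  have 1: "vanishes n (\<lambda>z. h z * g z) p" if h: "h = pu f \<or> h = pv f" for h
  proof (cases i)
    case 0
    then have "j = Suc n" using Suc.hyps by simp
    then have "vanishes n g p" using Suc.prems(4) vanishes_mono by blast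
    then show ?thesis using Suc.hyps(1)[of 0 n h g] h s by auto
  next
    case (Suc i')
    then have "vanishes i' h p" using h Suc.prems(3) by auto
    then show ?thesis using Suc.hyps(1)[of i' j h g] Suc.hyps(2) Suc Suc.prems(4) h s by auto
  qed
  have 2: "vanishes n (\<lambda>z. f z * h z) p" if h: "h = pu g \<or> h = pv g" for h
  proof (cases j)
    case 0
    then have "i = Suc n" using Suc.hyps by simp
    then have "vanishes n f p" using Suc.prems(3) vanishes_mono by blast
    then show ?thesis using Suc.hyps(1)[of n 0 f h] h s by auto
  next
    case (Suc j')
    then have "vanishes j' h p" using h Suc.prems(4) by auto
    then show ?thesis using Suc.hyps(1)[of i j' f h] Suc.hyps(2) Suc Suc.prems(3) h s by auto
  qed
  have "f p * g p = 0"
    using Suc.hyps(2) Suc.prems(3,4) by (cases i; cases j) auto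
  moreover have "vanishes n (\<lambda>z. pu f z * g z + f z * pu g z) p" "vanishes n (\<lambda>z. pv f z * g z + f z * pv g z) p"
    using 1 2 s by (auto intro!: vanishes_add smooth_mult)
  ultimately show ?case
    unfolding Suc.hyps(2)[symmetric] by (simp add: pu_mult pv_mult s)
qed simp

definition hess :: "(real \<times> real \<Rightarrow> real) \<Rightarrow> real \<times> real \<Rightarrow> real" where
  "hess f p = pu (pu f) p * pv (pv f) p - (pv (pu f) p)^2"

lemma vanishes_2: "vanishes 2 f p \<longleftrightarrow> f p = 0 \<and> pu f p = 0 \<and> pv f p = 0"
  by (auto simp: numeral_2_eq_2)

lemma vanishes_diff_scaled_2:
  assumes "smooth f" "smooth g" "vanishes 2 (\<lambda>z. g z - \<kappa> * f z) p" "\<kappa> \<noteq> 0"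
  shows "vanishes 2 g p \<longleftrightarrow> vanishes 2 f p"
  using assms by (auto simp: vanishes_2 partial_simps smooth_intros smooth_mult)

text \<open>The Hessian determinant is quadratic in the 2-jet, hence the square; the sign of
  \<kappa> does not matter.\<close>

lemma vanishes_diff_scaled_3:
  assumes "smooth f" "smooth g" "vanishes 3 (\<lambda>z. g z - \<kappa> * f z) p"
  shows "hess g p = \<kappa>\<^sup>2 * hess f p"
  using assms
  by (simp add: numeral_3_eq_3 hess_def partial_simps smooth_partial_intros smooth_mult)
     (simp add: algebra_simps power2_eq_square)

text \<open>At a critical point the second derivatives of \<sigma> meet only the vanishing gradient,
  so the Hessian changes as a quadratic form and its determinant by the squared Jacobian. For the
  converse the gradient is recovered by inverting the transposed Jacobian matrix.\<close>

lemma hess_compose: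
  fixes \<sigma> :: "real \<times> real \<Rightarrow> real \<times> real"
  assumes s: "smooth \<psi>" "smooth \<sigma>"
  shows "vanishes 2 \<psi> (\<sigma> p) \<Longrightarrow> vanishes 2 (\<lambda>z. \<psi> (\<sigma> z)) p"
    and "vanishes 2 \<psi> (\<sigma> p) \<Longrightarrow> hess (\<lambda>z. \<psi> (\<sigma> z)) p = (jacobian \<sigma> p)\<^sup>2 * hess \<psi> (\<sigma> p)"
    and "jacobian \<sigma> p \<noteq> 0 \<Longrightarrow> vanishes 2 (\<lambda>z. \<psi> (\<sigma> z)) p \<Longrightarrow> vanishes 2 \<psi> (\<sigma> p)"
proof -
  define a b where "a z = fst (\<sigma> z)" and "b z = snd (\<sigma> z)" for z
  have ab: "smooth a" "smooth b" and \<sigma>: "\<sigma> z = (a z, b z)" for z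
    unfolding a_def b_def by (auto intro!: smooth_fst_compose smooth_snd_compose s)
  have p: "pu a = (\<lambda>z. fst (pu \<sigma> z))" "pv a = (\<lambda>z. fst (pv \<sigma> z))"
     "pu b = (\<lambda>z. snd (pu \<sigma> z))" "pv b = (\<lambda>z. snd (pv \<sigma> z))"
    unfolding a_def b_def using s(2)
    by (simp_all add: pu_linear_compose pv_linear_compose bounded_linear_fst bounded_linear_snd)
  note sm = ab ab[THEN smooth_pu] ab[THEN smooth_pv] s(1) s(1)[THEN smooth_pu] s(1)[THEN smooth_pv]
    smooth_compose[OF s(1) smooth_Pair[OF ab]] smooth_compose[OF smooth_pu[OF s(1)] smooth_Pair[OF ab]]
    smooth_compose[OF smooth_pv[OF s(1)] smooth_Pair[OF ab]]
  note d = pu_compose_plane[OF s(1) ab] pu_compose_plane[OF smooth_pu[OF s(1)] ab]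
    pu_compose_plane[OF smooth_pv[OF s(1)] ab]
  have J: "jacobian \<sigma> z = pu a z * pv b z - pv a z * pu b z" for z
    by (simp add: jacobian_def p)
  show "vanishes 2 \<psi> (\<sigma> p) \<Longrightarrow> vanishes 2 (\<lambda>z. \<psi> (\<sigma> z)) p"
    by (simp add: vanishes_2 \<sigma> d)
  show "vanishes 2 \<psi> (\<sigma> p) \<Longrightarrow> hess (\<lambda>z. \<psi> (\<sigma> z)) p = (jacobian \<sigma> p)\<^sup>2 * hess \<psi> (\<sigma> p)"
    unfolding J \<sigma> vanishes_2 hess_def
    by (simp add: d partial_simps smooth_mult sm fun_cong[OF pv_pu_commute[OF s(1)]] del: split_paired_All)
       (simp add: algebra_simps power2_eq_square)
  assume "jacobian \<sigma> p \<noteq> 0" "vanishes 2 (\<lambda>z. \<psi> (\<sigma> z)) p"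
  then have 0: "\<psi> (\<sigma> p) = 0" and 1: "pu a p * pu \<psi> (\<sigma> p) + pu b p * pv \<psi> (\<sigma> p) = 0"
    and 2: "pv a p * pu \<psi> (\<sigma> p) + pv b p * pv \<psi> (\<sigma> p) = 0"
    by (simp_all add: vanishes_2 \<sigma> d)
  have "jacobian \<sigma> p * pu \<psi> (\<sigma> p) = 0" "jacobian \<sigma> p * pv \<psi> (\<sigma> p) = 0"
    using 1 2 unfolding J by algebra+
  with 0 \<open>jacobian \<sigma> p \<noteq> 0\<close> show "vanishes 2 \<psi> (\<sigma> p)" by (simp add: vanishes_2)
qed

section \<open>The discriminant under a change of vector fields\<close>

definition Phi :: "(real \<times> real \<Rightarrow> real^3) \<Rightarrow> real \<times> real \<Rightarrow> real" where
  "Phi f z = det3 (pu f z) (pv f z) (pv (pv f) z)"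

definition lie :: "(real \<times> real \<Rightarrow> real) \<Rightarrow> (real \<times> real \<Rightarrow> real) \<Rightarrow> (real \<times> real \<Rightarrow> 'b::real_normed_vector) \<Rightarrow> real \<times> real \<Rightarrow> 'b" where
  "lie b a f z = b z *\<^sub>R pu f z + a z *\<^sub>R pv f z"

lemma smooth_Phi: "smooth f \<Longrightarrow> smooth (Phi f)"
  unfolding Phi_def[abs_def] by (intro smooth_det3 smooth_pu smooth_pv; assumption)

lemma smooth_lie: "smooth b \<Longrightarrow> smooth a \<Longrightarrow> smooth f \<Longrightarrow> smooth (lie b a f)"
  unfolding lie_def[abs_def] by (intro smooth_partial_intros; assumption)

lemma pu_scaleR: "smooth c \<Longrightarrow> smooth f \<Longrightarrow> pu (\<lambda>z. c z *\<^sub>R f z) = (\<lambda>z. pu c z *\<^sub>R f z + c z *\<^sub>R pu f z)"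
  and pv_scaleR: "smooth c \<Longrightarrow> smooth f \<Longrightarrow> pv (\<lambda>z. c z *\<^sub>R f z) = (\<lambda>z. pv c z *\<^sub>R f z + c z *\<^sub>R pv f z)"
  using has_derivative_pu_pv(1,2)[OF has_derivative_scaleR[OF smooth_has_derivative_pu_pv smooth_has_derivative_pu_pv]]
  by (auto simp: fun_eq_iff add.commute)

text \<open>For \<xi> = (c, d) and \<eta> = (b, a) this covers \<open>Phi\<close>, with the
  coordinate fields, as well as the \<phi> of the theorem, with c = 1 and d = 0. Comparing the two
  becomes a question about changing fields.\<close>

definition Phi_fields where
  "Phi_fields c d b a f z = det3 (lie c d f z) (lie b a f z) (lie b a (lie b a f) z)"

lemma smooth_Phi_fields:
  "smooth c \<Longrightarrow> smooth d \<Longrightarrow> smooth b \<Longrightarrow> smooth a \<Longrightarrow> smooth f \<Longrightarrow> smooth (Phi_fields c d b a f)"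
  unfolding Phi_fields_def[abs_def] by (intro smooth_det3 smooth_lie; assumption)

context
  fixes f :: "real \<times> real \<Rightarrow> real^3" and p
  assumes f: "smooth f" and fv: "pv f p = 0"
begin

lemma vanishes_Phi: "vanishes 1 (Phi f) p"
  by (simp add: Phi_def det3_def fv)

lemma pv_Phi: "pv (Phi f) p = 0"
  unfolding Phi_def[abs_def]
  by (simp add: partial_det3 f smooth_pu smooth_pv fv) (simp add: det3_def)

lemma lie_lie_at:
  assumes "smooth b" "smooth a" "b p = 0"
  shows "\<exists>s. lie b a (lie b a f) p = (a p)\<^sup>2 *\<^sub>R pv (pv f) p + s *\<^sub>R pu f p"
proof
  show "lie b a (lie b a f) p = (a p)\<^sup>2 *\<^sub>R pv (pv f) p + (a p * pv b p) *\<^sub>R pu f p"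
    unfolding lie_def
    by (simp add: partial_simps pu_scaleR pv_scaleR smooth_partial_intros assms f fv power2_eq_square
        algebra_simps)
qed

text \<open>Up to the factor c a - d b the first two entries may be replaced by f_u and f_v. Modulo
  these, the terms of \<eta>\<eta>f that differentiate a and b disappear, and a^2 f_vv + 2 a b f_uv
  + b^2 f_uu remains.\<close>

lemma Phi_fields_expand:
  assumes "smooth b" "smooth a"
  shows "Phi_fields c d b a f z = (c z * a z - d z * b z) *
    ((a z)\<^sup>2 * Phi f z + 2 * a z * b z * det3 (pu f z) (pv f z) (pu (pv f) z)
      + (b z)\<^sup>2 * det3 (pu f z) (pv f z) (pu (pu f) z))"
  unfolding Phi_fields_def Phi_def lie_def
  by (simp add: partial_simps pu_scaleR pv_scaleR smooth_partial_intros assms f pv_pu_commute_vec[OF f])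
     (simp add: det3_def algebra_simps power2_eq_square power3_eq_cube)

text \<open>The difference consists of three products: a function vanishing at p times Phi, a
  multiple of b times P, and a multiple of b^2 times Q. As f_v = 0 at p, all of Phi, P and Q vanish
  there, so the order is at least 2, and the product with b^2 has order 3 outright. If Phi is
  critical, so is P, and the other two gain one order.\<close>

lemma Phi_fields_vanishes:
  assumes s: "smooth c" "smooth d" "smooth b" "smooth a" and b: "b p = 0"
  defines "\<kappa> \<equiv> c p * a p * (a p)\<^sup>2"
  shows "vanishes 2 (\<lambda>z. Phi_fields c d b a f z - \<kappa> * Phi f z) p"
    and "vanishes 2 (Phi f) p \<Longrightarrow> vanishes 3 (\<lambda>z. Phi_fields c d b a f z - \<kappa> * Phi f z) p"
proof -
  define A where "A z = (c z * a z - d z * b z) * (a z)\<^sup>2 - \<kappa>" for z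
  define B where "B z = (c z * a z - d z * b z) * (2 * a z)" for z
  define C where "C z = c z * a z - d z * b z" for z
  define P where "P z = det3 (pu f z) (pv f z) (pu (pv f) z)" for z
  define Q where "Q z = det3 (pu f z) (pv f z) (pu (pu f) z)" for z
  have sm: "smooth A" "smooth B" "smooth C" "smooth P" "smooth Q" "smooth (Phi f)"
    unfolding A_def B_def C_def P_def Q_def
    by (intro smooth_det3 smooth_partial_intros s f smooth_Phi)+
  have eq: "(\<lambda>z. Phi_fields c d b a f z - \<kappa> * Phi f z) =
     (\<lambda>z. A z * Phi f z + ((B z * b z) * P z + (C z * b z) * (b z * Q z)))"
    unfolding Phi_fields_expand[OF s(3,4)] A_def B_def C_def P_def Q_def
    by (rule ext) (simp add: algebra_simps power2_eq_square)
  have A: "vanishes 1 A p" using b by (simp add: A_def \<kappa>_def)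
  have b1: "vanishes 1 b p" using b by simp
  have P1: "vanishes 1 P p" "vanishes 1 Q p" by (simp_all add: P_def Q_def det3_def fv)
  have Bb: "vanishes 1 (\<lambda>z. B z * b z) p" and Cb: "vanishes 1 (\<lambda>z. C z * b z) p" using b by simp_all
  have bQ: "vanishes 2 (\<lambda>z. b z * Q z) p"
    using vanishes_mult[OF s(3) sm(5) b1 P1(2)] by (simp add: numeral_2_eq_2)
  have CQ: "vanishes 3 (\<lambda>z. (C z * b z) * (b z * Q z)) p"
    using vanishes_mult[OF _ _ Cb bQ] sm s by (simp add: smooth_mult numeral_3_eq_3)
  have 2: "vanishes 2 (\<lambda>z. A z * Phi f z) p" "vanishes 2 (\<lambda>z. (B z * b z) * P z) p"
    using vanishes_mult[OF sm(1,6) A vanishes_Phi] vanishes_mult[OF smooth_mult[OF sm(2) s(3)] sm(4) Bb P1(1)]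
    by (simp_all add: numeral_2_eq_2)
  show "vanishes 2 (\<lambda>z. Phi_fields c d b a f z - \<kappa> * Phi f z) p"
    unfolding eq using 2 vanishes_mono[of 2, folded numeral_3_eq_3, simplified, OF CQ] sm s
    by (intro vanishes_add smooth_add smooth_mult) auto
  assume c: "vanishes 2 (Phi f) p"
  have "pu (Phi f) p = 0" using c by (simp add: vanishes_2)
  \<comment> \<open>This is the u-derivative of Phi at p. Up to sign it is also the v-derivative of
    P, while the u-derivative det(f_u, f_uv, f_uv) of P is zero anyway.\<close>
  then have c': "det3 (pu f p) (pu (pv f) p) (pv (pv f) p) = 0"
    unfolding Phi_def[abs_def]
    by (simp add: partial_det3 f smooth_pu smooth_pv fv) (simp add: det3_def fv)
  have "det3 (pu f p) (pv (pv f) p) (pu (pv f) p) = - det3 (pu f p) (pu (pv f) p) (pv (pv f) p)"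
    by (simp add: det3_def algebra_simps)
  with c' have c'': "det3 (pu f p) (pv (pv f) p) (pu (pv f) p) = 0" by simp
  have "det3 x y y = 0" "det3 x 0 y = 0" "det3 x y 0 = 0" for x y by (simp_all add: det3_def)
  then have "pv P p = 0" "pu P p = 0" unfolding P_def[abs_def] using c''
    by (simp_all add: partial_det3 f smooth_pu smooth_pv fv pv_pu_commute_vec)
  then have P2: "vanishes 2 P p" using P1 by (simp add: vanishes_2)
  have 3: "vanishes 3 (\<lambda>z. A z * Phi f z) p" "vanishes 3 (\<lambda>z. (B z * b z) * P z) p"
    using vanishes_mult[OF sm(1,6) A c] vanishes_mult[OF smooth_mult[OF sm(2) s(3)] sm(4) Bb P2]
    by (simp_all add: numeral_3_eq_3)
  show "vanishes 3 (\<lambda>z. Phi_fields c d b a f z - \<kappa> * Phi f z) p"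
    unfolding eq using 3 CQ sm s by (intro vanishes_add smooth_add smooth_mult) auto
qed

end

section \<open>The discriminant under target diffeomorphisms\<close>

lemma linear_expand_3:
  fixes L :: "real^3 \<Rightarrow> 'b::real_vector"
  assumes "linear L"
  shows "L w = (\<Sum>j\<in>UNIV. (w $ j) *\<^sub>R L (axis j 1))"
proof -
  have "L w = L (\<Sum>j\<in>UNIV. (w $ j) *s axis j 1)" by (simp add: basis_expansion)
  also have "\<dots> = (\<Sum>j\<in>UNIV. (w $ j) *\<^sub>R L (axis j 1))"
    by (simp add: linear_sum[OF assms] scalar_mult_eq_scaleR linear_scale[OF assms])
  finally show ?thesis .
qed

lemma det3_linear:
  assumes "linear L"
  shows "det3 (L a) (L b) (L c) = det3 (L (axis 1 1)) (L (axis 2 1)) (L (axis 3 1)) * det3 a b c"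
  by (subst (1 2 3) linear_expand_3[OF assms])
     (simp add: sum_3 det3_def algebra_simps)

lemma det3_add: "det3 a b (x + y) = det3 a b x + det3 a b y"
  by (simp add: det3_def algebra_simps)

lemma det3_bilinear:
  "det3 w (\<Sum>j\<in>UNIV. (x $ j) *\<^sub>R a j) (\<Sum>k\<in>UNIV. (y $ k) *\<^sub>R b k) =
     (\<Sum>j\<in>UNIV. \<Sum>k\<in>UNIV. (x $ j) * ((y $ k) * det3 w (a j) (b k)))"
  for x y :: "real^3"
  by (simp add: sum_3 det3_def algebra_simps)

lemma smooth_sum: "(\<And>i. i \<in> A \<Longrightarrow> smooth (f i)) \<Longrightarrow> smooth (\<lambda>p. \<Sum>i\<in>A. f i p)"
  by (rule smooth_on_sum) auto

lemma vanishes_zero: "vanishes k (\<lambda>_. 0) p"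
  by (induction k) (auto simp: partial_simps)

lemma vanishes_sum:
  "finite A \<Longrightarrow> (\<And>i. i \<in> A \<Longrightarrow> smooth (f i)) \<Longrightarrow> (\<And>i. i \<in> A \<Longrightarrow> vanishes k (f i) p) \<Longrightarrow>
    vanishes k (\<lambda>z. \<Sum>i\<in>A. f i z) p"
proof (induction A rule: finite_induct)
  case (insert x F)
  have "vanishes k (\<lambda>z. f x z + (\<Sum>i\<in>F. f i z)) p"
    by (intro vanishes_add smooth_sum insert) (use insert in auto)
  then show ?case using insert.hyps by simp
qed (simp add: vanishes_zero)

lemma local_diffeo_derivative_inverse:
  fixes \<tau> \<tau>' :: "'a::euclidean_space \<Rightarrow> 'a"
  assumes "local_diffeo \<tau> \<tau>' y y'"
  shows "frechet_derivative \<tau>' (at y') (frechet_derivative \<tau> (at y) w) = w"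
proof -
  let ?D = "frechet_derivative \<tau> (at y)" and ?D' = "frechet_derivative \<tau>' (at y')"
  have d: "(\<tau> has_derivative ?D) (at y)" "(\<tau>' has_derivative ?D') (at (\<tau> y))"
    using assms smooth_has_derivative[of \<tau> y] smooth_has_derivative[of \<tau>' y'] by (auto simp: local_diffeo_def)
  have e: "\<forall>\<^sub>F z in nhds y. \<tau>' (\<tau> z) = z" using assms by (simp add: local_diffeo_def)
  obtain S where S: "open S" "y \<in> S" "\<And>z. z \<in> S \<Longrightarrow> \<tau>' (\<tau> z) = z"
    using e by (auto simp: eventually_nhds)
  have "((\<lambda>z. z) has_derivative (\<lambda>w. ?D' (?D w))) (at y)"
    by (rule has_derivative_transform_within_open[OF has_derivative_compose[OF d] S(1,2)]) (rule S(3))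
  from has_derivative_unique[OF this has_derivative_ident] show ?thesis by metis
qed

lemma local_diffeo_derivative_inj:
  fixes \<tau> \<tau>' :: "'a::euclidean_space \<Rightarrow> 'a"
  assumes "local_diffeo \<tau> \<tau>' y y'" "frechet_derivative \<tau> (at y) w = 0"
  shows "w = 0"
proof -
  have "linear (frechet_derivative \<tau>' (at y'))"
    using assms(1) has_derivative_linear[OF smooth_has_derivative[of \<tau>']] by (simp add: local_diffeo_def)
  with local_diffeo_derivative_inverse[OF assms(1), of w] assms(2) show ?thesis
    by (simp add: linear_0)
qed

lemma local_diffeo_det3:
  fixes \<tau> \<tau>' :: "real^3 \<Rightarrow> real^3"
  assumes "local_diffeo \<tau> \<tau>' y y'"
  shows "det3 (frechet_derivative \<tau> (at y) (axis 1 1)) (frechet_derivative \<tau> (at y) (axis 2 1))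
     (frechet_derivative \<tau> (at y) (axis 3 1)) \<noteq> 0"
proof -
  let ?D = "frechet_derivative \<tau> (at y)" and ?D' = "frechet_derivative \<tau>' (at y')"
  have "linear ?D'"
    using assms has_derivative_linear[OF smooth_has_derivative[of \<tau>']] by (simp add: local_diffeo_def)
  from det3_linear[OF this, of "?D (axis 1 1)" "?D (axis 2 1)" "?D (axis 3 1)"]
  have "det3 (axis 1 1) (axis 2 1) (axis 3 1) =
      det3 (?D' (axis 1 1)) (?D' (axis 2 1)) (?D' (axis 3 1)) * det3 (?D (axis 1 1)) (?D (axis 2 1)) (?D (axis 3 1))"
    by (simp add: local_diffeo_derivative_inverse[OF assms])
  moreover have "det3 (axis 1 1) (axis 2 1) (axis 3 1) = 1" by (simp add: det3_def axis_def)
  ultimately show ?thesis by auto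
qed

lemma pu_compose_vec:
  assumes "smooth \<tau>" "smooth f"
  shows "pu (\<lambda>z. \<tau> (f z)) z = frechet_derivative \<tau> (at (f z)) (pu f z)"
    and "pv (\<lambda>z. \<tau> (f z)) z = frechet_derivative \<tau> (at (f z)) (pv f z)"
  using has_derivative_pu_pv(1,2)[OF has_derivative_compose[OF smooth_has_derivative_pu_pv[OF assms(2)] smooth_has_derivative[OF assms(1)]]]
  by simp_all

context
  fixes f :: "real \<times> real \<Rightarrow> real^3" and p and \<tau> :: "real^3 \<Rightarrow> real^3"
  assumes f: "smooth f" and fv: "pv f p = 0" and t: "smooth \<tau>"
begin

text \<open>The second v-derivative of the composite is D\<tau> f_vv + D^2\<tau>(f_v, f_v). The
  first summand multiplies Phi by det D\<tau>. The second carries two factors f_v, and the middle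
  entry of the determinant a third, so it has order 3 without any assumption; criticality is needed
  only for the variation of det D\<tau>.\<close>

lemma Phi_target_vanishes:
  defines "\<kappa> \<equiv> det3 (frechet_derivative \<tau> (at (f p)) (axis 1 1)) (frechet_derivative \<tau> (at (f p)) (axis 2 1))
     (frechet_derivative \<tau> (at (f p)) (axis 3 1))"
  shows "vanishes 2 (\<lambda>z. Phi (\<lambda>z. \<tau> (f z)) z - \<kappa> * Phi f z) p"
    and "vanishes 2 (Phi f) p \<Longrightarrow> vanishes 3 (\<lambda>z. Phi (\<lambda>z. \<tau> (f z)) z - \<kappa> * Phi f z) p"
    and "pv (pv (\<lambda>z. \<tau> (f z))) p = frechet_derivative \<tau> (at (f p)) (pv (pv f) p)"
proof -
  define m where "m j z = frechet_derivative \<tau> (at (f z)) (axis j 1)" for j z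
  have lin: "linear (frechet_derivative \<tau> (at y))" for y
    using smooth_has_derivative[OF t] has_derivative_linear by blast
  have m: "smooth (m j)" for j
    unfolding m_def by (rule smooth_compose[OF smooth_on_derivative[OF t open_UNIV] f])
  have lex: "frechet_derivative \<tau> (at (f z)) w = (\<Sum>j\<in>UNIV. (w $ j) *\<^sub>R m j z)" for z w
    unfolding m_def by (rule linear_expand_3[OF lin])
  define fh where "fh z = \<tau> (f z)" for z
  have fh: "smooth fh" unfolding fh_def by (rule smooth_compose[OF t f])
  have u: "pu fh = (\<lambda>z. \<Sum>j\<in>UNIV. (pu f z $ j) *\<^sub>R m j z)"
    and v: "pv fh = (\<lambda>z. \<Sum>j\<in>UNIV. (pv f z $ j) *\<^sub>R m j z)"
    unfolding fh_def[abs_def] by (rule ext, simp only: pu_compose_vec[OF t f] lex)+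
  have vv: "pv (pv fh) = (\<lambda>z. \<Sum>j\<in>UNIV. (pv (pv f) z $ j) *\<^sub>R m j z + (pv f z $ j) *\<^sub>R pv (m j) z)"
    unfolding v sum_3
    by (simp add: pv_add pv_scaleR pv_nth smooth_partial_intros m f)
  define N where "N j k z = det3 (pu fh z) (m j z) (pv (m k) z)" for j k z
  define \<delta> where "\<delta> z = det3 (m 1 z) (m 2 z) (m 3 z)" for z
  have sm: "smooth (N j k)" "smooth \<delta>" "smooth (Phi f)" "smooth (\<lambda>z. pv f z $ j)" for j k
    unfolding N_def \<delta>_def by (intro smooth_det3 smooth_partial_intros m f fh smooth_Phi)+
  have eq: "(\<lambda>z. Phi fh z - \<kappa> * Phi f z) =
     (\<lambda>z. (\<delta> z - \<kappa>) * Phi f z + (\<Sum>j\<in>UNIV. \<Sum>k\<in>UNIV. (pv f z $ j) * ((pv f z $ k) * N j k z)))"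
  proof
    fix z
    have "det3 (pu fh z) (pv fh z) (\<Sum>j\<in>UNIV. (pv (pv f) z $ j) *\<^sub>R m j z) = \<delta> z * Phi f z"
      unfolding u v lex[symmetric] \<delta>_def Phi_def by (rule det3_linear[OF lin[of "f z"], folded m_def])
    moreover have "det3 (pu fh z) (pv fh z) (\<Sum>j\<in>UNIV. (pv f z $ j) *\<^sub>R pv (m j) z) =
        (\<Sum>j\<in>UNIV. \<Sum>k\<in>UNIV. (pv f z $ j) * ((pv f z $ k) * N j k z))"
      unfolding v N_def by (rule det3_bilinear)
    ultimately show "Phi fh z - \<kappa> * Phi f z =
        (\<delta> z - \<kappa>) * Phi f z + (\<Sum>j\<in>UNIV. \<Sum>k\<in>UNIV. (pv f z $ j) * ((pv f z $ k) * N j k z))"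
      unfolding Phi_def[of fh] vv sum.distrib by (simp add: det3_add algebra_simps)
  qed
  \<comment> \<open>\<open>m k\<close> is a function of f z, so its v-derivative is linear in f_v:
    the third vanishing factor sits inside N.\<close>
  have "pv (m k) p = 0" for k
    unfolding m_def using pu_compose_vec(2)[OF smooth_on_derivative[OF t open_UNIV] f, of _ p] fv
    by (metis linear_0 has_derivative_linear smooth_has_derivative smooth_on_derivative[OF t open_UNIV])
  then have N: "vanishes 1 (N j k) p" for j k
    by (simp add: N_def det3_def)
  have fj: "vanishes 1 (\<lambda>z. pv f z $ j) p" for j by (simp add: fv)
  have fN: "vanishes 2 (\<lambda>z. (pv f z $ k) * N j k z) p" for j k
    using vanishes_mult[OF sm(4,1) fj N] by (simp add: numeral_2_eq_2)
  have "vanishes 3 (\<lambda>z. (pv f z $ j) * ((pv f z $ k) * N j k z)) p" for j k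
    using vanishes_mult[OF sm(4) smooth_mult[OF sm(4,1)] fj fN[where j=j and k=k], of j]
    by (simp add: numeral_3_eq_3)
  then have R: "vanishes 3 (\<lambda>z. \<Sum>j\<in>UNIV. \<Sum>k\<in>UNIV. (pv f z $ j) * ((pv f z $ k) * N j k z)) p"
    by (intro vanishes_sum smooth_sum smooth_mult sm) auto
  have \<delta>: "vanishes 1 (\<lambda>z. \<delta> z - \<kappa>) p" by (simp add: \<delta>_def \<kappa>_def m_def)
  have sR: "smooth (\<lambda>z. \<Sum>j\<in>UNIV. \<Sum>k\<in>UNIV. (pv f z $ j) * ((pv f z $ k) * N j k z))"
    by (intro smooth_sum smooth_mult sm)
  have s\<delta>: "smooth (\<lambda>z. \<delta> z - \<kappa>)" by (intro smooth_diff sm smooth_const)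
  have "vanishes 2 (\<lambda>z. (\<delta> z - \<kappa>) * Phi f z) p"
    using vanishes_mult[OF s\<delta> sm(3) \<delta> vanishes_Phi[OF f fv]] by (simp add: numeral_2_eq_2)
  then show "vanishes 2 (\<lambda>z. Phi (\<lambda>z. \<tau> (f z)) z - \<kappa> * Phi f z) p"
    unfolding fh_def[abs_def, symmetric] eq
    using vanishes_mono[of 2, folded numeral_3_eq_3, simplified, OF R] sR s\<delta> sm
    by (intro vanishes_add smooth_mult) auto
  show "vanishes 3 (\<lambda>z. Phi (\<lambda>z. \<tau> (f z)) z - \<kappa> * Phi f z) p" if "vanishes 2 (Phi f) p"
  proof -
    have "vanishes 3 (\<lambda>z. (\<delta> z - \<kappa>) * Phi f z) p"
      using vanishes_mult[OF s\<delta> sm(3) \<delta> that] by (simp add: numeral_3_eq_3)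
    then show ?thesis
      unfolding fh_def[abs_def, symmetric] eq
      using R sR s\<delta> sm by (intro vanishes_add smooth_mult) auto
  qed
  show "pv (pv (\<lambda>z. \<tau> (f z))) p = frechet_derivative \<tau> (at (f p)) (pv (pv f) p)"
    unfolding fh_def[abs_def, symmetric] vv lex by (simp add: fv m_def)
qed

end

section \<open>Pullback of vector fields and invariants of germs\<close>

text \<open>Cramer's rule for the field that D\<sigma> carries to (b', a'). It is claimed only near
  p because the reciprocal of the Jacobian agrees with a globally smooth function only
  there.\<close>

lemma ex_pullback_field:
  assumes s: "smooth \<sigma>" and J: "jacobian \<sigma> p \<noteq> 0" and ab: "smooth b'" "smooth a'"
  shows "\<exists>b a. smooth b \<and> smooth a \<and> (\<forall>\<^sub>F z in nhds p.
     b z * fst (pu \<sigma> z) + a z * fst (pv \<sigma> z) = b' (\<sigma> z) \<and>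
     b z * snd (pu \<sigma> z) + a z * snd (pv \<sigma> z) = a' (\<sigma> z))"
proof -
  obtain r where r: "smooth r" "\<forall>\<^sub>F z in nhds p. r z * jacobian \<sigma> z = 1"
    using ex_smooth_inverse_near[OF smooth_jacobian[OF s] J] by blast
  define b where "b z = r z * (b' (\<sigma> z) * snd (pv \<sigma> z) - a' (\<sigma> z) * fst (pv \<sigma> z))" for z
  define a where "a z = r z * (a' (\<sigma> z) * fst (pu \<sigma> z) - b' (\<sigma> z) * snd (pu \<sigma> z))" for z
  note sm = smooth_compose[OF ab(1) s] smooth_compose[OF ab(2) s]
  have "smooth b" "smooth a"
    unfolding b_def a_def by (intro smooth_partial_intros sm r s)+
  moreover have "\<forall>\<^sub>F z in nhds p.
     b z * fst (pu \<sigma> z) + a z * fst (pv \<sigma> z) = b' (\<sigma> z) \<and>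
     b z * snd (pu \<sigma> z) + a z * snd (pv \<sigma> z) = a' (\<sigma> z)"
    using r(2)
  proof eventually_elim
    case (elim z)
    have "b z * fst (pu \<sigma> z) + a z * fst (pv \<sigma> z) = (r z * jacobian \<sigma> z) * b' (\<sigma> z)"
      "b z * snd (pu \<sigma> z) + a z * snd (pv \<sigma> z) = (r z * jacobian \<sigma> z) * a' (\<sigma> z)"
      by (simp_all add: b_def a_def jacobian_def algebra_simps)
    with elim show ?case by simp
  qed
  ultimately show ?thesis by blast
qed

lemma partial_compose:
  assumes "smooth \<psi>" "smooth \<sigma>"
  shows "pu (\<lambda>z. \<psi> (\<sigma> z)) z = fst (pu \<sigma> z) *\<^sub>R pu \<psi> (\<sigma> z) + snd (pu \<sigma> z) *\<^sub>R pv \<psi> (\<sigma> z)"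
    and "pv (\<lambda>z. \<psi> (\<sigma> z)) z = fst (pv \<sigma> z) *\<^sub>R pu \<psi> (\<sigma> z) + snd (pv \<sigma> z) *\<^sub>R pv \<psi> (\<sigma> z)"
  using has_derivative_pu_pv(1,2)[OF has_derivative_compose[OF smooth_has_derivative_pu_pv[OF assms(2)]
        smooth_has_derivative_pu_pv[OF assms(1)]]]
  by simp_all

lemma lie_pullback:
  assumes "smooth \<psi>" "smooth \<sigma>" "\<forall>\<^sub>F z in nhds p. f z = \<psi> (\<sigma> z)"
    and "\<forall>\<^sub>F z in nhds p.
     b z * fst (pu \<sigma> z) + a z * fst (pv \<sigma> z) = b' (\<sigma> z) \<and>
     b z * snd (pu \<sigma> z) + a z * snd (pv \<sigma> z) = a' (\<sigma> z)"
  shows "\<forall>\<^sub>F z in nhds p. lie b a f z = lie b' a' \<psi> (\<sigma> z)"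
  using pu_eventually_cong[OF assms(3)] assms(4)
proof eventually_elim
  case (elim z)
  then show ?case
    unfolding lie_def partial_compose[OF assms(1,2)]
    by (auto simp flip: elim(3)[THEN conjunct1] elim(3)[THEN conjunct2] simp: algebra_simps)
qed

text \<open>Fields related by \<sigma> turn the determinant of h at \<sigma> z into one of f at z
  with variable coefficients. The null condition reads b f_u + a f_v = 0 at p, so b = 0 there
  because f_v = 0 and f_u \<noteq> 0, and the comparison with the coordinate fields applies. Only
  squares of the Jacobian and of \<kappa> reach the Hessian determinant, so k is positive.\<close>

theorem Phi_fields_pullback:
  fixes f h :: "real \<times> real \<Rightarrow> real^3"
  assumes f: "smooth f" and h: "smooth h" and s: "smooth \<sigma>" and J: "jacobian \<sigma> p \<noteq> 0"
    and e: "\<forall>\<^sub>F z in nhds p. f z = h (\<sigma> z)"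
    and fv: "pv f p = 0" and fu: "pu f p \<noteq> 0"
    and co: "smooth c'" "smooth d'" "smooth b'" "smooth a'"
    and ind: "c' (\<sigma> p) * a' (\<sigma> p) - d' (\<sigma> p) * b' (\<sigma> p) \<noteq> 0"
    and null: "lie b' a' h (\<sigma> p) = 0"
  shows "vanishes 2 (Phi_fields c' d' b' a' h) (\<sigma> p) \<longleftrightarrow> vanishes 2 (Phi f) p"
    and "vanishes 2 (Phi f) p \<Longrightarrow> \<exists>k>0. hess (Phi_fields c' d' b' a' h) (\<sigma> p) = k * hess (Phi f) p"
    and "(\<exists>s. lie b' a' (lie b' a' h) (\<sigma> p) = s *\<^sub>R lie c' d' h (\<sigma> p)) \<longleftrightarrow> (\<exists>s. pv (pv f) p = s *\<^sub>R pu f p)"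
proof -
  obtain c d where cd: "smooth c" "smooth d" and cd': "\<forall>\<^sub>F z in nhds p.
     c z * fst (pu \<sigma> z) + d z * fst (pv \<sigma> z) = c' (\<sigma> z) \<and>
     c z * snd (pu \<sigma> z) + d z * snd (pv \<sigma> z) = d' (\<sigma> z)"
    using ex_pullback_field[OF s J co(1,2)] by blast
  obtain b a where ba: "smooth b" "smooth a" and ba': "\<forall>\<^sub>F z in nhds p.
     b z * fst (pu \<sigma> z) + a z * fst (pv \<sigma> z) = b' (\<sigma> z) \<and>
     b z * snd (pu \<sigma> z) + a z * snd (pv \<sigma> z) = a' (\<sigma> z)"
    using ex_pullback_field[OF s J co(3,4)] by blast
  note E1 = lie_pullback[OF h s e cd'] and E2 = lie_pullback[OF h s e ba']
  note E3 = lie_pullback[OF smooth_lie[OF co(3,4) h] s E2 ba']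
  let ?P = "Phi_fields c' d' b' a' h"
  have P: "smooth ?P" "smooth (Phi f)" "smooth (\<lambda>z. ?P (\<sigma> z))"
    using smooth_Phi_fields[OF co h] smooth_Phi[OF f] smooth_compose[OF _ s] by auto
  have EP: "\<forall>\<^sub>F z in nhds p. Phi_fields c d b a f z = ?P (\<sigma> z)"
    using E1 E2 E3 by eventually_elim (simp add: Phi_fields_def)
  have bp: "b p = 0"
    using eventually_nhds_x_imp_x[OF E2] null fv fu by (simp add: lie_def)
  have "(c p * a p - d p * b p) * jacobian \<sigma> p = c' (\<sigma> p) * a' (\<sigma> p) - d' (\<sigma> p) * b' (\<sigma> p)"
    unfolding eventually_nhds_x_imp_x[OF cd', THEN conjunct1, symmetric]
      eventually_nhds_x_imp_x[OF cd', THEN conjunct2, symmetric]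
      eventually_nhds_x_imp_x[OF ba', THEN conjunct1, symmetric]
      eventually_nhds_x_imp_x[OF ba', THEN conjunct2, symmetric]
    by (simp add: jacobian_def algebra_simps)
  with ind bp have ca: "c p \<noteq> 0" "a p \<noteq> 0" by auto
  define \<kappa> where "\<kappa> = c p * a p * (a p)\<^sup>2"
  have \<kappa>: "\<kappa> \<noteq> 0" using ca by (simp add: \<kappa>_def)
  have "\<forall>\<^sub>F z in nhds p. Phi_fields c d b a f z - \<kappa> * Phi f z = ?P (\<sigma> z) - \<kappa> * Phi f z"
    using EP by eventually_elim simp
  note cong = vanishes_cong[OF this]
  have v2: "vanishes 2 (\<lambda>z. ?P (\<sigma> z) - \<kappa> * Phi f z) p"
    using Phi_fields_vanishes(1)[OF f fv cd ba bp, folded \<kappa>_def] cong by blast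
  have iff1: "vanishes 2 (\<lambda>z. ?P (\<sigma> z)) p \<longleftrightarrow> vanishes 2 (Phi f) p"
    by (rule vanishes_diff_scaled_2[OF P(2,3) v2 \<kappa>])
  show iff2: "vanishes 2 ?P (\<sigma> p) \<longleftrightarrow> vanishes 2 (Phi f) p"
    using iff1 hess_compose(1,3)[OF P(1) s] J by blast
  show "\<exists>k>0. hess ?P (\<sigma> p) = k * hess (Phi f) p" if c: "vanishes 2 (Phi f) p"
  proof -
    have "vanishes 3 (\<lambda>z. ?P (\<sigma> z) - \<kappa> * Phi f z) p"
      using Phi_fields_vanishes(2)[OF f fv cd ba bp c, folded \<kappa>_def] cong by blast
    from vanishes_diff_scaled_3[OF P(2,3) this]
    have "(jacobian \<sigma> p)\<^sup>2 * hess ?P (\<sigma> p) = \<kappa>\<^sup>2 * hess (Phi f) p"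
      using hess_compose(2)[OF P(1) s] iff2 c by simp
    then have "hess ?P (\<sigma> p) = (\<kappa>\<^sup>2 / (jacobian \<sigma> p)\<^sup>2) * hess (Phi f) p"
      using J by (simp add: field_simps)
    then show ?thesis using \<kappa> J by (intro exI[of _ "\<kappa>\<^sup>2 / (jacobian \<sigma> p)\<^sup>2"]) auto
  qed
  obtain t where t: "lie b' a' (lie b' a' h) (\<sigma> p) = (a p)\<^sup>2 *\<^sub>R pv (pv f) p + t *\<^sub>R pu f p"
    using lie_lie_at[OF f fv ba bp] eventually_nhds_x_imp_x[OF E3] by auto
  have l: "lie c' d' h (\<sigma> p) = c p *\<^sub>R pu f p"
    using eventually_nhds_x_imp_x[OF E1] by (simp add: lie_def fv)
  show "(\<exists>s. lie b' a' (lie b' a' h) (\<sigma> p) = s *\<^sub>R lie c' d' h (\<sigma> p)) \<longleftrightarrow> (\<exists>s. pv (pv f) p = s *\<^sub>R pu f p)"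
  proof
    assume "\<exists>s. lie b' a' (lie b' a' h) (\<sigma> p) = s *\<^sub>R lie c' d' h (\<sigma> p)"
    then obtain s where "(a p)\<^sup>2 *\<^sub>R pv (pv f) p + t *\<^sub>R pu f p = (s * c p) *\<^sub>R pu f p"
      unfolding t l by auto
    then have "(a p)\<^sup>2 *\<^sub>R pv (pv f) p = (s * c p - t) *\<^sub>R pu f p"
      by (simp add: algebra_simps)
    then have "inverse ((a p)\<^sup>2) *\<^sub>R ((a p)\<^sup>2 *\<^sub>R pv (pv f) p) = inverse ((a p)\<^sup>2) *\<^sub>R ((s * c p - t) *\<^sub>R pu f p)"
      by simp
    then have "pv (pv f) p = (inverse ((a p)\<^sup>2) * (s * c p - t)) *\<^sub>R pu f p"
      using ca by simp
    then show "\<exists>s. pv (pv f) p = s *\<^sub>R pu f p" by blast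
  next
    assume "\<exists>s. pv (pv f) p = s *\<^sub>R pu f p"
    then obtain s where "pv (pv f) p = s *\<^sub>R pu f p" by blast
    then have "lie b' a' (lie b' a' h) (\<sigma> p) = (((a p)\<^sup>2 * s + t) / c p) *\<^sub>R lie c' d' h (\<sigma> p)"
      unfolding t l using ca by (simp flip: scaleR_add_left)
    then show "\<exists>s. lie b' a' (lie b' a' h) (\<sigma> p) = s *\<^sub>R lie c' d' h (\<sigma> p)" by blast
  qed
qed

lemma lie_const: "lie (\<lambda>_. 1) (\<lambda>_. 0) f = pu f" "lie (\<lambda>_. 0) (\<lambda>_. 1) f = pv f"
  by (auto simp: lie_def)

lemma Phi_fields_const: "Phi_fields (\<lambda>_. 1) (\<lambda>_. 0) (\<lambda>_. 0) (\<lambda>_. 1) f = Phi f"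
  by (auto simp: Phi_fields_def Phi_def lie_const)

lemma local_diffeo_jacobian:
  fixes \<sigma> \<sigma>' :: "real \<times> real \<Rightarrow> real \<times> real"
  assumes "local_diffeo \<sigma> \<sigma>' p q"
  shows "jacobian \<sigma> p \<noteq> 0"
proof -
  have s: "smooth \<sigma>" "smooth \<sigma>'" and e: "\<forall>\<^sub>F z in nhds p. \<sigma>' (\<sigma> z) = z"
    using assms by (auto simp: local_diffeo_def)
  have i: "pu (\<lambda>z. z) z = (1, 0)" "pv (\<lambda>z. z) z = (0, 1)" for z
    using has_derivative_pu_pv(1,2)[OF has_derivative_ident] by auto
  have "(1, 0) = fst (pu \<sigma> p) *\<^sub>R pu \<sigma>' (\<sigma> p) + snd (pu \<sigma> p) *\<^sub>R pv \<sigma>' (\<sigma> p)"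
    "(0, 1) = fst (pv \<sigma> p) *\<^sub>R pu \<sigma>' (\<sigma> p) + snd (pv \<sigma> p) *\<^sub>R pv \<sigma>' (\<sigma> p)"
    using eventually_nhds_x_imp_x[OF pu_eventually_cong(1)[OF e]] eventually_nhds_x_imp_x[OF pu_eventually_cong(2)[OF e]]
    unfolding i partial_compose[OF s(2,1)] by simp_all
  then have "jacobian \<sigma> p * jacobian \<sigma>' (\<sigma> p) = 1"
    unfolding jacobian_def by (auto simp: prod_eq_iff) algebra
  then show ?thesis by auto
qed

text \<open>The target change comes first: it keeps v a null direction, so the intermediate map
  \<open>fh\<close> can be compared with f directly. The source change then pulls the coordinate
  fields of g back to fields with variable coefficients. The last claim transports the independence
  of f_u and f_vv.\<close>

theorem germ_equiv_invariants:
  fixes f g :: "real \<times> real \<Rightarrow> real^3"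
  assumes f: "smooth f" and g: "smooth g" and equiv: "germ_equiv f p g q"
    and fv: "pv f p = 0" and fu: "pu f p \<noteq> 0" and gv: "pv g q = 0"
  shows "vanishes 2 (Phi g) q \<longleftrightarrow> vanishes 2 (Phi f) p"
    and "vanishes 2 (Phi f) p \<Longrightarrow> \<exists>k>0. hess (Phi g) q = k * hess (Phi f) p"
    and "(\<exists>s. pv (pv g) q = s *\<^sub>R pu g q) \<longleftrightarrow> (\<exists>s. pv (pv f) p = s *\<^sub>R pu f p)"
proof -
  obtain \<sigma> \<sigma>' \<tau> \<tau>' where S: "local_diffeo \<sigma> \<sigma>' p q" and T: "local_diffeo \<tau> \<tau>' (f p) (g q)"
    and e: "\<forall>\<^sub>F z in nhds p. \<tau> (f z) = g (\<sigma> z)"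
    using equiv unfolding germ_equiv_def by blast
  have s: "smooth \<sigma>" "\<sigma> p = q" and t: "smooth \<tau>" using S T by (auto simp: local_diffeo_def)
  define fh where "fh z = \<tau> (f z)" for z
  have fh: "smooth fh" unfolding fh_def by (rule smooth_compose[OF t f])
  let ?D = "frechet_derivative \<tau> (at (f p))"
  have lin: "linear ?D" using smooth_has_derivative[OF t] has_derivative_linear by blast
  define \<kappa> where "\<kappa> = det3 (?D (axis 1 1)) (?D (axis 2 1)) (?D (axis 3 1))"
  have \<kappa>: "\<kappa> \<noteq> 0" unfolding \<kappa>_def by (rule local_diffeo_det3[OF T])
  note inj = local_diffeo_derivative_inj[OF T]
  have d: "pu fh p = ?D (pu f p)" "pv fh p = ?D (pv f p)"
    unfolding fh_def[abs_def] by (rule pu_compose_vec[OF t f])+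
  have fhv: "pv fh p = 0" using d(2) fv linear_0[OF lin] by simp
  have fhu: "pu fh p \<noteq> 0" using d(1) inj fu by auto
  have fhvv: "pv (pv fh) p = ?D (pv (pv f) p)"
    unfolding fh_def[abs_def] by (rule Phi_target_vanishes(3)[OF f fv t])
  have P: "smooth (Phi f)" "smooth (Phi fh)" using smooth_Phi f fh by auto
  note v = Phi_target_vanishes[OF f fv t, folded \<kappa>_def fh_def[abs_def]]
  have 1: "vanishes 2 (Phi fh) p \<longleftrightarrow> vanishes 2 (Phi f) p"
    by (rule vanishes_diff_scaled_2[OF P v(1) \<kappa>])
  have 2: "(\<exists>s. pv (pv fh) p = s *\<^sub>R pu fh p) \<longleftrightarrow> (\<exists>s. pv (pv f) p = s *\<^sub>R pu f p)"
  proof -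
    have "?D x = s *\<^sub>R ?D y \<longleftrightarrow> x = s *\<^sub>R y" for x y s
      using inj[of "x - s *\<^sub>R y"] by (auto simp: linear_diff[OF lin] linear_scale[OF lin])
    then show ?thesis unfolding fhvv d(1) by simp
  qed
  have null: "lie (\<lambda>_. 0) (\<lambda>_. 1) g (\<sigma> p) = 0" using gv s by (simp add: lie_const)
  note F = Phi_fields_pullback[OF fh g s(1) local_diffeo_jacobian[OF S] _ fhv fhu smooth_const smooth_const
      smooth_const smooth_const _ null, of 1 0, unfolded Phi_fields_const lie_const s(2), simplified,
      OF e[folded fh_def]]
  show "vanishes 2 (Phi g) q \<longleftrightarrow> vanishes 2 (Phi f) p"
    using F(1) 1 by blast
  show "(\<exists>s. pv (pv g) q = s *\<^sub>R pu g q) \<longleftrightarrow> (\<exists>s. pv (pv f) p = s *\<^sub>R pu f p)"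
    using F(3) 2 by blast
  assume c: "vanishes 2 (Phi f) p"
  obtain k where "k > 0" "hess (Phi g) q = k * hess (Phi fh) p"
    using F(2) 1 c by blast
  moreover have "hess (Phi fh) p = \<kappa>\<^sup>2 * hess (Phi f) p"
    by (rule vanishes_diff_scaled_3[OF P v(2)[OF c]])
  ultimately show "\<exists>k>0. hess (Phi g) q = k * hess (Phi f) p"
    using \<kappa> by (intro exI[of _ "k * \<kappa>\<^sup>2"]) auto
qed

section \<open>Normal forms and the criterion\<close>

lemma partial_vector_3:
  fixes a b c :: "real \<times> real \<Rightarrow> real"
  assumes "smooth a" "smooth b" "smooth c"
  shows "pu (\<lambda>z. vector [a z, b z, c z] :: real^3) = (\<lambda>z. vector [pu a z, pu b z, pu c z])"
    and "pv (\<lambda>z. vector [a z, b z, c z] :: real^3) = (\<lambda>z. vector [pv a z, pv b z, pv c z])"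
proof -
  note s = smooth_vector_3[OF assms]
  show "pu (\<lambda>z. vector [a z, b z, c z] :: real^3) = (\<lambda>z. vector [pu a z, pu b z, pu c z])"
    by (rule ext) (simp add: vec_eq_iff forall_3 flip: fun_cong[OF pu_nth[OF s]])
  show "pv (\<lambda>z. vector [a z, b z, c z] :: real^3) = (\<lambda>z. vector [pv a z, pv b z, pv c z])"
    by (rule ext) (simp add: vec_eq_iff forall_3 flip: fun_cong[OF pv_nth[OF s]])
qed

section \<open>Germs of the form (u, v^2, v K(u, v^2))\<close>

definition normal_map :: "(real \<times> real \<Rightarrow> real) \<Rightarrow> real \<times> real \<Rightarrow> real^3" where
  "normal_map K z = vector [fst z, snd z * snd z, snd z * K (fst z, snd z * snd z)]"

lemma S1_plus_germ_eq: "S1_plus_germ = normal_map (\<lambda>z. fst z * fst z + snd z)"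
  and S1_minus_germ_eq: "S1_minus_germ = normal_map (\<lambda>z. fst z * fst z - snd z)"
  by (auto simp: S1_plus_germ_def S1_minus_germ_def normal_map_def fun_eq_iff power2_eq_square)

lemma smooth_compose_pair:
  "smooth F \<Longrightarrow> smooth a \<Longrightarrow> smooth b \<Longrightarrow> smooth (\<lambda>z. F (a z, b z))"
  for a :: "'a::real_normed_vector \<Rightarrow> 'b::euclidean_space" and b :: "'a \<Rightarrow> 'c::euclidean_space"
  by (rule smooth_compose[OF _ smooth_Pair])

context
  fixes K :: "real \<times> real \<Rightarrow> real"
  assumes K: "smooth K"
begin

lemma normal_map_smooth_aux:
  assumes "smooth F"
  shows "smooth (\<lambda>z::real\<times>real. F (fst z, snd z * snd z))"
  by (intro smooth_compose_pair[OF assms] smooth_intros)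

lemma normal_map_partial_aux:
  fixes F :: "real \<times> real \<Rightarrow> real"
  assumes "smooth F"
  shows "pu (\<lambda>z. F (fst z, snd z * snd z)) = (\<lambda>z. pu F (fst z, snd z * snd z))"
    and "pv (\<lambda>z. F (fst z, snd z * snd z)) = (\<lambda>z. 2 * snd z * pv F (fst z, snd z * snd z))"
proof -
  have s: "smooth (\<lambda>z::real\<times>real. fst z)" "smooth (\<lambda>z::real\<times>real. snd z * snd z)"
    by (intro smooth_intros)+
  show "pu (\<lambda>z. F (fst z, snd z * snd z)) = (\<lambda>z. pu F (fst z, snd z * snd z))"
    and "pv (\<lambda>z. F (fst z, snd z * snd z)) = (\<lambda>z. 2 * snd z * pv F (fst z, snd z * snd z))"
    unfolding pu_compose_plane[OF assms s] by (simp_all add: partial_simps smooth_intros)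
qed

lemma smooth_normal_map: "smooth (normal_map K)"
  unfolding normal_map_def[abs_def]
  by (intro smooth_vector_3 smooth_mult normal_map_smooth_aux K smooth_intros)

lemma normal_map_partials:
  "pu (normal_map K) = (\<lambda>z. vector [1, 0, snd z * pu K (fst z, snd z * snd z)])"
  "pv (normal_map K) = (\<lambda>z. vector [0, 2 * snd z,
     K (fst z, snd z * snd z) + 2 * (snd z * snd z) * pv K (fst z, snd z * snd z)])"
  "pv (pv (normal_map K)) = (\<lambda>z. vector [0, 2, 6 * snd z * pv K (fst z, snd z * snd z) +
     4 * (snd z * snd z * snd z) * pv (pv K) (fst z, snd z * snd z)])"
proof -
  note aux = normal_map_smooth_aux normal_map_partial_aux
  show 1: "pu (normal_map K) = (\<lambda>z. vector [1, 0, snd z * pu K (fst z, snd z * snd z)])"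
    unfolding normal_map_def[abs_def]
    by (subst partial_vector_3)
       (simp_all add: smooth_mult aux K smooth_intros partial_simps)
  show 2: "pv (normal_map K) = (\<lambda>z. vector [0, 2 * snd z,
     K (fst z, snd z * snd z) + 2 * (snd z * snd z) * pv K (fst z, snd z * snd z)])"
    unfolding normal_map_def[abs_def]
    by (subst partial_vector_3)
       (simp_all add: smooth_mult aux K smooth_intros partial_simps mult_ac)
  show "pv (pv (normal_map K)) = (\<lambda>z. vector [0, 2, 6 * snd z * pv K (fst z, snd z * snd z) +
     4 * (snd z * snd z * snd z) * pv (pv K) (fst z, snd z * snd z)])"
    unfolding 2
    by (subst partial_vector_3)
       (simp_all add: smooth_add smooth_mult aux K smooth_pv smooth_intros partial_simps algebra_simps)
qed

lemma Phi_normal_map: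
  "Phi (normal_map K) = (\<lambda>z. - 2 * K (fst z, snd z * snd z) + snd z * snd z *
     (8 * pv K (fst z, snd z * snd z) + 8 * (snd z * snd z) * pv (pv K) (fst z, snd z * snd z)))"
  unfolding Phi_def[abs_def] normal_map_partials(3) unfolding normal_map_partials(1,2) by (rule ext) (simp add: det3_def algebra_simps)

text \<open>To second order Phi is -2 K(u, 0) + 6 K_y v^2, which gives -2 K_uu, 12 K_y and no mixed
  derivative at the origin. Hence S_1^+, where K = u^2 + y, has negative Hessian
  determinant.\<close>

lemma normal_map_at_zero:
  assumes "K (0, 0) = 0"
  shows "pv (normal_map K) (0, 0) = 0"
    and "vanishes 2 (Phi (normal_map K)) (0, 0) \<longleftrightarrow> pu K (0, 0) = 0"
    and "hess (Phi (normal_map K)) (0, 0) = - 24 * (pu (pu K) (0, 0) * pv K (0, 0))"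
    and "\<nexists>s. pv (pv (normal_map K)) (0, 0) = s *\<^sub>R pu (normal_map K) (0, 0)"
proof -
  note aux = normal_map_smooth_aux normal_map_partial_aux
  note sm = smooth_add smooth_mult aux(1) K smooth_pv smooth_pu smooth_intros
  show "pv (normal_map K) (0, 0) = 0"
    by (simp add: normal_map_partials assms vec_eq_iff forall_3)
  show "\<nexists>s. pv (pv (normal_map K)) (0, 0) = s *\<^sub>R pu (normal_map K) (0, 0)"
    unfolding normal_map_partials(3) unfolding normal_map_partials(1)
    by (simp add: vec_eq_iff forall_3)
  have u: "pu (Phi (normal_map K)) = (\<lambda>z. - 2 * pu K (fst z, snd z * snd z) + snd z * snd z *
     (8 * pu (pv K) (fst z, snd z * snd z) + 8 * (snd z * snd z) * pu (pv (pv K)) (fst z, snd z * snd z)))"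
    unfolding Phi_normal_map by (simp add: partial_simps sm aux(2,3))
  have v: "pv (Phi (normal_map K)) = (\<lambda>z. 12 * snd z * pv K (fst z, snd z * snd z) + (snd z * snd z) *
     (48 * snd z * pv (pv K) (fst z, snd z * snd z)
      + 16 * (snd z * snd z * snd z) * pv (pv (pv K)) (fst z, snd z * snd z)))"
    unfolding Phi_normal_map by (simp add: partial_simps sm aux(2,3) algebra_simps)
  show "vanishes 2 (Phi (normal_map K)) (0, 0) \<longleftrightarrow> pu K (0, 0) = 0"
    by (simp add: vanishes_2 u v) (simp add: Phi_normal_map assms)
  have "pu (pu (Phi (normal_map K))) (0, 0) = - 2 * pu (pu K) (0, 0)"
    "pv (pu (Phi (normal_map K))) (0, 0) = 0"
    unfolding u by (simp_all add: partial_simps sm aux(2,3))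
  moreover have "pv (pv (Phi (normal_map K))) (0, 0) = 12 * pv K (0, 0)"
    unfolding v by (simp add: partial_simps sm aux(2,3))
  ultimately show "hess (Phi (normal_map K)) (0, 0) = - 24 * (pu (pu K) (0, 0) * pv K (0, 0))"
    by (simp add: hess_def)
qed

end

lemma hadamard_second:
  assumes "smooth g"
  shows "\<exists>h. smooth h \<and> (\<forall>u v. g (u, v) = g (u, 0) + v * pv g (u, 0) + v * v * h (u, v)) \<and>
     (\<forall>u. 2 * h (u, 0) = pv (pv g) (u, 0))"
proof -
  define k where "k = ray_mean 0 (pv g)"
  define h where "h = ray_mean 0 (pv k)"
  have k: "smooth k" unfolding k_def by (intro smooth_ray_mean smooth_pv assms)
  have h: "smooth h" unfolding h_def by (intro smooth_ray_mean smooth_pv k)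
  have k0: "k (u, 0) = pv g (u, 0)" for u by (simp add: k_def ray_mean_zero)
  have gk: "g (u, v) = g (u, 0) + v * k (u, v)" for u v
    unfolding k_def by (rule hadamard[OF assms])
  have kh: "k (u, v) = pv g (u, 0) + v * h (u, v)" for u v
    using hadamard[OF k, of u v] by (simp add: h_def k0)
  define g0 where "g0 z = g (fst z, 0)" for z :: "real \<times> real"
  have s0: "smooth g0" unfolding g0_def by (intro smooth_compose_pair[OF assms] smooth_intros)
  have pg0: "pv g0 = (\<lambda>_. 0)"
    unfolding g0_def[abs_def]
    using pu_compose_plane(2)[OF assms smooth_fst smooth_const[of 0]] by (simp add: pv_fst pv_const)
  have "g = (\<lambda>z. g0 z + snd z * k z)"
  proof
    fix z show "g z = g0 z + snd z * k z"
      using gk[of "fst z" "snd z"] by (simp add: g0_def)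
  qed
  then have "pv g = pv (\<lambda>z. g0 z + snd z * k z)" by simp
  also have "\<dots> = (\<lambda>z. k z + snd z * pv k z)"
    by (simp add: partial_simps s0 k pg0 smooth_mult smooth_intros)
  finally have "pv (pv g) (u, 0) = 2 * pv k (u, 0)" for u
    by (simp add: partial_simps k smooth_pv smooth_mult smooth_intros)
  moreover have "h (u, 0) = pv k (u, 0)" for u by (simp add: h_def ray_mean_zero)
  ultimately show ?thesis
  proof (intro exI[of _ h] conjI allI h)
    show "g (u, v) = g (u, 0) + v * pv g (u, 0) + v * v * h (u, v)" for u v
      by (subst gk, subst kh) (simp add: algebra_simps)
  qed simp
qed

lemma eventually_nhds_slice:
  fixes a b :: "'a::t2_space \<Rightarrow> real"
  assumes "\<forall>\<^sub>F z in nhds (0, 0). P z" and "isCont a p" "isCont b p" "a p = 0" "b p = 0"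
  shows "\<forall>\<^sub>F z in nhds p. P (a z, b z)"
proof (rule eventually_compose_filterlim[OF assms(1)])
  have "isCont (\<lambda>z. (a z, b z)) p" by (intro continuous_intros assms(2,3))
  then show "filterlim (\<lambda>z. (a z, b z)) (nhds (0, 0)) (nhds p)"
    using assms(4,5) by (simp add: continuous_at tendsto_nhds_iff)
qed

text \<open>Hadamard division, once in y and twice in u, writes K(u, y) = u^2 e'(0, u) + y k1(u, y).
  Dividing the third component by \<epsilon> k1(u, v^2) leaves v (u^2 q + \<epsilon> v^2) with q >
  0, and replacing u by u sqrt q gives the model. The divisor and the new first coordinate depend on
  u and v^2 alone, that is on the first two target coordinates, so both changes can be made in the
  target.\<close>

lemma normal_map_equiv_S1:
  assumes K: "smooth K" and K0: "K (0, 0) = 0" "pu K (0, 0) = 0"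
    and \<epsilon>: "\<epsilon> = 1 \<or> \<epsilon> = - 1" and pos: "\<epsilon> * (pu (pu K) (0, 0) * pv K (0, 0)) > 0"
  shows "germ_equiv (normal_map K) (0, 0) (normal_map (\<lambda>z. fst z * fst z + \<epsilon> * snd z)) (0, 0)"
proof -
  define k1 where "k1 = ray_mean 0 (pv K)"
  have k1: "smooth k1" unfolding k1_def by (intro smooth_ray_mean smooth_pv K)
  have Kk: "K (u, y) = K (u, 0) + y * k1 (u, y)" for u y
    unfolding k1_def by (rule hadamard[OF K])
  have k10: "k1 (0, 0) = pv K (0, 0)" by (simp add: k1_def ray_mean_zero)
  \<comment> \<open>K(., 0) is moved to the second variable, where Hadamard division is formulated;
    hence e' is evaluated at (0, u).\<close>
  define g where "g z = K (snd z, 0)" for z :: "real \<times> real"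
  have g: "smooth g" unfolding g_def by (intro smooth_compose_pair[OF K] smooth_intros)
  have pg: "pv g = (\<lambda>z. pu K (snd z, 0))" "pv (\<lambda>z. pu K (snd z, 0)) = (\<lambda>z. pu (pu K) (snd z, 0))"
    unfolding g_def[abs_def]
    using pu_compose_plane(2)[OF K smooth_snd smooth_const[of 0]]
      pu_compose_plane(2)[OF smooth_pu[OF K] smooth_snd smooth_const[of 0]]
    by (simp_all add: pv_snd pv_const)
  obtain e' where e': "smooth e'" "\<And>u v. g (u, v) = g (u, 0) + v * pv g (u, 0) + v * v * e' (u, v)"
    "\<And>u. 2 * e' (u, 0) = pv (pv g) (u, 0)"
    using hadamard_second[OF g] by blast
  have Ke: "K (u, y) = u * u * e' (0, u) + y * k1 (u, y)" for u y
    using e'(2)[of 0 u] Kk[of u y] K0 by (simp add: g_def pg)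
  have e0: "2 * e' (0, 0) = pu (pu K) (0, 0)" using e'(3)[of 0] by (simp add: pg)
  have k1nz: "k1 (0, 0) \<noteq> 0" using pos k10 by auto
  obtain r where r: "smooth r" "\<forall>\<^sub>F z in nhds (0, 0). r z * k1 z = 1"
    using ex_smooth_inverse_near[OF k1 k1nz] by blast
  have r0: "r (0, 0) * k1 (0, 0) = 1" using eventually_nhds_x_imp_x[OF r(2)] .
  define q where "q z = \<epsilon> * (e' (0, fst z) * r z)" for z
  have q: "smooth q" unfolding q_def by (intro smooth_mult smooth_const smooth_compose_pair[OF e'(1)] r(1) smooth_intros)
  have "q (0, 0) > 0"
  proof -
    \<comment> \<open>Near the origin q is \<epsilon> e' / k1; multiplied by 2 k1^2 its value there
      becomes the positive number \<epsilon> K_uu K_y.\<close>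
    have "q (0, 0) * (2 * (k1 (0, 0) * k1 (0, 0))) = \<epsilon> * ((2 * e' (0, 0)) * (r (0, 0) * k1 (0, 0)) * k1 (0, 0))"
      by (simp add: q_def)
    also have "\<dots> > 0" unfolding r0 e0 unfolding k10 using pos by simp
    finally show ?thesis using k1nz by (simp add: zero_less_mult_iff)
  qed
  then obtain s where s: "smooth s" "s (0, 0) > 0" "\<forall>\<^sub>F z in nhds (0, 0). s z * s z = q z"
    using ex_smooth_sqrt_near[OF q] by blast
  \<comment> \<open>One rescaling of u in two readings: \<kappa> acts on the target coordinates (u,
    y), \<sigma> on the source through y = v^2.\<close>
  define \<kappa> where "\<kappa> z = (fst z * s z, snd z)" for z
  define \<sigma> where "\<sigma> z = (fst z * s (fst z, snd z * snd z), snd z)" for z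
  have sm: "smooth \<kappa>" "smooth \<sigma>"
    unfolding \<kappa>_def \<sigma>_def
    by (intro smooth_Pair smooth_mult smooth_compose_pair[OF s(1)] s(1) smooth_intros)+
  have fs: "fst (pu \<rho> z) = pu (\<lambda>z. fst (\<rho> z)) z" "snd (pu \<rho> z) = pu (\<lambda>z. snd (\<rho> z)) z"
     "fst (pv \<rho> z) = pv (\<lambda>z. fst (\<rho> z)) z" "snd (pv \<rho> z) = pv (\<lambda>z. snd (\<rho> z)) z"
    if "smooth \<rho>" for \<rho> :: "real \<times> real \<Rightarrow> real \<times> real" and z
    using that by (simp_all add: pu_linear_compose pv_linear_compose bounded_linear_fst bounded_linear_snd)
  have ss: "smooth (\<lambda>z. s (fst z, snd z * snd z))"
    by (rule normal_map_smooth_aux[OF K s(1)])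
  have J: "jacobian \<kappa> (0, 0) \<noteq> 0" "jacobian \<sigma> (0, 0) \<noteq> 0"
    unfolding jacobian_def fs[OF sm(1)] fs[OF sm(2)]
    using s(2) by (simp_all add: \<kappa>_def \<sigma>_def partial_simps s(1) ss smooth_intros)
  obtain \<kappa>' where \<kappa>': "local_diffeo \<kappa> \<kappa>' (0, 0) (0, 0)"
    using ex_local_diffeo[OF sm(1) J(1)] by (auto simp: \<kappa>_def)
  obtain \<sigma>' where \<sigma>': "local_diffeo \<sigma> \<sigma>' (0, 0) (0, 0)"
    using ex_local_diffeo[OF sm(2) J(2)] by (auto simp: \<sigma>_def)
  define m m' :: "real^3 \<Rightarrow> real^3"
    where "m y = vector [y $ 1, y $ 2, \<epsilon> * (y $ 3 * r (y $ 1, y $ 2))]"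
      and "m' y = vector [y $ 1, y $ 2, \<epsilon> * (y $ 3 * k1 (y $ 1, y $ 2))]" for y
  have r1: "\<forall>\<^sub>F y in nhds (0::real^3). r (y $ 1, y $ 2) * k1 (y $ 1, y $ 2) = 1"
    by (rule eventually_nhds_slice[OF r(2)]) (auto intro!: continuous_intros)
  have \<epsilon>2: "\<epsilon> * \<epsilon> = 1" using \<epsilon> by auto
  have c: "\<epsilon> * ((\<epsilon> * (x * a)) * b) = (\<epsilon> * \<epsilon>) * x * (a * b)" for x a b :: real by simp
  have l0: "lift3 \<kappa> 0 = 0" by (simp add: lift3_def \<kappa>_def vec_eq_iff forall_3)
  have m_diffeo: "local_diffeo m m' 0 0"
    unfolding local_diffeo_def
  proof (intro conjI)
    show "smooth m" "smooth m'"
      unfolding m_def m'_def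
      by (intro smooth_vector_3 smooth_mult smooth_compose_pair[OF r(1)] smooth_compose_pair[OF k1] smooth_intros)+
    show "\<forall>\<^sub>F z in nhds 0. m' (m z) = z" "\<forall>\<^sub>F z in nhds 0. m (m' z) = z"
      using r1 by (eventually_elim, simp add: m_def m'_def vec_eq_iff forall_3 c \<epsilon>2 mult.commute[of "k1 _"])+
  qed (simp_all add: m_def m'_def vec_eq_iff forall_3)
  have "local_diffeo (lift3 \<kappa>) (lift3 \<kappa>') 0 (lift3 \<kappa> 0)"
    using \<kappa>' by (intro local_diffeo_lift3) simp
  then have "local_diffeo (lift3 \<kappa>) (lift3 \<kappa>') 0 0" using l0 by simp
  with m_diffeo have T: "local_diffeo (\<lambda>y. lift3 \<kappa> (m y)) (\<lambda>y. m' (lift3 \<kappa>' y)) 0 0"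
    by (rule local_diffeo_compose)
  have n0: "normal_map L (0, 0) = 0" for L by (simp add: normal_map_def vec_eq_iff forall_3)
  have 1: "\<forall>\<^sub>F z in nhds (0::real, 0::real). r (fst z, snd z * snd z) * k1 (fst z, snd z * snd z) = 1"
    by (rule eventually_nhds_slice[OF r(2)]) (auto intro!: continuous_intros)
  have 2: "\<forall>\<^sub>F z in nhds (0::real, 0::real). s (fst z, snd z * snd z) * s (fst z, snd z * snd z) = q (fst z, snd z * snd z)"
    by (rule eventually_nhds_slice[OF s(3)]) (auto intro!: continuous_intros)
  have "\<forall>\<^sub>F z in nhds (0, 0). lift3 \<kappa> (m (normal_map K z)) = normal_map (\<lambda>z. fst z * fst z + \<epsilon> * snd z) (\<sigma> z)"
    using 1 2
  proof eventually_elim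
    case (elim z)
    define u v where "u = fst z" and "v = snd z"
    define R S where "R = r (u, v * v)" and "S = s (u, v * v)"
    have 3: "R * k1 (u, v * v) = 1" "S * S = \<epsilon> * (e' (0, u) * R)"
      using elim by (simp_all add: u_def v_def R_def S_def q_def)
    have "\<epsilon> * (v * K (u, v * v) * R) = \<epsilon> * (v * (u * u * (e' (0, u) * R) + v * v * (R * k1 (u, v * v))))"
      unfolding Ke by (simp add: algebra_simps)
    also have "\<dots> = v * (u * u * (\<epsilon> * (e' (0, u) * R)) + \<epsilon> * (v * v))"
      unfolding 3(1) by (simp add: algebra_simps)
    also have "\<dots> = v * (u * S * (u * S) + \<epsilon> * (v * v))"
      unfolding 3(2)[symmetric] by (simp add: algebra_simps)
    finally have eq: "\<epsilon> * (v * K (u, v * v) * R) = v * (u * S * (u * S) + \<epsilon> * (v * v))" .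
    show ?case
      by (simp add: lift3_def m_def normal_map_def \<kappa>_def \<sigma>_def u_def[symmetric] v_def[symmetric]
          R_def[symmetric] S_def[symmetric] eq)
  qed
  then show ?thesis
    unfolding germ_equiv_def n0 using \<sigma>' T by blast
qed

section \<open>Reduction of a germ to normal form\<close>

lemma partial_pair:
  fixes a b :: "real \<times> real \<Rightarrow> real"
  assumes "smooth a" "smooth b"
  shows "pu (\<lambda>z. (a z, b z)) = (\<lambda>z. (pu a z, pu b z))" "pv (\<lambda>z. (a z, b z)) = (\<lambda>z. (pv a z, pv b z))"
  using has_derivative_pu_pv(1,2)[OF has_derivative_Pair[OF assms[THEN smooth_has_derivative_pu_pv]]]
  by (auto simp: fun_eq_iff)

text \<open>f_u, f_vv and their cross product form a basis, with determinant the squared length of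
  the cross product; the inverse of the matrix with these columns is the linear target
  change.\<close>

lemma germ_equiv_linear_target:
  fixes f :: "real \<times> real \<Rightarrow> real^3"
  assumes f: "smooth f" and ind: "\<nexists>s. pv (pv f) p = s *\<^sub>R pu f p" and fu: "pu f p \<noteq> 0" and fv: "pv f p = 0"
  shows "\<exists>g. smooth g \<and> germ_equiv f p g p \<and> g p = 0 \<and> pu g p = axis 1 1 \<and> pv g p = 0 \<and> pv (pv g) p = axis 2 1"
proof -
  define e1 e2 e3 where "e1 = pu f p" and "e2 = pv (pv f) p" and "e3 = cross3 e1 e2"
  define A :: "real^3^3" where "A = vector [e1, e2, e3]"
  have "e3 \<noteq> 0"
    unfolding e3_def cross_eq_0 collinear_lemma using ind fu
    by (auto simp: e1_def e2_def)
  have "det A = e3 \<bullet> e3"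
    unfolding A_def det_vector_3 e3_def by (simp add: det3_def cross3_def inner_vec_def sum_3 algebra_simps)
  define B where "B = transpose A"
  have "invertible B"
    unfolding B_def using \<open>e3 \<noteq> 0\<close> \<open>det A = e3 \<bullet> e3\<close> by (simp add: invertible_det_nz det_transpose)
  then obtain N where N: "B ** N = mat 1" "N ** B = mat 1"
    unfolding invertible_def by blast
  have A1: "B *v axis 1 1 = e1" "B *v axis 2 1 = e2"
    unfolding A_def B_def by (simp_all add: vec_eq_iff matrix_vector_mult_def transpose_def sum_3 axis_def)
  have N1: "N *v e1 = axis 1 1" "N *v e2 = axis 2 1"
    unfolding A1[symmetric] matrix_vector_mul_assoc N by simp_all
  have bl: "bounded_linear ((*v) M)" for M :: "real^3^3" by (rule matrix_vector_mul_bounded_linear)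
  define g where "g z = N *v (f z - f p)" for z
  have d: "smooth (\<lambda>z. f z - f p)" by (intro smooth_intros f)
  have g: "smooth g" unfolding g_def by (rule smooth_on_linear_compose[OF bl open_UNIV d])
  have gu: "pu g = (\<lambda>z. N *v pu f z)" and gv: "pv g = (\<lambda>z. N *v pv f z)"
    unfolding g_def[abs_def] pu_linear_compose[OF d bl] pv_linear_compose[OF d bl]
    by (simp_all add: partial_simps f smooth_intros)
  have gvv: "pv (pv g) = (\<lambda>z. N *v pv (pv f) z)"
    unfolding gv by (rule pv_linear_compose[OF smooth_pv[OF f] bl])
  have "local_diffeo (\<lambda>y. N *v (y - f p)) (\<lambda>y. B *v y + f p) (f p) (g p)"
  proof (rule local_diffeo_global)
    show "smooth (\<lambda>y. N *v (y - f p))"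
      by (rule smooth_on_linear_compose[OF bl open_UNIV]) (intro smooth_intros)
    show "smooth (\<lambda>y. B *v y + f p)"
      by (intro smooth_intros smooth_linear bl)
  qed (simp_all add: matrix_vector_mul_assoc N g_def)
  then have "germ_equiv f p g p"
    by (rule germ_equiv_target) (simp add: g_def)
  then show ?thesis
    using g gu gv gvv N1 fv by (intro exI[of _ g]) (auto simp: g_def e1_def e2_def)
qed

text \<open>The first component has u-derivative 1 and serves as the new coordinate u. Its first two
  v-derivatives vanish at the origin, so the first two v-derivatives of the other components keep
  their values there.\<close>

lemma germ_equiv_first_coordinate:
  fixes g :: "real \<times> real \<Rightarrow> real^3"
  assumes g: "smooth g" and g0: "g (0, 0) = 0" "pu g (0, 0) = axis 1 1" "pv g (0, 0) = 0"
    "pv (pv g) (0, 0) = axis 2 1"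
  shows "\<exists>F G. smooth F \<and> smooth G \<and> germ_equiv g (0, 0) (\<lambda>z. vector [fst z, F z, G z]) (0, 0) \<and>
    pv F (0, 0) = 0 \<and> pv (pv F) (0, 0) = 1 \<and> pv G (0, 0) = (0::real)"
proof -
  define a where "a z = g z $ 1" for z
  have a: "smooth a" unfolding a_def by (intro smooth_nth g)
  have pa: "pu a = (\<lambda>z. pu g z $ 1)" "pv a = (\<lambda>z. pv g z $ 1)"
    unfolding a_def[abs_def] by (simp_all add: partial_simps g)
  have paa: "pv (pv a) (0, 0) = 0"
    unfolding pa by (simp add: partial_simps g smooth_pv g0 axis_def)
  define \<sigma> where "\<sigma> z = (a z, snd z)" for z
  have \<sigma>: "smooth \<sigma>" "\<sigma> (0, 0) = (0, 0)"
    unfolding \<sigma>_def by (intro smooth_Pair a smooth_intros) (simp add: a_def g0)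
  have "jacobian \<sigma> (0, 0) \<noteq> 0"
    unfolding jacobian_def \<sigma>_def partial_pair[OF a smooth_snd]
    by (simp add: partial_simps pa g0 axis_def)
  from ex_local_diffeo[OF \<sigma>(1) this] obtain \<sigma>' where \<sigma>': "local_diffeo \<sigma> \<sigma>' (0, 0) (0, 0)"
    unfolding \<sigma>(2) by blast
  have s': "smooth \<sigma>'" and inv: "\<forall>\<^sub>F z in nhds (0, 0). \<sigma>' (\<sigma> z) = z"
    using \<sigma>' by (auto simp: local_diffeo_def)
  define F G where "F z = g (\<sigma>' z) $ 2" and "G z = g (\<sigma>' z) $ 3" for z
  have FG: "smooth F" "smooth G" unfolding F_def G_def by (intro smooth_nth smooth_compose[OF g s'])+
  have eq: "\<forall>\<^sub>F z in nhds (0, 0). g z $ 2 = F (a z, snd z)" "\<forall>\<^sub>F z in nhds (0, 0). g z $ 3 = G (a z, snd z)"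
    using inv by (eventually_elim, simp add: F_def G_def \<sigma>_def)+
  have "\<forall>\<^sub>F z in nhds (0, 0). g z = vector [fst (\<sigma> z), F (\<sigma> z), G (\<sigma> z)]"
    using eq by eventually_elim (simp add: vec_eq_iff forall_3 \<sigma>_def a_def)
  then have equiv: "germ_equiv g (0, 0) (\<lambda>z. vector [fst z, F z, G z]) (0, 0)"
    by (rule germ_equiv_source[OF \<sigma>'])
  note cF = pu_compose_plane[OF FG(1) a smooth_snd] and cG = pu_compose_plane[OF FG(2) a smooth_snd]
  note e1 = pu_eventually_cong(2)[OF eq(1), unfolded cF pv_nth[OF g]]
    and e2 = pu_eventually_cong(2)[OF eq(2), unfolded cG pv_nth[OF g]]
  have F1: "pv F (0, 0) = 0"
    using eventually_nhds_x_imp_x[OF e1] by (simp add: pa g0 partial_simps) (simp add: a_def g0)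
  have G1: "pv G (0, 0) = 0"
    using eventually_nhds_x_imp_x[OF e2] by (simp add: pa g0 partial_simps) (simp add: a_def g0)
  have sF: "smooth (\<lambda>z. pu F (a z, snd z))" "smooth (\<lambda>z. pv F (a z, snd z))"
    by (intro smooth_compose_pair smooth_pu smooth_pv FG a smooth_intros)+
  have "pv (pv g) (0, 0) $ 2 = pv (\<lambda>z. pv a z *\<^sub>R pu F (a z, snd z) + pv snd z *\<^sub>R pv F (a z, snd z)) (0, 0)"
    using eventually_nhds_x_imp_x[OF pu_eventually_cong(2)[OF e1]]
    by (simp add: partial_simps g smooth_pv)
  also have "\<dots> = pv (pv F) (0, 0)"
    by (simp add: partial_simps sF smooth_pv a smooth_mult smooth_intros
        pu_compose_plane[OF smooth_pv[OF FG(1)] a smooth_snd] paa)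
       (simp add: pa g0 a_def)
  finally have F2: "pv (pv F) (0, 0) = 1" by (simp add: g0 axis_def)
  show ?thesis using FG equiv F1 F2 G1 by blast
qed

text \<open>F_vv \<noteq> 0 makes F_v itself a coordinate. Taken as the new v, it moves the
  fibrewise critical points of F onto the axis v = 0 and so prepares the Morse step.\<close>

lemma germ_equiv_critical_axis:
  fixes F G :: "real \<times> real \<Rightarrow> real"
  assumes FG: "smooth F" "smooth G" and F0: "pv F (0, 0) = 0" "pv (pv F) (0, 0) = 1" and G0: "pv G (0, 0) = 0"
  shows "\<exists>F' G'. smooth F' \<and> smooth G' \<and>
    germ_equiv (\<lambda>z. vector [fst z, F z, G z] :: real^3) (0, 0) (\<lambda>z. vector [fst z, F' z, G' z]) (0, 0) \<and>
    (\<forall>\<^sub>F z in nhds (0, 0). snd z = 0 \<longrightarrow> pv F' z = 0) \<and> pv (pv F') (0, 0) = 1 \<and> pv G' (0, 0) = (0::real)"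
proof -
  note sF = smooth_pv[OF FG(1)] smooth_pv[OF smooth_pv[OF FG(1)]]
  define \<sigma> where "\<sigma> z = (fst z, pv F z)" for z
  have \<sigma>: "smooth \<sigma>" "\<sigma> (0, 0) = (0, 0)"
    unfolding \<sigma>_def by (intro smooth_Pair sF smooth_intros) (simp add: F0)
  have "jacobian \<sigma> (0, 0) \<noteq> 0"
    unfolding jacobian_def \<sigma>_def partial_pair[OF smooth_fst sF(1)]
    by (simp add: partial_simps F0)
  from ex_local_diffeo[OF \<sigma>(1) this] obtain \<sigma>' where \<sigma>': "local_diffeo \<sigma> \<sigma>' (0, 0) (0, 0)"
    unfolding \<sigma>(2) by blast
  have s': "smooth \<sigma>'" "\<sigma>' (0, 0) = (0, 0)" and inv: "\<forall>\<^sub>F z in nhds (0, 0). \<sigma>' (\<sigma> z) = z"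
    and inv': "\<forall>\<^sub>F z in nhds (0, 0). \<sigma> (\<sigma>' z) = z"
    using \<sigma>' by (auto simp: local_diffeo_def)
  define F' G' where "F' z = F (\<sigma>' z)" and "G' z = G (\<sigma>' z)" for z
  have FG': "smooth F'" "smooth G'" unfolding F'_def G'_def by (rule smooth_compose[OF FG(1) s'(1)] smooth_compose[OF FG(2) s'(1)])+
  have eq: "\<forall>\<^sub>F z in nhds (0, 0). F z = F' (fst z, pv F z)" "\<forall>\<^sub>F z in nhds (0, 0). G z = G' (fst z, pv F z)"
    using inv by (eventually_elim, simp add: F'_def G'_def \<sigma>_def)+
  have "\<forall>\<^sub>F z in nhds (0, 0). (vector [fst z, F z, G z] :: real^3) = vector [fst (\<sigma> z), F' (\<sigma> z), G' (\<sigma> z)]"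
    using eq by eventually_elim (simp add: \<sigma>_def)
  then have equiv: "germ_equiv (\<lambda>z. vector [fst z, F z, G z] :: real^3) (0, 0) (\<lambda>z. vector [fst z, F' z, G' z]) (0, 0)"
    by (rule germ_equiv_source[OF \<sigma>'])
  have e1: "\<forall>\<^sub>F z in nhds (0, 0). pv F z = pv (pv F) z * pv F' (fst z, pv F z)"
    and e2: "\<forall>\<^sub>F z in nhds (0, 0). pv G z = pv (pv F) z * pv G' (fst z, pv F z)"
    using pu_eventually_cong(2)[OF eq(1)] pu_eventually_cong(2)[OF eq(2)]
    unfolding pu_compose_plane[OF FG'(1) smooth_fst sF(1)] pu_compose_plane[OF FG'(2) smooth_fst sF(1)]
    by (simp_all add: pv_fst)
  have G1: "pv G' (0, 0) = 0"
    using eventually_nhds_x_imp_x[OF e2] by (simp add: F0 G0 partial_simps)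
  define Q where "Q z = pv (pv F) (\<sigma>' z)" for z
  have Q: "smooth Q" "Q (0, 0) = 1" unfolding Q_def by (rule smooth_compose[OF sF(2) s'(1)]) (simp add: s' F0)
  have "\<forall>\<^sub>F z in nhds (0, 0). pv F (\<sigma>' z) = Q z * pv F' (\<sigma> (\<sigma>' z))"
    unfolding Q_def \<sigma>_def
    by (rule smooth_eventually[OF s'(1), where p="(0, 0)" and P="\<lambda>z. pv F z = pv (pv F) z * pv F' (fst z, pv F z)"])
       (simp only: s'(2) e1)
  \<comment> \<open>In the new coordinates the chain rule F_v = F_vv F'_v reads v = Q F'_v with Q(0,
    0) = 1. So F'_v = 0 on the axis, and one more v-derivative gives F'_vv = 1 at the
    origin.\<close>
  with inv' have e3: "\<forall>\<^sub>F z in nhds (0, 0). snd z = Q z * pv F' z"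
  proof eventually_elim
    case (elim z)
    have "snd (\<sigma> (\<sigma>' z)) = pv F (\<sigma>' z)" unfolding \<sigma>_def by simp
    also note elim(2)
    finally show ?case unfolding elim(1) .
  qed
  have "open (Q -` (- {0}))"
    using smooth_on_imp_continuous_on[OF Q(1)] by (intro open_vimage) auto
  from eventually_nhds_in_open[OF this, of "(0, 0)"] have "\<forall>\<^sub>F z in nhds (0, 0). Q z \<noteq> 0"
    using Q(2) by simp
  with e3 have F1: "\<forall>\<^sub>F z in nhds (0, 0). snd z = 0 \<longrightarrow> pv F' z = 0"
    by eventually_elim auto
  have "pv F' (0, 0) = 0" using eventually_nhds_x_imp_x[OF F1] by simp
  then have "pv (pv F') (0, 0) = 1"
    using eventually_nhds_x_imp_x[OF pu_eventually_cong(2)[OF e3]] Q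
    by (simp add: partial_simps FG' smooth_pv)
  then show ?thesis using FG' equiv F1 G1 by blast
qed

text \<open>With F_v = 0 on the axis, Taylor's formula reads F = F(u, 0) + v^2 h with h(0, 0) = 1/2,
  and v sqrt h is the fibrewise Morse coordinate. It leaves u alone, so the first component is
  kept.\<close>

lemma germ_equiv_fold:
  fixes F G :: "real \<times> real \<Rightarrow> real"
  assumes FG: "smooth F" "smooth G" and F0: "\<forall>\<^sub>F z in nhds (0, 0). snd z = 0 \<longrightarrow> pv F z = 0"
    "pv (pv F) (0, 0) = 1" and G0: "pv G (0, 0) = 0"
  shows "\<exists>G'. smooth G' \<and>
    germ_equiv (\<lambda>z. vector [fst z, F z, G z] :: real^3) (0, 0)
      (\<lambda>z. vector [fst z, F (fst z, 0) + snd z * snd z, G' z]) (0, 0) \<and> pv G' (0, 0) = (0::real)"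
proof -
  obtain h where h: "smooth h" "\<And>u v. F (u, v) = F (u, 0) + v * pv F (u, 0) + v * v * h (u, v)"
    "\<And>u. 2 * h (u, 0) = pv (pv F) (u, 0)"
    using hadamard_second[OF FG(1)] by blast
  have "h (0, 0) > 0" using h(3)[of 0] F0(2) by simp
  then obtain s where s: "smooth s" "s (0, 0) > 0" "\<forall>\<^sub>F z in nhds (0, 0). s z * s z = h z"
    using ex_smooth_sqrt_near[OF h(1)] by blast
  define b where "b z = snd z * s z" for z
  have b: "smooth b" unfolding b_def by (intro smooth_mult s smooth_intros)
  have b0: "b (0, 0) = 0" "pv b (0, 0) = s (0, 0)"
    unfolding b_def[abs_def] by (simp_all add: partial_simps s smooth_intros)
  define \<sigma> where "\<sigma> z = (fst z, b z)" for z
  have \<sigma>: "smooth \<sigma>" "\<sigma> (0, 0) = (0, 0)"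
    unfolding \<sigma>_def by (intro smooth_Pair b smooth_intros) (simp add: b0)
  have "jacobian \<sigma> (0, 0) \<noteq> 0"
    unfolding jacobian_def \<sigma>_def partial_pair[OF smooth_fst b]
    using s by (simp add: partial_simps b0)
  from ex_local_diffeo[OF \<sigma>(1) this] obtain \<sigma>' where \<sigma>': "local_diffeo \<sigma> \<sigma>' (0, 0) (0, 0)"
    unfolding \<sigma>(2) by blast
  have s': "smooth \<sigma>'" and inv: "\<forall>\<^sub>F z in nhds (0, 0). \<sigma>' (\<sigma> z) = z"
    using \<sigma>' by (auto simp: local_diffeo_def)
  define G' where "G' z = G (\<sigma>' z)" for z
  have G': "smooth G'" unfolding G'_def by (rule smooth_compose[OF FG(2) s'])
  have eq: "\<forall>\<^sub>F z in nhds (0, 0). G z = G' (fst z, b z)"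
    using inv by eventually_elim (simp add: G'_def \<sigma>_def)
  have ax: "\<forall>\<^sub>F z in nhds (0::real, 0::real). snd (fst z, 0::real) = 0 \<longrightarrow> pv F (fst z, 0) = 0"
    by (rule eventually_nhds_slice[OF F0(1)]) (auto intro!: continuous_intros)
  have "\<forall>\<^sub>F z in nhds (0, 0). (vector [fst z, F z, G z] :: real^3) =
      vector [fst (\<sigma> z), F (fst (\<sigma> z), 0) + snd (\<sigma> z) * snd (\<sigma> z), G' (\<sigma> z)]"
    using eq s(3) ax
  proof eventually_elim
    case (elim z)
    have "F z = F (fst z, 0) + b z * b z"
      using h(2)[of "fst z" "snd z"] elim(3) unfolding b_def
      by (simp add: elim(2)[symmetric] algebra_simps)
    with elim(1) show ?case by (simp add: \<sigma>_def)
  qed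
  then have equiv: "germ_equiv (\<lambda>z. vector [fst z, F z, G z] :: real^3) (0, 0)
      (\<lambda>z. vector [fst z, F (fst z, 0) + snd z * snd z, G' z]) (0, 0)"
    by (rule germ_equiv_source[OF \<sigma>'])
  have "pv G' (0, 0) = 0"
    using eventually_nhds_x_imp_x[OF pu_eventually_cong(2)[OF eq, unfolded pu_compose_plane[OF G' smooth_fst b]]] s
    by (simp add: partial_simps b0 G0)
  then show ?thesis using G' equiv by blast
qed

text \<open>The even part of G is E(u, v^2) near the origin. Both it and F(u, 0) are functions of
  earlier target coordinates and are removed by a triangular target change with a global inverse.
  The odd part is v times an even function, which becomes K(u, v^2), and K(0, 0) = G_v(0,
  0).\<close>

lemma germ_equiv_normal_map:
  fixes F G :: "real \<times> real \<Rightarrow> real"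
  assumes FG: "smooth F" "smooth G" and G0: "pv G (0, 0) = 0"
  shows "\<exists>K. smooth K \<and> K (0, 0) = (0::real) \<and>
    germ_equiv (\<lambda>z. vector [fst z, F (fst z, 0) + snd z * snd z, G z]) (0, 0) (normal_map K) (0, 0)"
proof -
  have sm: "smooth (\<lambda>z. G (fst z, - snd z))"
    by (intro smooth_compose_pair FG smooth_minus smooth_intros)
  define e where "e z = 1 / 2 * (G z + G (fst z, - snd z))" for z
  define od where "od z = 1 / 2 * (G z - G (fst z, - snd z))" for z
  have eo: "smooth e" "smooth od"
    unfolding e_def od_def by (intro smooth_mult smooth_add smooth_diff smooth_const sm FG)+
  define k where "k = ray_mean 0 (pv od)"
  have k: "smooth k" unfolding k_def by (intro smooth_ray_mean smooth_pv eo)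
  have odk: "od (u, v) = v * k (u, v)" for u v
    using hadamard[OF eo(2), of u v] by (simp add: k_def od_def)
  have "k (u, - v) = k (u, v)" for u v
    using odk[of u v] odk[of u "- v"] by (cases "v = 0") (auto simp: od_def algebra_simps)
  then obtain K where K: "smooth K" "\<And>u v. \<bar>u\<bar> \<le> 1 \<Longrightarrow> \<bar>v\<bar> \<le> 1 \<Longrightarrow> k (u, v) = K (u, v\<^sup>2)"
    using whitney_even[OF k] by blast
  have "e (u, - v) = e (u, v)" for u v by (simp add: e_def)
  then obtain E where E: "smooth E" "\<And>u v. \<bar>u\<bar> \<le> 1 \<Longrightarrow> \<bar>v\<bar> \<le> 1 \<Longrightarrow> e (u, v) = E (u, v\<^sup>2)"
    using whitney_even[OF eo(1)] by blast
  have "pv (\<lambda>z. G (fst z, - snd z)) (0, 0) = - pv G (0, 0)"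
    using pu_compose_plane(2)[OF FG(2) smooth_fst smooth_minus[OF smooth_snd]]
    by (simp add: partial_simps smooth_intros)
  then have "pv od (0, 0) = 0"
    unfolding od_def[abs_def] pv_mult[OF smooth_const smooth_diff[OF FG(2) sm]] pv_diff[OF FG(2) sm] pv_const
    using G0 by simp
  then have K0: "K (0, 0) = 0"
    using K(2)[of 0 0] by (simp add: k_def ray_mean_zero)
  define \<tau> \<tau>' :: "real^3 \<Rightarrow> real^3"
    where "\<tau> y = vector [y $ 1, y $ 2 - F (y $ 1, 0), y $ 3 - E (y $ 1, y $ 2 - F (y $ 1, 0))]"
      and "\<tau>' y = vector [y $ 1, y $ 2 + F (y $ 1, 0), y $ 3 + E (y $ 1, y $ 2)]" for y
  let ?f = "\<lambda>z::real\<times>real. vector [fst z, F (fst z, 0) + snd z * snd z, G z] :: real^3"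
  have near: "\<forall>\<^sub>F z in nhds (0::real, 0::real). \<bar>fst z\<bar> \<le> 1 \<and> \<bar>snd z\<bar> \<le> 1"
  proof -
    have "open {z::real\<times>real. \<bar>fst z\<bar> < 1 \<and> \<bar>snd z\<bar> < 1}"
      by (intro open_Collect_conj open_Collect_less continuous_intros)
    from eventually_nhds_in_open[OF this, of "(0, 0)"] show ?thesis
      by (auto elim!: eventually_mono)
  qed
  have eq: "\<forall>\<^sub>F z in nhds (0, 0). \<tau> (?f z) = normal_map K z"
    using near
  proof eventually_elim
    case (elim z)
    have "G z - E (fst z, snd z * snd z) = snd z * K (fst z, snd z * snd z)"
      using K(2)[of "fst z" "snd z"] E(2)[of "fst z" "snd z"] elim odk[of "fst z" "snd z"]
      by (simp add: e_def od_def power2_eq_square field_simps)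
    then show ?case by (simp add: \<tau>_def normal_map_def)
  qed
  have "local_diffeo \<tau> \<tau>' (?f (0, 0)) (normal_map K (0, 0))"
  proof (rule local_diffeo_global)
    show "smooth \<tau>" "smooth \<tau>'"
      unfolding \<tau>_def \<tau>'_def
      by (intro smooth_vector_3 smooth_add smooth_diff smooth_compose_pair[OF FG(1)]
          smooth_compose_pair[OF E(1)] smooth_intros)+
    show "\<tau> (?f (0, 0)) = normal_map K (0, 0)" using eventually_nhds_x_imp_x[OF eq] .
  qed (simp_all add: \<tau>_def \<tau>'_def vec_eq_iff forall_3)
  from germ_equiv_target[OF this eq] K(1) K0 show ?thesis by blast
qed

theorem germ_equiv_normal_form:
  fixes f :: "real \<times> real \<Rightarrow> real^3"
  assumes f: "smooth f" and ind: "\<nexists>s. pv (pv f) (0, 0) = s *\<^sub>R pu f (0, 0)"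
    and fu: "pu f (0, 0) \<noteq> 0" and fv: "pv f (0, 0) = 0"
  shows "\<exists>K. smooth K \<and> K (0, 0) = 0 \<and> germ_equiv f (0, 0) (normal_map K) (0, 0)"
proof -
  obtain g where 1: "smooth g" "germ_equiv f (0, 0) g (0, 0)" "g (0, 0) = 0" "pu g (0, 0) = axis 1 1"
    "pv g (0, 0) = 0" "pv (pv g) (0, 0) = axis 2 1"
    using germ_equiv_linear_target[OF f ind fu fv] by blast
  obtain F G where 2: "smooth F" "smooth G" "germ_equiv g (0, 0) (\<lambda>z. vector [fst z, F z, G z]) (0, 0)"
    "pv F (0, 0) = 0" "pv (pv F) (0, 0) = 1" "pv G (0, 0) = 0"
    using germ_equiv_first_coordinate[OF 1(1,3-6)] by blast
  obtain F' G' where 3: "smooth F'" "smooth G'"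
    "germ_equiv (\<lambda>z. vector [fst z, F z, G z] :: real^3) (0, 0) (\<lambda>z. vector [fst z, F' z, G' z]) (0, 0)"
    "\<forall>\<^sub>F z in nhds (0, 0). snd z = 0 \<longrightarrow> pv F' z = 0" "pv (pv F') (0, 0) = 1" "pv G' (0, 0) = 0"
    using germ_equiv_critical_axis[OF 2(1,2,4-6)] by blast
  obtain H where 4: "smooth H" "germ_equiv (\<lambda>z. vector [fst z, F' z, G' z] :: real^3) (0, 0)
      (\<lambda>z. vector [fst z, F' (fst z, 0) + snd z * snd z, H z]) (0, 0)" "pv H (0, 0) = 0"
    using germ_equiv_fold[OF 3(1,2,4-6)] by blast
  obtain K where 5: "smooth K" "K (0, 0) = 0"
    "germ_equiv (\<lambda>z. vector [fst z, F' (fst z, 0) + snd z * snd z, H z]) (0, 0) (normal_map K) (0, 0)"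
    using germ_equiv_normal_map[OF 3(1) 4(1,3)] by blast
  show ?thesis
    using 5(1,2) germ_equiv_trans[OF 1(2) germ_equiv_trans[OF 2(3) germ_equiv_trans[OF 3(3)
        germ_equiv_trans[OF 4(2) 5(3)]]]] by blast
qed

section \<open>The criterion for S_1 germs\<close>

text \<open>In Phi_vv at a point with f_v = 0 every determinant has a zero or repeated entry except
  det(f_u, f_vv, f_vvv), which collinearity kills. What remains of the Hessian determinant is minus
  the square of Phi_uv.\<close>

lemma hess_Phi_collinear:
  fixes f :: "real \<times> real \<Rightarrow> real^3"
  assumes f: "smooth f" and fv: "pv f p = 0" and col: "pv (pv f) p = s *\<^sub>R pu f p"
  shows "hess (Phi f) p \<le> 0"
proof -
  have z: "det3 x y y = 0" "det3 x y x = 0" "det3 x x y = 0" "det3 x 0 y = 0" "det3 x y 0 = 0"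
    "det3 x (r *\<^sub>R x) y = 0" "det3 x y (r *\<^sub>R x) = 0" "det3 x (r *\<^sub>R y) y = 0" for x y r
    by (simp_all add: det3_def)
  have "pv (pv (Phi f)) p = 0"
    unfolding Phi_def[abs_def]
    by (simp add: partial_det3 f smooth_pu smooth_pv smooth_det3 partial_simps smooth_add fv col z)
  then show ?thesis by (simp add: hess_def)
qed

text \<open>The model with sign \<epsilon> has K_uu = 2 and K_y = \<epsilon>, hence Hessian
  determinant -48 \<epsilon>, so one condition on \<epsilon> times the Hessian treats both cases.
  Independence of f_u and f_vv, which gives access to the normal form, is required for S_1^+ and
  follows from positivity for S_1^-.\<close>

theorem S1_criterion:
  fixes f :: "real \<times> real \<Rightarrow> real^3"
  assumes f: "smooth f" and fu: "pu f (0, 0) \<noteq> 0" and fv: "pv f (0, 0) = 0"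
  shows "germ_equiv f (0, 0) S1_plus_germ (0, 0) \<longleftrightarrow> vanishes 2 (Phi f) (0, 0) \<and>
      hess (Phi f) (0, 0) < 0 \<and> (\<nexists>s. pv (pv f) (0, 0) = s *\<^sub>R pu f (0, 0))" (is "?P \<longleftrightarrow> _")
    and "germ_equiv f (0, 0) S1_minus_germ (0, 0) \<longleftrightarrow> vanishes 2 (Phi f) (0, 0) \<and>
      hess (Phi f) (0, 0) > 0" (is "?M \<longleftrightarrow> _")
proof -
  define N where "N \<epsilon> z = fst z * fst z + \<epsilon> * snd z" for \<epsilon> and z :: "real \<times> real"
  have gN: "S1_plus_germ = normal_map (N 1)" "S1_minus_germ = normal_map (N (- 1))"
    by (simp_all add: S1_plus_germ_eq S1_minus_germ_eq N_def[abs_def])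
  have N: "smooth (N \<epsilon>)" for \<epsilon> unfolding N_def by (intro smooth_add smooth_mult smooth_intros)
  have N0: "N \<epsilon> (0, 0) = 0" "pu (N \<epsilon>) (0, 0) = 0" "pu (pu (N \<epsilon>)) (0, 0) = 2" "pv (N \<epsilon>) (0, 0) = \<epsilon>" for \<epsilon>
    unfolding N_def[abs_def]
    by (simp_all add: partial_simps smooth_add smooth_mult smooth_intros)
  have only_if: "vanishes 2 (Phi f) (0, 0) \<and> \<epsilon> * hess (Phi f) (0, 0) < 0 \<and>
      (\<nexists>s. pv (pv f) (0, 0) = s *\<^sub>R pu f (0, 0))"
    if "germ_equiv f (0, 0) (normal_map (N \<epsilon>)) (0, 0)" "\<epsilon> = 1 \<or> \<epsilon> = - 1" for \<epsilon>
  proof -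
    note n = normal_map_at_zero[OF N N0(1), of \<epsilon>]
    note i = germ_equiv_invariants[OF f smooth_normal_map[OF N] that(1) fv fu n(1)]
    have c: "vanishes 2 (Phi f) (0, 0)" using i(1) n(2) N0 by blast
    obtain k where k: "k > 0" "- 24 * (2 * \<epsilon>) = k * hess (Phi f) (0, 0)"
      using i(2)[OF c] n(3) N0 by auto
    have "k * (\<epsilon> * hess (Phi f) (0, 0)) = \<epsilon> * (k * hess (Phi f) (0, 0))" by simp
    also have "\<dots> < 0" unfolding k(2)[symmetric] using that(2) by auto
    finally have "\<epsilon> * hess (Phi f) (0, 0) < 0" using k(1) by (simp add: mult_less_0_iff)
    with c i(3) n(4) show ?thesis by blast
  qed
  have "if": "germ_equiv f (0, 0) (normal_map (N \<epsilon>)) (0, 0)"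
    if c: "vanishes 2 (Phi f) (0, 0)" "\<epsilon> * hess (Phi f) (0, 0) < 0" "\<epsilon> = 1 \<or> \<epsilon> = - 1"
      "\<nexists>s. pv (pv f) (0, 0) = s *\<^sub>R pu f (0, 0)" for \<epsilon>
  proof -
    obtain K where K: "smooth K" "K (0, 0) = 0" "germ_equiv f (0, 0) (normal_map K) (0, 0)"
      using germ_equiv_normal_form[OF f c(4) fu fv] by blast
    note n = normal_map_at_zero[OF K(1,2)]
    note i = germ_equiv_invariants[OF f smooth_normal_map[OF K(1)] K(3) fv fu n(1)]
    have K0: "pu K (0, 0) = 0" using i(1) n(2) c(1) by blast
    obtain k where k: "k > 0" "- 24 * (pu (pu K) (0, 0) * pv K (0, 0)) = k * hess (Phi f) (0, 0)"
      using i(2)[OF c(1)] n(3) by auto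
    have "24 * (\<epsilon> * (pu (pu K) (0, 0) * pv K (0, 0))) = - (\<epsilon> * (- 24 * (pu (pu K) (0, 0) * pv K (0, 0))))"
      by simp
    also have "\<dots> = - (k * (\<epsilon> * hess (Phi f) (0, 0)))"
      unfolding k(2) by simp
    also have "\<dots> > 0" using k(1) c(2) by (simp add: mult_pos_neg)
    finally have "\<epsilon> * (pu (pu K) (0, 0) * pv K (0, 0)) > 0" by (simp add: mult_ac)
    from germ_equiv_trans[OF K(3) normal_map_equiv_S1[OF K(1,2) K0 c(3) this]]
    show ?thesis by (simp add: N_def[abs_def])
  qed
  show "?P \<longleftrightarrow> vanishes 2 (Phi f) (0, 0) \<and>
      hess (Phi f) (0, 0) < 0 \<and> (\<nexists>s. pv (pv f) (0, 0) = s *\<^sub>R pu f (0, 0))"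
    unfolding gN using only_if[of 1] "if"[of 1] by auto
  have "\<nexists>s. pv (pv f) (0, 0) = s *\<^sub>R pu f (0, 0)" if "hess (Phi f) (0, 0) > 0"
    using hess_Phi_collinear[OF f fv] that by fastforce
  then show "?M \<longleftrightarrow> vanishes 2 (Phi f) (0, 0) \<and> hess (Phi f) (0, 0) > 0"
    unfolding gN using only_if[of "- 1"] "if"[of "- 1"] by auto
qed

section \<open>Sums of two curves\<close>

lemma germ_equiv_cong:
  assumes "\<forall>\<^sub>F z in nhds p. f z = f' z" "germ_equiv f p g q"
  shows "germ_equiv f' p g q"
proof -
  obtain \<sigma> \<sigma>' \<tau> \<tau>' where 1: "local_diffeo \<sigma> \<sigma>' p q" "local_diffeo \<tau> \<tau>' (f p) (g q)"
    "\<forall>\<^sub>F z in nhds p. \<tau> (f z) = g (\<sigma> z)" using assms(2) unfolding germ_equiv_def by blast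
  have "\<forall>\<^sub>F z in nhds p. \<tau> (f' z) = g (\<sigma> z)" using 1(3) assms(1) by eventually_elim simp
  with 1(1,2) eventually_nhds_x_imp_x[OF assms(1)] show ?thesis
    unfolding germ_equiv_def by metis
qed

lemma germ_equiv_affine_source:
  fixes h :: "real \<times> real \<Rightarrow> real^3"
  assumes d: "a1 * b2 - a2 * b1 \<noteq> 0"
    and f: "\<And>z. f z = h (fst p + a1 * fst z + a2 * snd z, snd p + b1 * fst z + b2 * snd z)"
  shows "germ_equiv f (0, 0) g q \<longleftrightarrow> germ_equiv h p g q"
proof -
  define \<sigma> where "\<sigma> z = (fst p + a1 * fst z + a2 * snd z, snd p + b1 * fst z + b2 * snd z)" for z
  define \<sigma>' where "\<sigma>' y = (inverse (a1 * b2 - a2 * b1) * (b2 * (fst y - fst p) - a2 * (snd y - snd p)),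
    inverse (a1 * b2 - a2 * b1) * (a1 * (snd y - snd p) - b1 * (fst y - fst p)))" for y
  have D: "local_diffeo \<sigma> \<sigma>' (0, 0) p"
  proof (rule local_diffeo_global)
    show "smooth \<sigma>" "smooth \<sigma>'" unfolding \<sigma>_def \<sigma>'_def by (intro smooth_intros)+
    show "\<sigma>' (\<sigma> z) = z" for z
    proof -
      define r where "r = inverse (a1 * b2 - a2 * b1)"
      have r: "r * (a1 * b2 - a2 * b1) = 1" using d by (simp add: r_def)
      have "r * (b2 * (a1 * x + a2 * w) - a2 * (b1 * x + b2 * w)) = (r * (a1 * b2 - a2 * b1)) * x"
        "r * (a1 * (b1 * x + b2 * w) - b1 * (a1 * x + a2 * w)) = (r * (a1 * b2 - a2 * b1)) * w" for x w
        by (simp_all add: algebra_simps)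
      then show ?thesis unfolding \<sigma>_def \<sigma>'_def r_def[symmetric] using r by (simp add: add.assoc prod_eq_iff)
    qed
    show "\<sigma> (\<sigma>' y) = y" for y
    proof -
      define r where "r = inverse (a1 * b2 - a2 * b1)"
      have r: "r * (a1 * b2 - a2 * b1) = 1" using d by (simp add: r_def)
      have "a1 * (r * (b2 * x - a2 * w)) + a2 * (r * (a1 * w - b1 * x)) = (r * (a1 * b2 - a2 * b1)) * x"
        "b1 * (r * (b2 * x - a2 * w)) + b2 * (r * (a1 * w - b1 * x)) = (r * (a1 * b2 - a2 * b1)) * w" for x w
        by (simp_all add: algebra_simps)
      then show ?thesis unfolding \<sigma>_def \<sigma>'_def r_def[symmetric] using r by (simp add: add.assoc prod_eq_iff)
    qed
    show "\<sigma> (0, 0) = p" by (simp add: \<sigma>_def)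
  qed
  have "germ_equiv f (0, 0) h p"
    by (rule germ_equiv_source[OF D]) (simp add: f \<sigma>_def)
  moreover have "germ_equiv h p f (0, 0)"
  proof (rule germ_equiv_source[OF local_diffeo_sym[OF D]])
    have "\<forall>\<^sub>F y in nhds p. \<sigma> (\<sigma>' y) = y" using D by (simp add: local_diffeo_def)
    then show "\<forall>\<^sub>F y in nhds p. h y = f (\<sigma>' y)"
      by eventually_elim (simp add: f flip: \<sigma>_def)
  qed
  ultimately show ?thesis using germ_equiv_trans by blast
qed

text \<open>The witness is the direction that D\<sigma> maps into the v-axis, the kernel of Dg; it
  is nonzero because the Jacobian is. If both partials of f vanished, D\<sigma> would map every
  direction into that kernel.\<close>

lemma germ_equiv_rank:
  fixes f g :: "real \<times> real \<Rightarrow> real^3"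
  assumes f: "smooth f" and g: "smooth g" and equiv: "germ_equiv f p g q"
    and gu: "pu g q \<noteq> 0" and gv: "pv g q = 0"
  shows "\<exists>y1 y2. (y1 \<noteq> 0 \<or> y2 \<noteq> 0) \<and> y1 *\<^sub>R pu f p + y2 *\<^sub>R pv f p = 0"
    and "pu f p \<noteq> 0 \<or> pv f p \<noteq> 0"
proof -
  obtain \<sigma> \<sigma>' \<tau> \<tau>' where S: "local_diffeo \<sigma> \<sigma>' p q" and T: "local_diffeo \<tau> \<tau>' (f p) (g q)"
    and e: "\<forall>\<^sub>F z in nhds p. \<tau> (f z) = g (\<sigma> z)"
    using equiv unfolding germ_equiv_def by blast
  have s: "smooth \<sigma>" "\<sigma> p = q" and t: "smooth \<tau>" using S T by (auto simp: local_diffeo_def)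
  let ?D = "frechet_derivative \<tau> (at (f p))"
  have lin: "linear ?D" using smooth_has_derivative[OF t] has_derivative_linear by blast
  have J: "jacobian \<sigma> p \<noteq> 0" by (rule local_diffeo_jacobian[OF S])
  have d: "?D (pu f p) = fst (pu \<sigma> p) *\<^sub>R pu g q" "?D (pv f p) = fst (pv \<sigma> p) *\<^sub>R pu g q"
    using eventually_nhds_x_imp_x[OF pu_eventually_cong(1)[OF e]] eventually_nhds_x_imp_x[OF pu_eventually_cong(2)[OF e]]
    unfolding pu_compose_vec[OF t f] partial_compose[OF g s(1)] s(2) gv by simp_all
  have "?D (fst (pv \<sigma> p) *\<^sub>R pu f p + (- fst (pu \<sigma> p)) *\<^sub>R pv f p) = 0"
    by (simp add: linear_add[OF lin] linear_diff[OF lin] linear_scale[OF lin] d)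
  from local_diffeo_derivative_inj[OF T this]
  show "\<exists>y1 y2. (y1 \<noteq> 0 \<or> y2 \<noteq> 0) \<and> y1 *\<^sub>R pu f p + y2 *\<^sub>R pv f p = 0"
    using J unfolding jacobian_def
    by (intro exI[of _ "fst (pv \<sigma> p)"] exI[of _ "- fst (pu \<sigma> p)"]) auto
  show "pu f p \<noteq> 0 \<or> pv f p \<noteq> 0"
  proof (rule ccontr)
    assume "\<not> (pu f p \<noteq> 0 \<or> pv f p \<noteq> 0)"
    with d gu linear_0[OF lin] have "fst (pu \<sigma> p) = 0" "fst (pv \<sigma> p) = 0" by auto
    with J show False by (simp add: jacobian_def)
  qed
qed

text \<open>With f_v = 0 the value of Phi and its v-derivative vanish automatically, so criticality
  is the single equation Phi_u = 0.\<close>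

lemma vanishes_2_Phi_iff:
  fixes f :: "real \<times> real \<Rightarrow> real^3"
  assumes f: "smooth f" and fv: "pv f p = 0"
  shows "vanishes 2 (Phi f) p \<longleftrightarrow> det3 (pu f p) (pu (pv f) p) (pv (pv f) p) = 0"
proof -
  have z: "det3 x 0 y = 0" for x y by (simp add: det3_def)
  have "pu (Phi f) p = det3 (pu f p) (pu (pv f) p) (pv (pv f) p)"
    unfolding Phi_def[abs_def] by (simp add: partial_det3 f smooth_pu smooth_pv fv z)
  then show ?thesis
    using vanishes_Phi[OF f fv] pv_Phi[OF f fv] by (simp add: vanishes_2)
qed

section \<open>Sums of curves in affine coordinates\<close>

text \<open>The Frechet derivative in direction 1, so that smoothness of directional derivatives
  applies directly and no domain appears.\<close>

definition curve_deriv :: "(real \<Rightarrow> real^3) \<Rightarrow> real \<Rightarrow> real^3" where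
  "curve_deriv c u = frechet_derivative c (at u) 1"

lemma smooth_curve_deriv: "smooth c \<Longrightarrow> smooth (curve_deriv c)"
  unfolding curve_deriv_def[abs_def] by (rule smooth_on_derivative) auto

lemma has_derivative_curve_deriv:
  assumes "smooth c"
  shows "(c has_derivative (\<lambda>h. h *\<^sub>R curve_deriv c u)) (at u)"
proof -
  note d = smooth_has_derivative[OF assms, of u]
  have "frechet_derivative c (at u) h = h *\<^sub>R curve_deriv c u" for h
    using linear_scale[OF has_derivative_linear[OF d], of h 1] by (simp add: curve_deriv_def)
  then have "frechet_derivative c (at u) = (\<lambda>h. h *\<^sub>R curve_deriv c u)" by auto
  with d show ?thesis by simp
qed

lemma has_vector_derivative_curve_deriv: "smooth c \<Longrightarrow> (c has_vector_derivative curve_deriv c u) (at u)"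
  using has_derivative_curve_deriv by (simp add: has_vector_derivative_def)

lemma partial_curve:
  assumes "smooth c"
  shows "pu (\<lambda>z. c (a0 + a1 * fst z + a2 * snd z)) = (\<lambda>z. a1 *\<^sub>R curve_deriv c (a0 + a1 * fst z + a2 * snd z))"
    and "pv (\<lambda>z. c (a0 + a1 * fst z + a2 * snd z)) = (\<lambda>z. a2 *\<^sub>R curve_deriv c (a0 + a1 * fst z + a2 * snd z))"
proof -
  have "((\<lambda>z. a0 + a1 * fst z + a2 * snd z) has_derivative (\<lambda>w. a1 * fst w + a2 * snd w)) (at z)" for z
    by (auto intro!: derivative_eq_intros)
  from has_derivative_pu_pv(1,2)[OF has_derivative_compose[OF this has_derivative_curve_deriv[OF assms]]]
  show "pu (\<lambda>z. c (a0 + a1 * fst z + a2 * snd z)) = (\<lambda>z. a1 *\<^sub>R curve_deriv c (a0 + a1 * fst z + a2 * snd z))"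
    and "pv (\<lambda>z. c (a0 + a1 * fst z + a2 * snd z)) = (\<lambda>z. a2 *\<^sub>R curve_deriv c (a0 + a1 * fst z + a2 * snd z))"
    by auto
qed

lemma smooth_curve_affine: "smooth c \<Longrightarrow> smooth (\<lambda>z::real\<times>real. c (a0 + a1 * fst z + a2 * snd z))"
  by (rule smooth_compose, assumption) (intro smooth_intros)

context
  fixes c c' :: "real \<Rightarrow> real^3" and u0 v0 a1 a2 b1 b2 :: real and f :: "real \<times> real \<Rightarrow> real^3"
  assumes c: "smooth c" "smooth c'"
    and f_def: "f = (\<lambda>z. c (u0 + a1 * fst z + a2 * snd z) + c' (v0 + b1 * fst z + b2 * snd z))"
begin

lemma smooth_curve_sum: "smooth f"
  unfolding f_def by (intro smooth_add smooth_curve_affine c)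

lemma curve_sum_partials:
  "pu f = (\<lambda>z. a1 *\<^sub>R curve_deriv c (u0 + a1 * fst z + a2 * snd z) + b1 *\<^sub>R curve_deriv c' (v0 + b1 * fst z + b2 * snd z))"
  "pv f = (\<lambda>z. a2 *\<^sub>R curve_deriv c (u0 + a1 * fst z + a2 * snd z) + b2 *\<^sub>R curve_deriv c' (v0 + b1 * fst z + b2 * snd z))"
  "pu (pv f) = (\<lambda>z. (a1 * a2) *\<^sub>R curve_deriv (curve_deriv c) (u0 + a1 * fst z + a2 * snd z) +
     (b1 * b2) *\<^sub>R curve_deriv (curve_deriv c') (v0 + b1 * fst z + b2 * snd z))"
  "pv (pv f) = (\<lambda>z. (a2 * a2) *\<^sub>R curve_deriv (curve_deriv c) (u0 + a1 * fst z + a2 * snd z) +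
     (b2 * b2) *\<^sub>R curve_deriv (curve_deriv c') (v0 + b1 * fst z + b2 * snd z))"
proof -
  note s = smooth_curve_affine c smooth_curve_deriv
  show "pu f = (\<lambda>z. a1 *\<^sub>R curve_deriv c (u0 + a1 * fst z + a2 * snd z) + b1 *\<^sub>R curve_deriv c' (v0 + b1 * fst z + b2 * snd z))"
    unfolding f_def by (simp add: partial_simps partial_curve s)
  show v: "pv f = (\<lambda>z. a2 *\<^sub>R curve_deriv c (u0 + a1 * fst z + a2 * snd z) + b2 *\<^sub>R curve_deriv c' (v0 + b1 * fst z + b2 * snd z))"
    unfolding f_def by (simp add: partial_simps partial_curve s)
  show "pu (pv f) = (\<lambda>z. (a1 * a2) *\<^sub>R curve_deriv (curve_deriv c) (u0 + a1 * fst z + a2 * snd z) +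
     (b1 * b2) *\<^sub>R curve_deriv (curve_deriv c') (v0 + b1 * fst z + b2 * snd z))"
    "pv (pv f) = (\<lambda>z. (a2 * a2) *\<^sub>R curve_deriv (curve_deriv c) (u0 + a1 * fst z + a2 * snd z) +
     (b2 * b2) *\<^sub>R curve_deriv (curve_deriv c') (v0 + b1 * fst z + b2 * snd z))"
    unfolding v
    by (simp_all add: partial_simps pu_scaleR pv_scaleR partial_curve s smooth_scaleR smooth_const mult.commute)
qed

end

text \<open>Here Phi is the determinant of the velocity of c and the first two derivatives of c'. A
  u-derivative does not touch the velocity of c', which is 0 at v0, so Phi_uu = 0. In Phi_uv
  differentiating that velocity repeats the third entry, so this vanishes as well.\<close>

lemma hess_Phi_singular_curve:
  fixes c c' :: "real \<Rightarrow> real^3"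
  assumes c: "smooth c" "smooth c'" and c'0: "curve_deriv c' v0 = 0"
    and f_def: "f = (\<lambda>z. c (u0 + 1 * fst z + 0 * snd z) + c' (v0 + 0 * fst z + 1 * snd z))"
  shows "hess (Phi f) (0, 0) = 0"
proof -
  note p = curve_sum_partials[OF c f_def]
  note s = smooth_curve_affine smooth_curve_deriv c
  have z: "det3 x 0 y = 0" "det3 x y y = 0" "det3 x y 0 = 0" for x y by (simp_all add: det3_def)
  define A where "A = (\<lambda>z. curve_deriv c (u0 + 1 * fst z + 0 * snd z))"
  define B where "B = (\<lambda>z. curve_deriv c' (v0 + 0 * fst z + 1 * snd z))"
  define C where "C = (\<lambda>z. curve_deriv (curve_deriv c') (v0 + 0 * fst z + 1 * snd z))"
  have sm: "smooth A" "smooth B" "smooth C"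
    unfolding A_def B_def C_def by (intro s)+
  have P: "Phi f = (\<lambda>z. det3 (A z) (B z) (C z))"
    unfolding Phi_def[abs_def] p(4) unfolding p(1,2) A_def B_def C_def by simp
  have d: "pu B = (\<lambda>_. 0)" "pu C = (\<lambda>_. 0)" "pv A = (\<lambda>_. 0)" "pv B = C"
    unfolding A_def B_def C_def by (simp_all only: partial_curve s scaleR_zero_left scaleR_one)
  have B0: "B (0, 0) = 0" using c'0 by (simp add: B_def)
  have u: "pu (Phi f) = (\<lambda>z. det3 (pu A z) (B z) (C z))"
    unfolding P by (simp add: partial_det3 sm d z)
  have "pu (pu (Phi f)) (0, 0) = 0" "pv (pu (Phi f)) (0, 0) = 0"
    unfolding u by (simp_all add: partial_det3 sm smooth_pu d z B0)
  then show ?thesis by (simp add: hess_def)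
qed


lemma S1_germs:
  assumes "g = S1_plus_germ \<or> g = S1_minus_germ"
  shows "smooth g" "pv g (0, 0) = 0" "pu g (0, 0) \<noteq> 0"
proof -
  obtain K where g: "g = normal_map K" and K: "smooth K" "K (0, 0) = 0"
  proof (cases "g = S1_plus_germ")
    case True
    then show ?thesis
      by (intro that[of "\<lambda>z. fst z * fst z + snd z"]) (simp_all add: S1_plus_germ_eq smooth_intros)
  next
    case False
    then show ?thesis
      using assms by (intro that[of "\<lambda>z. fst z * fst z - snd z"]) (simp_all add: S1_minus_germ_eq smooth_intros)
  qed
  show "smooth g" unfolding g by (rule smooth_normal_map[OF K(1)])
  show "pv g (0, 0) = 0" unfolding g by (rule normal_map_at_zero(1)[OF K])
  show "pu g (0, 0) \<noteq> 0" unfolding g normal_map_partials(1)[OF K(1)] by (simp add: vec_eq_iff forall_3)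
qed

context
  fixes c c' :: "real \<Rightarrow> real^3" and u0 v0 :: real and x :: "real \<times> real \<Rightarrow> real^3"
  assumes c: "smooth c" "smooth c'"
    and x_def: "x = (\<lambda>z. c (fst z) + c' (snd z))"
begin

lemma curve_sum_x: "x = (\<lambda>z. c (0 + 1 * fst z + 0 * snd z) + c' (0 + 0 * fst z + 1 * snd z))"
  by (simp add: x_def)

lemma curve_sum_x_partials:
  "pu x z = curve_deriv c (fst z)" "pv x z = curve_deriv c' (snd z)"
  using curve_sum_partials(1,2)[OF c curve_sum_x] by simp_all

text \<open>The map has rank one at an S_1 point, so at most one velocity can vanish. If one did,
  the given parameters, exchanged if necessary, would satisfy f_v = 0 and the Hessian determinant
  would be 0, against the criterion. The linear relation is the rank condition itself.\<close>

lemma curve_sum_S1_imp_parallel: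
  assumes g: "g = S1_plus_germ \<or> g = S1_minus_germ" and equiv: "germ_equiv x (u0, v0) g (0, 0)"
  shows "curve_deriv c u0 \<noteq> 0" "curve_deriv c' v0 \<noteq> 0"
    "\<exists>y1 y2. (y1 \<noteq> 0 \<or> y2 \<noteq> 0) \<and> y1 *\<^sub>R curve_deriv c u0 + y2 *\<^sub>R curve_deriv c' v0 = 0"
proof -
  have x: "smooth x" by (rule smooth_curve_sum[OF c curve_sum_x])
  note r = germ_equiv_rank[OF x S1_germs(1)[OF g] equiv S1_germs(3,2)[OF g], unfolded curve_sum_x_partials fst_conv snd_conv]
  show "\<exists>y1 y2. (y1 \<noteq> 0 \<or> y2 \<noteq> 0) \<and> y1 *\<^sub>R curve_deriv c u0 + y2 *\<^sub>R curve_deriv c' v0 = 0"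
    by (rule r(1))
  have hess_nz: "hess (Phi f) (0, 0) \<noteq> 0"
    if "smooth f" "pu f (0, 0) \<noteq> 0" "pv f (0, 0) = 0" "germ_equiv f (0, 0) g (0, 0)"
    for f :: "real \<times> real \<Rightarrow> real^3"
    using S1_criterion[OF that(1-3)] that(4) g by auto
  show "curve_deriv c' v0 \<noteq> 0"
  proof
    assume 0: "curve_deriv c' v0 = 0"
    define f where "f = (\<lambda>z. c (u0 + 1 * fst z + 0 * snd z) + c' (v0 + 0 * fst z + 1 * snd z))"
    have "germ_equiv f (0, 0) g (0, 0)"
      using equiv by (subst germ_equiv_affine_source[of 1 1 0 0 f x "(u0, v0)"]) (simp_all add: f_def x_def)
    moreover have "pu f (0, 0) \<noteq> 0" "pv f (0, 0) = 0"
      using curve_sum_partials(1,2)[OF c f_def] 0 r(2) by simp_all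
    ultimately have "hess (Phi f) (0, 0) \<noteq> 0"
      using hess_nz smooth_curve_sum[OF c f_def] by blast
    then show False using hess_Phi_singular_curve[OF c 0 f_def] by simp
  qed
  show "curve_deriv c u0 \<noteq> 0"
  proof
    assume 0: "curve_deriv c u0 = 0"
    \<comment> \<open>The parameters are exchanged, so that the singular curve is the one depending
      on v.\<close>
    define f where "f = (\<lambda>z. c' (v0 + 1 * fst z + 0 * snd z) + c (u0 + 0 * fst z + 1 * snd z))"
    have "germ_equiv f (0, 0) g (0, 0)"
      using equiv by (subst germ_equiv_affine_source[of 0 0 1 1 f x "(u0, v0)"]) (simp_all add: f_def x_def)
    moreover have "pu f (0, 0) \<noteq> 0" "pv f (0, 0) = 0"
      using curve_sum_partials(1,2)[OF c(2,1) f_def] 0 r(2) by simp_all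
    ultimately have "hess (Phi f) (0, 0) \<noteq> 0"
      using hess_nz smooth_curve_sum[OF c(2,1) f_def] by blast
    then show False using hess_Phi_singular_curve[OF c(2,1) 0 f_def] by simp
  qed
qed

text \<open>Affine source coordinates whose v-direction is the value of (b, a) at the base point
  give a map f with f_v = 0, to which the criterion applies; the fields in \<psi> are compared with
  the coordinate fields of f. There det(f_u, f_uv, f_vv) is b a^2 times the determinant in
  \<open>crit\<close>, with b and a taken at the base point.\<close>

lemma curve_sum_S1_criterion:
  fixes b a :: "real \<times> real \<Rightarrow> real"
  assumes d0: "curve_deriv c u0 \<noteq> 0" and ab: "smooth b" "smooth a"
    and nz: "b (u0, v0) \<noteq> 0" "a (u0, v0) \<noteq> 0"
    and null: "b (u0, v0) *\<^sub>R curve_deriv c u0 + a (u0, v0) *\<^sub>R curve_deriv c' v0 = 0"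
  defines "\<psi> \<equiv> Phi_fields (\<lambda>_. 1) (\<lambda>_. 0) b a x"
    and "crit \<equiv> det3 (curve_deriv c u0) (curve_deriv (curve_deriv c) u0) (curve_deriv (curve_deriv c') v0) = 0"
  shows "germ_equiv x (u0, v0) S1_plus_germ (0, 0) \<longleftrightarrow> crit \<and> hess \<psi> (u0, v0) < 0 \<and>
      (\<nexists>s. (b (u0, v0))\<^sup>2 *\<^sub>R curve_deriv (curve_deriv c) u0 + (a (u0, v0))\<^sup>2 *\<^sub>R curve_deriv (curve_deriv c') v0
         = s *\<^sub>R curve_deriv c u0)"
    and "germ_equiv x (u0, v0) S1_minus_germ (0, 0) \<longleftrightarrow> crit \<and> hess \<psi> (u0, v0) > 0"
proof -
  define y1 y2 where "y1 = b (u0, v0)" and "y2 = a (u0, v0)"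
  have x: "smooth x" by (rule smooth_curve_sum[OF c curve_sum_x])
  define f where "f = (\<lambda>z. c (u0 + 1 * fst z + y1 * snd z) + c' (v0 + 0 * fst z + y2 * snd z))"
  define \<sigma> where "\<sigma> z = (u0 + 1 * fst z + y1 * snd z, v0 + 0 * fst z + y2 * snd z)" for z :: "real \<times> real"
  have f: "smooth f" by (rule smooth_curve_sum[OF c f_def])
  have equiv: "germ_equiv f (0, 0) g (0, 0) \<longleftrightarrow> germ_equiv x (u0, v0) g (0, 0)" for g
    by (rule germ_equiv_affine_source[of 1 y2 y1 0]) (use nz in \<open>simp_all add: f_def x_def y2_def\<close>)
  note p = curve_sum_partials[OF c f_def]
  have p0: "pu f (0, 0) = curve_deriv c u0" "pv f (0, 0) = 0"
    "pu (pv f) (0, 0) = y1 *\<^sub>R curve_deriv (curve_deriv c) u0"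
    "pv (pv f) (0, 0) = (y1 * y1) *\<^sub>R curve_deriv (curve_deriv c) u0 + (y2 * y2) *\<^sub>R curve_deriv (curve_deriv c') v0"
    unfolding p(3,4) unfolding p(1,2) using null by (simp_all add: y1_def y2_def)
  have \<sigma>: "smooth \<sigma>" "\<sigma> (0, 0) = (u0, v0)"
    unfolding \<sigma>_def by (intro smooth_intros) simp
  have sp: "smooth (\<lambda>z::real\<times>real. u0 + 1 * fst z + y1 * snd z)" "smooth (\<lambda>z::real\<times>real. v0 + 0 * fst z + y2 * snd z)"
    by (intro smooth_intros)+
  have J: "jacobian \<sigma> (0, 0) \<noteq> 0"
    unfolding jacobian_def \<sigma>_def partial_pair[OF sp]
    using nz by (simp add: partial_simps smooth_add smooth_mult smooth_intros y2_def)
  have e: "\<forall>\<^sub>F z in nhds (0, 0). f z = x (\<sigma> z)" by (simp add: f_def x_def \<sigma>_def)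
  have null': "lie b a x (\<sigma> (0, 0)) = 0"
    unfolding \<sigma>(2) lie_def curve_sum_x_partials using null by simp
  have "vanishes 2 (Phi f) (0, 0) \<longleftrightarrow> det3 (curve_deriv c u0) (y1 *\<^sub>R curve_deriv (curve_deriv c) u0)
      ((y1 * y1) *\<^sub>R curve_deriv (curve_deriv c) u0 + (y2 * y2) *\<^sub>R curve_deriv (curve_deriv c') v0) = 0"
    unfolding vanishes_2_Phi_iff[OF f p0(2)] p0 ..
  also have "det3 w (y1 *\<^sub>R s) ((y1 * y1) *\<^sub>R s + (y2 * y2) *\<^sub>R t) = y1 * (y2 * y2) * det3 w s t" for w s t
    by (simp add: det3_def algebra_simps)
  finally have crit: "vanishes 2 (Phi f) (0, 0) \<longleftrightarrow> crit"
    using nz by (simp add: crit_def y1_def y2_def)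
  have fu: "pu f (0, 0) \<noteq> 0" using p0(1) d0 by simp
  note F = Phi_fields_pullback[OF f x \<sigma>(1) J e p0(2) fu smooth_const smooth_const ab _ null', of 1 0,
      folded \<psi>_def, unfolded \<sigma>(2), simplified, OF nz(2)]
  have h: "hess \<psi> (u0, v0) < 0 \<longleftrightarrow> hess (Phi f) (0, 0) < 0" "hess \<psi> (u0, v0) > 0 \<longleftrightarrow> hess (Phi f) (0, 0) > 0"
    if crit
  proof -
    obtain k where "k > 0" "hess \<psi> (u0, v0) = k * hess (Phi f) (0, 0)"
      using F(2) crit \<open>crit\<close> by blast
    then show "hess \<psi> (u0, v0) < 0 \<longleftrightarrow> hess (Phi f) (0, 0) < 0" "hess \<psi> (u0, v0) > 0 \<longleftrightarrow> hess (Phi f) (0, 0) > 0"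
      by (simp_all add: mult_less_0_iff zero_less_mult_iff)
  qed
  note C = S1_criterion[OF f fu p0(2), unfolded equiv crit p0(1,4)]
  show "germ_equiv x (u0, v0) S1_plus_germ (0, 0) \<longleftrightarrow> crit \<and> hess \<psi> (u0, v0) < 0 \<and>
      (\<nexists>s. (b (u0, v0))\<^sup>2 *\<^sub>R curve_deriv (curve_deriv c) u0 + (a (u0, v0))\<^sup>2 *\<^sub>R curve_deriv (curve_deriv c') v0
         = s *\<^sub>R curve_deriv c u0)"
    using C(1) h(1) unfolding y1_def y2_def power2_eq_square by blast
  show "germ_equiv x (u0, v0) S1_minus_germ (0, 0) \<longleftrightarrow> crit \<and> hess \<psi> (u0, v0) > 0"
    using C(2) h(2) by blast
qed

end

section \<open>Framed curves\<close>

lemma orthonormal_expand_cross3: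
  assumes "a \<bullet> a = 1" "b \<bullet> b = 1" "a \<bullet> b = 0"
  shows "w = (w \<bullet> a) *\<^sub>R a + (w \<bullet> b) *\<^sub>R b + (w \<bullet> cross3 a b) *\<^sub>R cross3 a b"
    and "cross3 a b \<bullet> cross3 a b = 1" "cross3 a b \<bullet> a = 0" "cross3 a b \<bullet> b = 0"
proof -
  have na: "norm a = 1" "norm b = 1" using assms by (simp_all add: norm_eq_1)
  show e: "cross3 a b \<bullet> cross3 a b = 1"
    using norm_cross[of a b] na assms(3) by (simp add: dot_square_norm)
  show p: "cross3 a b \<bullet> a = 0" "cross3 a b \<bullet> b = 0"
    by (simp_all add: dot_cross_self)
  define r where "r = w - ((w \<bullet> a) *\<^sub>R a + (w \<bullet> b) *\<^sub>R b + (w \<bullet> cross3 a b) *\<^sub>R cross3 a b)"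
  have p': "a \<bullet> cross3 a b = 0" "b \<bullet> cross3 a b = 0" "b \<bullet> a = 0"
    using p assms(3) by (simp_all add: inner_commute)
  have "r \<bullet> a = 0" "r \<bullet> b = 0" "r \<bullet> cross3 a b = 0"
    unfolding r_def using assms p p' e by (simp_all add: inner_diff_left inner_add_left)
  \<comment> \<open>The remainder r is orthogonal to a x b, and Lagrange's identity makes their
    cross product vanish too; a vector both orthogonal and parallel to a nonzero vector is
    0.\<close>
  moreover from this have "cross3 r (cross3 a b) = 0" by (simp add: Lagrange)
  ultimately have "r = 0 \<or> cross3 a b = 0"
    using norm_and_cross_eq_0[of r "cross3 a b"] by blast
  then have "r = 0" using e by auto
  then show "w = (w \<bullet> a) *\<^sub>R a + (w \<bullet> b) *\<^sub>R b + (w \<bullet> cross3 a b) *\<^sub>R cross3 a b"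
    by (simp add: r_def)
qed

lemma smooth_cross3: "smooth f \<Longrightarrow> smooth g \<Longrightarrow> smooth (\<lambda>p. cross3 (f p) (g p))"
  unfolding cross3_def by (intro smooth_intros)

lemma vector_derivative_eventually:
  assumes "smooth F" "\<forall>\<^sub>F u in nhds u0. F u = f u" "u0 \<in> interior I"
  shows "\<forall>\<^sub>F u in nhds u0. vector_derivative f (at u within I) = curve_deriv F u"
proof -
  obtain S where S: "open S" "u0 \<in> S" "\<And>u. u \<in> S \<Longrightarrow> F u = f u"
    using assms(2) by (auto simp: eventually_nhds)
  have "vector_derivative f (at u within I) = curve_deriv F u" if "u \<in> S \<inter> interior I" for u
  proof -
    have "(f has_vector_derivative curve_deriv F u) (at u)"
      by (rule has_vector_derivative_transform_within_open[OF has_vector_derivative_curve_deriv[OF assms(1)] S(1)])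
         (use that S in auto)
    then show ?thesis
      unfolding at_within_interior[OF IntD2[OF that]] by (rule vector_derivative_at)
  qed
  moreover have "\<forall>\<^sub>F u in nhds u0. u \<in> S \<inter> interior I"
    using S assms(3) by (intro eventually_nhds_in_open) auto
  ultimately show ?thesis by (auto elim!: eventually_mono)
qed

text \<open>Passes from curves on an interval, differentiated within it, to curves smooth on the
  whole line. The frame equations then hold only near u0, which suffices because all further
  arguments concern germs.\<close>

lemma framed_curve_germ:
  assumes fc: "framed_curve I \<gamma> \<nu>\<^sub>1 \<nu>\<^sub>2"
    and cu: "\<forall>u\<in>I. framed_curvature I \<gamma> \<nu>\<^sub>1 \<nu>\<^sub>2 u = (l u, m u, n u, \<alpha> u)"
    and u0: "u0 \<in> interior I"
  shows "\<exists>c n1 n2. smooth c \<and> smooth n1 \<and> smooth n2 \<and> (\<forall>\<^sub>F u in nhds u0. u \<in> I \<and>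
     c u = \<gamma> u \<and> n1 u = \<nu>\<^sub>1 u \<and> n2 u = \<nu>\<^sub>2 u \<and>
     n1 u \<bullet> n1 u = 1 \<and> n2 u \<bullet> n2 u = 1 \<and> n1 u \<bullet> n2 u = 0 \<and>
     curve_deriv c u \<bullet> n1 u = 0 \<and> curve_deriv c u \<bullet> n2 u = 0 \<and>
     m u = curve_deriv n1 u \<bullet> cross3 (n1 u) (n2 u) \<and> n u = curve_deriv n2 u \<bullet> cross3 (n1 u) (n2 u) \<and>
     \<alpha> u = curve_deriv c u \<bullet> cross3 (n1 u) (n2 u))"
proof -
  have oi: "open (interior I)" by simp
  have s: "smooth_on (interior I) (\<lambda>u. (\<gamma> u, \<nu>\<^sub>1 u, \<nu>\<^sub>2 u))"
    using fc interior_subset by (auto simp: framed_curve_def intro: smooth_on_subset)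
  have s1: "smooth_on (interior I) \<gamma>"
    using smooth_on_linear_compose[OF bounded_linear_fst oi s] by simp
  have s2: "smooth_on (interior I) (\<lambda>u. (\<nu>\<^sub>1 u, \<nu>\<^sub>2 u))"
    using smooth_on_linear_compose[OF bounded_linear_snd oi s] by simp
  have s3: "smooth_on (interior I) \<nu>\<^sub>1" "smooth_on (interior I) \<nu>\<^sub>2"
    using smooth_on_linear_compose[OF bounded_linear_fst oi s2] smooth_on_linear_compose[OF bounded_linear_snd oi s2]
    by simp_all
  obtain c where c: "smooth c" "\<forall>\<^sub>F u in nhds u0. c u = \<gamma> u"
    using ex_smooth_eq_near[OF s1 oi u0] by blast
  obtain n1 where n1: "smooth n1" "\<forall>\<^sub>F u in nhds u0. n1 u = \<nu>\<^sub>1 u"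
    using ex_smooth_eq_near[OF s3(1) oi u0] by blast
  obtain n2 where n2: "smooth n2" "\<forall>\<^sub>F u in nhds u0. n2 u = \<nu>\<^sub>2 u"
    using ex_smooth_eq_near[OF s3(2) oi u0] by blast
  have I: "\<forall>\<^sub>F u in nhds u0. u \<in> I"
    using eventually_nhds_in_open[OF oi u0] by (auto elim!: eventually_mono dest: interior_subset[THEN subsetD])
  have "\<forall>\<^sub>F u in nhds u0. u \<in> I \<and>
     c u = \<gamma> u \<and> n1 u = \<nu>\<^sub>1 u \<and> n2 u = \<nu>\<^sub>2 u \<and>
     n1 u \<bullet> n1 u = 1 \<and> n2 u \<bullet> n2 u = 1 \<and> n1 u \<bullet> n2 u = 0 \<and>
     curve_deriv c u \<bullet> n1 u = 0 \<and> curve_deriv c u \<bullet> n2 u = 0 \<and>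
     m u = curve_deriv n1 u \<bullet> cross3 (n1 u) (n2 u) \<and> n u = curve_deriv n2 u \<bullet> cross3 (n1 u) (n2 u) \<and>
     \<alpha> u = curve_deriv c u \<bullet> cross3 (n1 u) (n2 u)"
    using I c(2) n1(2) n2(2) vector_derivative_eventually[OF c u0] vector_derivative_eventually[OF n1 u0]
      vector_derivative_eventually[OF n2 u0]
  proof eventually_elim
    case (elim u)
    have "(\<nu>\<^sub>1 u, \<nu>\<^sub>2 u) \<in> Delta" "vector_derivative \<gamma> (at u within I) \<bullet> \<nu>\<^sub>1 u = 0"
      "vector_derivative \<gamma> (at u within I) \<bullet> \<nu>\<^sub>2 u = 0"
      using fc elim(1) by (auto simp: framed_curve_def)
    moreover have "framed_curvature I \<gamma> \<nu>\<^sub>1 \<nu>\<^sub>2 u = (l u, m u, n u, \<alpha> u)" using cu elim(1) by blast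
    ultimately show ?case
      using elim by (simp add: Delta_def framed_curvature_def frame_mu_def norm_eq_1)
  qed
  then show ?thesis using c(1) n1(1) n2(1) by blast
qed

lemma curve_deriv_orthogonal:
  assumes "smooth f" "smooth g" "\<forall>\<^sub>F u in nhds u0. f u \<bullet> g u = 0"
  shows "curve_deriv f u0 \<bullet> g u0 = - (f u0 \<bullet> curve_deriv g u0)"
proof -
  obtain S where S: "open S" "u0 \<in> S" "\<And>u. u \<in> S \<Longrightarrow> f u \<bullet> g u = 0"
    using assms(3) by (auto simp: eventually_nhds)
  have "((\<lambda>u. f u \<bullet> g u) has_vector_derivative f u0 \<bullet> curve_deriv g u0 + curve_deriv f u0 \<bullet> g u0) (at u0)"
    by (rule bounded_bilinear.has_vector_derivative[OF bounded_bilinear_inner])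
       (intro has_vector_derivative_curve_deriv assms)+
  moreover have "((\<lambda>u. f u \<bullet> g u) has_vector_derivative 0) (at u0)"
    by (rule has_vector_derivative_transform_within_open[OF has_vector_derivative_const S(1,2)])
       (simp add: S(3))
  ultimately have "f u0 \<bullet> curve_deriv g u0 + curve_deriv f u0 \<bullet> g u0 = 0"
    by (rule vector_derivative_unique_at)
  then show ?thesis by simp
qed

text \<open>Differentiating the orthogonality of c_u to n1 and n2 gives the components of c_uu along
  n1 and n2. The component along \<mu> stays an unnamed A, since second derivatives are used only
  modulo \<mu>.\<close>

lemma framed_second_derivative:
  assumes s: "smooth c" "smooth n1" "smooth n2"
    and e: "\<forall>\<^sub>F u in nhds u0. curve_deriv c u \<bullet> n1 u = 0" "\<forall>\<^sub>F u in nhds u0. curve_deriv c u \<bullet> n2 u = 0"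
    and o: "n1 u0 \<bullet> n1 u0 = 1" "n2 u0 \<bullet> n2 u0 = 1" "n1 u0 \<bullet> n2 u0 = 0"
  defines "\<mu> \<equiv> cross3 (n1 u0) (n2 u0)"
  shows "curve_deriv c u0 = (curve_deriv c u0 \<bullet> \<mu>) *\<^sub>R \<mu>"
    and "\<exists>A. curve_deriv (curve_deriv c) u0 = A *\<^sub>R \<mu> -
      (curve_deriv c u0 \<bullet> \<mu>) *\<^sub>R ((curve_deriv n1 u0 \<bullet> \<mu>) *\<^sub>R n1 u0 + (curve_deriv n2 u0 \<bullet> \<mu>) *\<^sub>R n2 u0)"
proof -
  note x = orthonormal_expand_cross3(1)[OF o, folded \<mu>_def]
  show d: "curve_deriv c u0 = (curve_deriv c u0 \<bullet> \<mu>) *\<^sub>R \<mu>"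
    using x[of "curve_deriv c u0"] eventually_nhds_x_imp_x[OF e(1)] eventually_nhds_x_imp_x[OF e(2)] by simp
  have "curve_deriv (curve_deriv c) u0 \<bullet> n1 u0 = - ((curve_deriv c u0 \<bullet> \<mu>) *\<^sub>R \<mu> \<bullet> curve_deriv n1 u0)"
    "curve_deriv (curve_deriv c) u0 \<bullet> n2 u0 = - ((curve_deriv c u0 \<bullet> \<mu>) *\<^sub>R \<mu> \<bullet> curve_deriv n2 u0)"
    unfolding d[symmetric] by (intro curve_deriv_orthogonal smooth_curve_deriv s e)+
  then have "curve_deriv (curve_deriv c) u0 = (curve_deriv (curve_deriv c) u0 \<bullet> \<mu>) *\<^sub>R \<mu> -
      (curve_deriv c u0 \<bullet> \<mu>) *\<^sub>R ((curve_deriv n1 u0 \<bullet> \<mu>) *\<^sub>R n1 u0 + (curve_deriv n2 u0 \<bullet> \<mu>) *\<^sub>R n2 u0)"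
    by (subst x) (simp add: inner_commute algebra_simps)
  then show "\<exists>A. curve_deriv (curve_deriv c) u0 = A *\<^sub>R \<mu> -
      (curve_deriv c u0 \<bullet> \<mu>) *\<^sub>R ((curve_deriv n1 u0 \<bullet> \<mu>) *\<^sub>R n1 u0 + (curve_deriv n2 u0 \<bullet> \<mu>) *\<^sub>R n2 u0)"
    by blast
qed

section \<open>The function phi near the base point\<close>

text \<open>Agreement on a neighbourhood, rather than at p alone, allows the directional derivative
  to be iterated, as \<eta>\<eta>x requires.\<close>

lemma dir_deriv_eventually:
  assumes S: "open S" "p \<in> S" "S \<subseteq> A" and G: "smooth G"
    and e: "\<forall>\<^sub>F z in nhds p. g z = G z" "\<forall>\<^sub>F z in nhds p. \<zeta> z = (b z, a z)"
  shows "\<forall>\<^sub>F z in nhds p. dir_deriv A \<zeta> g z = lie b a G z"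
proof -
  obtain U where U: "open U" "p \<in> U" "\<And>z. z \<in> U \<Longrightarrow> g z = G z"
    using e(1) by (auto simp: eventually_nhds)
  have "\<forall>\<^sub>F z in nhds p. z \<in> S \<inter> U" using S U by (intro eventually_nhds_in_open) auto
  with e(2) show ?thesis
  proof eventually_elim
    case (elim z)
    have "at z within A = at z"
      using elim(2) S by (meson Int_iff at_within_interior interior_maximal subsetD)
    moreover have "(g has_derivative (\<lambda>w. fst w *\<^sub>R pu G z + snd w *\<^sub>R pv G z)) (at z)"
      by (rule has_derivative_transform_within_open[OF smooth_has_derivative_pu_pv[OF G] U(1)])
         (use elim(2) U(3) in auto)
    from frechet_derivative_at[OF this]
    have "frechet_derivative g (at z) = (\<lambda>w. fst w *\<^sub>R pu G z + snd w *\<^sub>R pv G z)" by simp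
    ultimately show ?case using elim(1) by (simp add: dir_deriv_def lie_def)
  qed
qed

lemma partial_eventually:
  assumes e: "\<forall>\<^sub>F z in nhds p. f z = F z" and F: "smooth F"
  shows "\<forall>\<^sub>F z in nhds p. partial_u f z = pu F z" "\<forall>\<^sub>F z in nhds p. partial_v f z = pv F z"
proof -
  obtain U where U: "open U" "p \<in> U" "\<And>z. z \<in> U \<Longrightarrow> f z = F z"
    using e by (auto simp: eventually_nhds)
  have "partial_u f (u, v) = pu F (u, v) \<and> partial_v f (u, v) = pv F (u, v)" if "(u, v) \<in> U" for u v
  proof -
    have o: "open ((\<lambda>s. (s, v)) -` U)" "open ((\<lambda>s. (u, s)) -` U)"
      by (auto intro!: open_vimage U continuous_intros)
    have "((\<lambda>s. f (s, v)) has_real_derivative pu F (u, v)) (at u)"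
      by (rule has_field_derivative_transform_within_open[OF smooth_DERIV_u[OF F] o(1)]) (use that U in auto)
    moreover have "((\<lambda>s. f (u, s)) has_real_derivative pv F (u, v)) (at v)"
      by (rule has_field_derivative_transform_within_open[OF smooth_DERIV_v[OF F] o(2)]) (use that U in auto)
    ultimately show ?thesis by (simp add: partial_u_def partial_v_def DERIV_imp_deriv)
  qed
  with U(1,2) show "\<forall>\<^sub>F z in nhds p. partial_u f z = pu F z" "\<forall>\<^sub>F z in nhds p. partial_v f z = pv F z"
    by (auto simp: eventually_nhds)
qed

lemma hess_det_eq:
  assumes e: "\<forall>\<^sub>F z in nhds p. f z = F z" and F: "smooth F"
  shows "hess_det f p = hess F p"
proof -
  note u = partial_eventually(1)[OF e F] and v = partial_eventually(2)[OF e F]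
  show ?thesis
    unfolding hess_det_def hess_def
    by (simp add: eventually_nhds_x_imp_x[OF partial_eventually(1)[OF u smooth_pu[OF F]]]
        eventually_nhds_x_imp_x[OF partial_eventually(2)[OF u smooth_pu[OF F]]]
        eventually_nhds_x_imp_x[OF partial_eventually(2)[OF v smooth_pv[OF F]]])
qed

lemma phi_eventually:
  assumes S: "open S" "p \<in> S" "S \<subseteq> I \<times> J" and X: "smooth X" and s: "smooth b" "smooth a"
    and x: "\<forall>\<^sub>F z in nhds p. x z = X z"
    and eta: "\<forall>\<^sub>F z in nhds p. eta_field \<alpha> \<alpha>' T z = (b z, a z)"
  shows "\<forall>\<^sub>F z in nhds p. phi I J \<alpha> \<alpha>' T x z = Phi_fields (\<lambda>_. 1) (\<lambda>_. 0) b a X z"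
proof -
  note D1 = dir_deriv_eventually[OF S X x, of xi_field "\<lambda>_. 1" "\<lambda>_. 0"]
  note D2 = dir_deriv_eventually[OF S X x eta]
  note D3 = dir_deriv_eventually[OF S smooth_lie[OF s X] D2 eta]
  have "\<forall>\<^sub>F z in nhds p. dir_deriv (I \<times> J) xi_field x z = lie (\<lambda>_. 1) (\<lambda>_. 0) X z"
    by (rule D1) (simp add: xi_field_def case_prod_unfold)
  with D2 D3 show ?thesis
    by eventually_elim (simp add: phi_def Phi_fields_def det_vector_3)
qed

section \<open>The frame matrix at a point with |t33| = 1\<close>

text \<open>Rows and columns have length 1, so |t33| = 1 empties the rest of the third row and
  column. The upper left block is then orthogonal with determinant t33, hence equal to t33 times its
  cofactor matrix; the last two equations are entries of that identity.\<close>

lemma rotation_matrix_axis: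
  fixes T :: "real^3^3"
  assumes T: "rotation_matrix T" and t33: "\<bar>T $ 3 $ 3\<bar> = 1"
  shows "T $ 3 $ 1 = 0" "T $ 3 $ 2 = 0" "T $ 1 $ 3 = 0" "T $ 2 $ 3 = 0"
    "T $ 3 $ 3 * T $ 3 $ 3 = 1" "T $ 2 $ 2 = T $ 3 $ 3 * T $ 1 $ 1" "T $ 2 $ 1 = - (T $ 3 $ 3 * T $ 1 $ 2)"
proof -
  have o: "T ** transpose T = mat 1" "transpose T ** T = mat 1" and d: "det T = 1"
    using T by (auto simp: rotation_matrix_def orthogonal_matrix_def)
  have r: "T $ i $ 1 * T $ j $ 1 + T $ i $ 2 * T $ j $ 2 + T $ i $ 3 * T $ j $ 3 = (if i = j then 1 else 0)" for i j
    using arg_cong[OF o(1), of "\<lambda>A. A $ i $ j"]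
    by (simp add: matrix_matrix_mult_def transpose_def mat_def sum_3)
  have c: "T $ 1 $ i * T $ 1 $ j + T $ 2 $ i * T $ 2 $ j + T $ 3 $ i * T $ 3 $ j = (if i = j then 1 else 0)" for i j
    using arg_cong[OF o(2), of "\<lambda>A. A $ i $ j"]
    by (simp add: matrix_matrix_mult_def transpose_def mat_def sum_3)
  show t: "T $ 3 $ 3 * T $ 3 $ 3 = 1" using t33 by (metis abs_mult_self_eq mult_1)
  have "T $ 3 $ 1 * T $ 3 $ 1 + T $ 3 $ 2 * T $ 3 $ 2 = 0" using r[of 3 3] t by simp
  then show z1: "T $ 3 $ 1 = 0" "T $ 3 $ 2 = 0" unfolding sum_squares_eq_zero_iff by blast+
  have "T $ 1 $ 3 * T $ 1 $ 3 + T $ 2 $ 3 * T $ 2 $ 3 = 0" using c[of 3 3] t by simp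
  then show z2: "T $ 1 $ 3 = 0" "T $ 2 $ 3 = 0" unfolding sum_squares_eq_zero_iff by blast+
  have D: "T $ 3 $ 3 * (T $ 1 $ 1 * T $ 2 $ 2 - T $ 1 $ 2 * T $ 2 $ 1) = 1"
    using d z1 z2 by (simp add: det_3 algebra_simps)
  have O: "T $ 1 $ 1 * T $ 2 $ 1 + T $ 1 $ 2 * T $ 2 $ 2 = 0" and N: "T $ 2 $ 1 * T $ 2 $ 1 + T $ 2 $ 2 * T $ 2 $ 2 = 1"
    using r[of 1 2] r[of 2 2] z2 by auto
  show "T $ 2 $ 2 = T $ 3 $ 3 * T $ 1 $ 1" "T $ 2 $ 1 = - (T $ 3 $ 3 * T $ 1 $ 2)"
  proof -
    have "T $ 2 $ 2 * (T $ 3 $ 3 * (T $ 1 $ 1 * T $ 2 $ 2 - T $ 1 $ 2 * T $ 2 $ 1)) =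
        T $ 3 $ 3 * T $ 1 $ 1 * (T $ 2 $ 1 * T $ 2 $ 1 + T $ 2 $ 2 * T $ 2 $ 2)
        - T $ 3 $ 3 * T $ 2 $ 1 * (T $ 1 $ 1 * T $ 2 $ 1 + T $ 1 $ 2 * T $ 2 $ 2)"
      by (simp add: algebra_simps)
    then show "T $ 2 $ 2 = T $ 3 $ 3 * T $ 1 $ 1" unfolding D O N by simp
    have "T $ 2 $ 1 * (T $ 3 $ 3 * (T $ 1 $ 1 * T $ 2 $ 2 - T $ 1 $ 2 * T $ 2 $ 1)) =
        - (T $ 3 $ 3 * T $ 1 $ 2 * (T $ 2 $ 1 * T $ 2 $ 1 + T $ 2 $ 2 * T $ 2 $ 2))
        + T $ 3 $ 3 * T $ 2 $ 2 * (T $ 1 $ 1 * T $ 2 $ 1 + T $ 1 $ 2 * T $ 2 $ 2)"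
      by (simp add: algebra_simps)
    then show "T $ 2 $ 1 = - (T $ 3 $ 3 * T $ 1 $ 2)" unfolding D O N by simp
  qed
qed

text \<open>Modulo e3 the vectors g and g' are -\<alpha> (m, n) and -\<alpha>' (P, Q), where (P, Q)
  is (m', n') carried into the first frame. The determinant is a nonzero multiple of m Q - n P, to
  which the cofactor relations of the frame matrix give the stated form. In the second claim the
  coefficients are the squared components of \<eta>, and t33^2 = 1.\<close>

lemma frame_curvature_conditions:
  fixes T :: "real^3^3" and e1 e2 :: "real^3"
  assumes o: "e1 \<bullet> e1 = 1" "e2 \<bullet> e2 = 1" "e1 \<bullet> e2 = 0"
  defines "e3 \<equiv> cross3 e1 e2"
  assumes T: "rotation_matrix T" and t33: "\<bar>T $ 3 $ 3\<bar> = 1" and nz: "\<alpha> \<noteq> 0" "\<alpha>' \<noteq> 0"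
    and f1: "f1 = (T $ 1 $ 1) *\<^sub>R e1 + (T $ 1 $ 2) *\<^sub>R e2 + (T $ 1 $ 3) *\<^sub>R e3"
    and f2: "f2 = (T $ 2 $ 1) *\<^sub>R e1 + (T $ 2 $ 2) *\<^sub>R e2 + (T $ 2 $ 3) *\<^sub>R e3"
    and f3: "f3 = (T $ 3 $ 1) *\<^sub>R e1 + (T $ 3 $ 2) *\<^sub>R e2 + (T $ 3 $ 3) *\<^sub>R e3"
    and g: "g = A *\<^sub>R e3 - \<alpha> *\<^sub>R (m *\<^sub>R e1 + n *\<^sub>R e2)"
    and g': "g' = A' *\<^sub>R f3 - \<alpha>' *\<^sub>R (m' *\<^sub>R f1 + n' *\<^sub>R f2)"
  shows "det3 (\<alpha> *\<^sub>R e3) g g' = 0 \<longleftrightarrow>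
      m * (m' * T $ 2 $ 1 - n' * T $ 1 $ 1) + n * (m' * T $ 2 $ 2 - n' * T $ 1 $ 2) = 0"
    and "(\<exists>s. (- \<alpha>')\<^sup>2 *\<^sub>R g + (\<alpha> * T $ 3 $ 3)\<^sup>2 *\<^sub>R g' = s *\<^sub>R (\<alpha> *\<^sub>R e3)) \<longleftrightarrow>
      \<alpha>' * m + \<alpha> * (m' * T $ 1 $ 1 + n' * T $ 2 $ 1) = 0 \<and>
      \<alpha>' * n + \<alpha> * (m' * T $ 1 $ 2 + n' * T $ 2 $ 2) = 0"
proof -
  note t = rotation_matrix_axis[OF T t33]
  note e = orthonormal_expand_cross3(2-4)[OF o, folded e3_def]
  have e': "e1 \<bullet> e3 = 0" "e2 \<bullet> e3 = 0" "e2 \<bullet> e1 = 0" using e o by (simp_all add: inner_commute)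
  define P where "P = m' * T $ 1 $ 1 + n' * T $ 2 $ 1"
  define Q where "Q = m' * T $ 1 $ 2 + n' * T $ 2 $ 2"
  have G: "g = (- \<alpha> * m) *\<^sub>R e1 + (- \<alpha> * n) *\<^sub>R e2 + A *\<^sub>R e3"
    unfolding g by (simp add: algebra_simps)
  have G': "g' = (- \<alpha>' * P) *\<^sub>R e1 + (- \<alpha>' * Q) *\<^sub>R e2 + (A' * T $ 3 $ 3) *\<^sub>R e3"
    unfolding g' f1 f2 f3 t(1-4) P_def Q_def by (simp add: algebra_simps)
  have d: "det3 e1 e2 e3 = 1"
  proof -
    have "det3 e1 e2 e3 = e3 \<bullet> e3"
      by (simp add: e3_def det3_def cross3_def inner_vec_def sum_3 algebra_simps)
    then show ?thesis using e by simp
  qed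
  have D3: "det3 (\<alpha> *\<^sub>R e3) (p1 *\<^sub>R e1 + p2 *\<^sub>R e2 + p3 *\<^sub>R e3) (q1 *\<^sub>R e1 + q2 *\<^sub>R e2 + q3 *\<^sub>R e3) =
      \<alpha> * (p1 * q2 - p2 * q1) * det3 e1 e2 e3" for p1 p2 p3 q1 q2 q3
    by (simp add: det3_def algebra_simps)
  have "det3 (\<alpha> *\<^sub>R e3) g g' = \<alpha> * \<alpha> * \<alpha>' * (m * Q - n * P)"
    unfolding G G' D3 d by (simp add: algebra_simps)
  moreover have "m * Q - n * P = - (T $ 3 $ 3) * (m * (m' * T $ 2 $ 1 - n' * T $ 1 $ 1) + n * (m' * T $ 2 $ 2 - n' * T $ 1 $ 2))"
    unfolding P_def Q_def using t(5-7) by algebra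
  ultimately show "det3 (\<alpha> *\<^sub>R e3) g g' = 0 \<longleftrightarrow>
      m * (m' * T $ 2 $ 1 - n' * T $ 1 $ 1) + n * (m' * T $ 2 $ 2 - n' * T $ 1 $ 2) = 0"
    using nz t(5) by auto
  have tt: "(\<alpha> * T $ 3 $ 3)\<^sup>2 = \<alpha>\<^sup>2" using t(5) by (simp add: power2_eq_square algebra_simps)
  define R where "R = (- \<alpha>')\<^sup>2 *\<^sub>R g + (\<alpha> * T $ 3 $ 3)\<^sup>2 *\<^sub>R g'"
  have R: "R = (- \<alpha> * \<alpha>' * (\<alpha>' * m + \<alpha> * P)) *\<^sub>R e1 + (- \<alpha> * \<alpha>' * (\<alpha>' * n + \<alpha> * Q)) *\<^sub>R e2
      + (\<alpha>'\<^sup>2 * A + \<alpha>\<^sup>2 * (A' * T $ 3 $ 3)) *\<^sub>R e3"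
    unfolding R_def tt G G' by (simp add: algebra_simps power2_eq_square)
  have "(\<exists>s. R = s *\<^sub>R (\<alpha> *\<^sub>R e3)) \<longleftrightarrow> \<alpha>' * m + \<alpha> * P = 0 \<and> \<alpha>' * n + \<alpha> * Q = 0"
  proof
    assume "\<exists>s. R = s *\<^sub>R (\<alpha> *\<^sub>R e3)"
    then have "R \<bullet> e1 = 0" "R \<bullet> e2 = 0" using e by auto
    then show "\<alpha>' * m + \<alpha> * P = 0 \<and> \<alpha>' * n + \<alpha> * Q = 0"
      unfolding R using nz o e e' by (simp add: inner_add_left inner_diff_left)
  next
    assume "\<alpha>' * m + \<alpha> * P = 0 \<and> \<alpha>' * n + \<alpha> * Q = 0"
    then have "R = ((\<alpha>'\<^sup>2 * A + \<alpha>\<^sup>2 * (A' * T $ 3 $ 3)) / \<alpha>) *\<^sub>R (\<alpha> *\<^sub>R e3)"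
      unfolding R using nz by simp
    then show "\<exists>s. R = s *\<^sub>R (\<alpha> *\<^sub>R e3)" by blast
  qed
  then show "(\<exists>s. (- \<alpha>')\<^sup>2 *\<^sub>R g + (\<alpha> * T $ 3 $ 3)\<^sup>2 *\<^sub>R g' = s *\<^sub>R (\<alpha> *\<^sub>R e3)) \<longleftrightarrow>
      \<alpha>' * m + \<alpha> * (m' * T $ 1 $ 1 + n' * T $ 2 $ 1) = 0 \<and>
      \<alpha>' * n + \<alpha> * (m' * T $ 1 $ 2 + n' * T $ 2 $ 2) = 0"
    unfolding R_def P_def Q_def .
qed

lemma frame_matrix_rows:
  assumes "frame_matrix I J \<nu>\<^sub>1 \<nu>\<^sub>2 \<nu>\<^sub>1' \<nu>\<^sub>2' T" "u \<in> I" "v \<in> J"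
  shows "\<nu>\<^sub>1' v = (T u v $ 1 $ 1) *\<^sub>R \<nu>\<^sub>1 u + (T u v $ 1 $ 2) *\<^sub>R \<nu>\<^sub>2 u + (T u v $ 1 $ 3) *\<^sub>R cross3 (\<nu>\<^sub>1 u) (\<nu>\<^sub>2 u)"
    "\<nu>\<^sub>2' v = (T u v $ 2 $ 1) *\<^sub>R \<nu>\<^sub>1 u + (T u v $ 2 $ 2) *\<^sub>R \<nu>\<^sub>2 u + (T u v $ 2 $ 3) *\<^sub>R cross3 (\<nu>\<^sub>1 u) (\<nu>\<^sub>2 u)"
    "cross3 (\<nu>\<^sub>1' v) (\<nu>\<^sub>2' v) =
      (T u v $ 3 $ 1) *\<^sub>R \<nu>\<^sub>1 u + (T u v $ 3 $ 2) *\<^sub>R \<nu>\<^sub>2 u + (T u v $ 3 $ 3) *\<^sub>R cross3 (\<nu>\<^sub>1 u) (\<nu>\<^sub>2 u)"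
    "rotation_matrix (T u v)"
proof -
  have e: "frame_rows \<nu>\<^sub>1' \<nu>\<^sub>2' v = T u v ** frame_rows \<nu>\<^sub>1 \<nu>\<^sub>2 u" and r: "rotation_matrix (T u v)"
    using assms unfolding frame_matrix_def by blast+
  have *: "frame_rows \<nu>\<^sub>1' \<nu>\<^sub>2' v $ i =
    (T u v $ i $ 1) *\<^sub>R \<nu>\<^sub>1 u + (T u v $ i $ 2) *\<^sub>R \<nu>\<^sub>2 u + (T u v $ i $ 3) *\<^sub>R cross3 (\<nu>\<^sub>1 u) (\<nu>\<^sub>2 u)" for i
    unfolding e by (simp add: vec_eq_iff matrix_matrix_mult_def sum_3 frame_rows_def frame_mu_def)
  show "\<nu>\<^sub>1' v = (T u v $ 1 $ 1) *\<^sub>R \<nu>\<^sub>1 u + (T u v $ 1 $ 2) *\<^sub>R \<nu>\<^sub>2 u + (T u v $ 1 $ 3) *\<^sub>R cross3 (\<nu>\<^sub>1 u) (\<nu>\<^sub>2 u)"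
    "\<nu>\<^sub>2' v = (T u v $ 2 $ 1) *\<^sub>R \<nu>\<^sub>1 u + (T u v $ 2 $ 2) *\<^sub>R \<nu>\<^sub>2 u + (T u v $ 2 $ 3) *\<^sub>R cross3 (\<nu>\<^sub>1 u) (\<nu>\<^sub>2 u)"
    "cross3 (\<nu>\<^sub>1' v) (\<nu>\<^sub>2' v) =
      (T u v $ 3 $ 1) *\<^sub>R \<nu>\<^sub>1 u + (T u v $ 3 $ 2) *\<^sub>R \<nu>\<^sub>2 u + (T u v $ 3 $ 3) *\<^sub>R cross3 (\<nu>\<^sub>1 u) (\<nu>\<^sub>2 u)"
    using *[of 1] *[of 2] *[of 3] by (simp_all add: frame_rows_def frame_mu_def)
qed (use assms in \<open>auto simp: frame_matrix_def\<close>)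

theorem theorem2p10:
  fixes I J :: "real set"
    and \<gamma> \<nu>\<^sub>1 \<nu>\<^sub>2 \<gamma>' \<nu>\<^sub>1' \<nu>\<^sub>2' :: "real \<Rightarrow> real^3"
    and l m n \<alpha> l' m' n' \<alpha>' :: "real \<Rightarrow> real"
    and T :: "real \<Rightarrow> real \<Rightarrow> real^3^3"
    and x :: "real \<times> real \<Rightarrow> real^3"
    and \<phi> :: "real \<times> real \<Rightarrow> real"
    and u\<^sub>0 v\<^sub>0 :: real
  assumes "is_interval I" and "is_interval J"
    and "framed_curve I \<gamma> \<nu>\<^sub>1 \<nu>\<^sub>2" and "framed_curve J \<gamma>' \<nu>\<^sub>1' \<nu>\<^sub>2'"
    and "\<forall>u\<in>I. framed_curvature I \<gamma> \<nu>\<^sub>1 \<nu>\<^sub>2 u = (l u, m u, n u, \<alpha> u)"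
    and "\<forall>v\<in>J. framed_curvature J \<gamma>' \<nu>\<^sub>1' \<nu>\<^sub>2' v = (l' v, m' v, n' v, \<alpha>' v)"
    and "frame_matrix I J \<nu>\<^sub>1 \<nu>\<^sub>2 \<nu>\<^sub>1' \<nu>\<^sub>2' T"
    and "\<forall>u\<in>I. \<forall>v\<in>J. x (u, v) = \<gamma> u + \<gamma>' v"
    and "\<forall>p\<in>I \<times> J. \<phi> p = phi I J \<alpha> \<alpha>' T x p"
    and "u\<^sub>0 \<in> interior I" and "v\<^sub>0 \<in> interior J"
  shows
    "(S1_plus_singular_point x (u\<^sub>0, v\<^sub>0) \<longleftrightarrow>
        \<alpha> u\<^sub>0 * \<alpha>' v\<^sub>0 \<noteq> 0 \<and>
        \<bar>T u\<^sub>0 v\<^sub>0 $ 3 $ 3\<bar> = 1 \<and>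
        m u\<^sub>0 * (m' v\<^sub>0 * T u\<^sub>0 v\<^sub>0 $ 2 $ 1 - n' v\<^sub>0 * T u\<^sub>0 v\<^sub>0 $ 1 $ 1)
          + n u\<^sub>0 * (m' v\<^sub>0 * T u\<^sub>0 v\<^sub>0 $ 2 $ 2 - n' v\<^sub>0 * T u\<^sub>0 v\<^sub>0 $ 1 $ 2) = 0 \<and>
        hess_det \<phi> (u\<^sub>0, v\<^sub>0) < 0 \<and>
        (\<alpha>' v\<^sub>0 * m u\<^sub>0 + \<alpha> u\<^sub>0 * (m' v\<^sub>0 * T u\<^sub>0 v\<^sub>0 $ 1 $ 1 + n' v\<^sub>0 * T u\<^sub>0 v\<^sub>0 $ 2 $ 1),
         \<alpha>' v\<^sub>0 * n u\<^sub>0 + \<alpha> u\<^sub>0 * (m' v\<^sub>0 * T u\<^sub>0 v\<^sub>0 $ 1 $ 2 + n' v\<^sub>0 * T u\<^sub>0 v\<^sub>0 $ 2 $ 2))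
          \<noteq> (0, 0))
     \<and>
     (S1_minus_singular_point x (u\<^sub>0, v\<^sub>0) \<longleftrightarrow>
        \<alpha> u\<^sub>0 * \<alpha>' v\<^sub>0 \<noteq> 0 \<and>
        \<bar>T u\<^sub>0 v\<^sub>0 $ 3 $ 3\<bar> = 1 \<and>
        m u\<^sub>0 * (m' v\<^sub>0 * T u\<^sub>0 v\<^sub>0 $ 2 $ 1 - n' v\<^sub>0 * T u\<^sub>0 v\<^sub>0 $ 1 $ 1)
          + n u\<^sub>0 * (m' v\<^sub>0 * T u\<^sub>0 v\<^sub>0 $ 2 $ 2 - n' v\<^sub>0 * T u\<^sub>0 v\<^sub>0 $ 1 $ 2) = 0 \<and>
        hess_det \<phi> (u\<^sub>0, v\<^sub>0) > 0)"
proof -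
  obtain c n1 n2 where c: "smooth c" "smooth n1" "smooth n2" and ev: "\<forall>\<^sub>F u in nhds u\<^sub>0. u \<in> I \<and>
     c u = \<gamma> u \<and> n1 u = \<nu>\<^sub>1 u \<and> n2 u = \<nu>\<^sub>2 u \<and>
     n1 u \<bullet> n1 u = 1 \<and> n2 u \<bullet> n2 u = 1 \<and> n1 u \<bullet> n2 u = 0 \<and>
     curve_deriv c u \<bullet> n1 u = 0 \<and> curve_deriv c u \<bullet> n2 u = 0 \<and>
     m u = curve_deriv n1 u \<bullet> cross3 (n1 u) (n2 u) \<and> n u = curve_deriv n2 u \<bullet> cross3 (n1 u) (n2 u) \<and>
     \<alpha> u = curve_deriv c u \<bullet> cross3 (n1 u) (n2 u)"
    using framed_curve_germ[OF assms(3,5,10)] by blast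
  obtain c' k1 k2 where c': "smooth c'" "smooth k1" "smooth k2" and ev': "\<forall>\<^sub>F v in nhds v\<^sub>0. v \<in> J \<and>
     c' v = \<gamma>' v \<and> k1 v = \<nu>\<^sub>1' v \<and> k2 v = \<nu>\<^sub>2' v \<and>
     k1 v \<bullet> k1 v = 1 \<and> k2 v \<bullet> k2 v = 1 \<and> k1 v \<bullet> k2 v = 0 \<and>
     curve_deriv c' v \<bullet> k1 v = 0 \<and> curve_deriv c' v \<bullet> k2 v = 0 \<and>
     m' v = curve_deriv k1 v \<bullet> cross3 (k1 v) (k2 v) \<and> n' v = curve_deriv k2 v \<bullet> cross3 (k1 v) (k2 v) \<and>
     \<alpha>' v = curve_deriv c' v \<bullet> cross3 (k1 v) (k2 v)"
    using framed_curve_germ[OF assms(4,6,11)] by blast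
  note at = eventually_nhds_x_imp_x[OF ev] and at' = eventually_nhds_x_imp_x[OF ev']
  define X where "X = (\<lambda>z. c (fst z) + c' (snd z))"
  define \<mu> where "\<mu> u = cross3 (n1 u) (n2 u)" for u
  define \<mu>' where "\<mu>' v = cross3 (k1 v) (k2 v)" for v
  \<comment> \<open>b and a represent the components of \<eta>. T is given only pointwise, so t33
    enters as the inner product of \<mu>' and \<mu>, which is visibly smooth.\<close>
  define b where "b z = - (curve_deriv c' (snd z) \<bullet> \<mu>' (snd z))" for z :: "real \<times> real"
  define a where "a z = (curve_deriv c (fst z) \<bullet> \<mu> (fst z)) * (\<mu>' (snd z) \<bullet> \<mu> (fst z))" for z :: "real \<times> real"
  let ?p = "(u\<^sub>0, v\<^sub>0)" and ?t = "T u\<^sub>0 v\<^sub>0"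
  have \<mu>: "smooth \<mu>" "smooth \<mu>'"
    unfolding \<mu>_def \<mu>'_def by (intro smooth_cross3 c c')+
  have X: "smooth X" unfolding X_def
    by (intro smooth_add smooth_compose[OF c(1) smooth_fst] smooth_compose[OF c'(1) smooth_snd])
  have ab: "smooth b" "smooth a"
    unfolding b_def a_def
    by (intro smooth_minus smooth_mult smooth_inner smooth_compose[OF smooth_curve_deriv[OF c(1)] smooth_fst]
        smooth_compose[OF smooth_curve_deriv[OF c'(1)] smooth_snd] smooth_compose[OF \<mu>(1) smooth_fst]
        smooth_compose[OF \<mu>(2) smooth_snd])+
  have evp: "\<forall>\<^sub>F z in nhds ?p. fst z \<in> I \<and>
     c (fst z) = \<gamma> (fst z) \<and> n1 (fst z) = \<nu>\<^sub>1 (fst z) \<and> n2 (fst z) = \<nu>\<^sub>2 (fst z) \<and>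
     n1 (fst z) \<bullet> n1 (fst z) = 1 \<and> n2 (fst z) \<bullet> n2 (fst z) = 1 \<and> n1 (fst z) \<bullet> n2 (fst z) = 0 \<and>
     \<alpha> (fst z) = curve_deriv c (fst z) \<bullet> \<mu> (fst z)"
    by (rule smooth_eventually[OF smooth_fst]) (use ev in \<open>auto elim!: eventually_mono simp: \<mu>_def\<close>)
  have evp': "\<forall>\<^sub>F z in nhds ?p. snd z \<in> J \<and>
     c' (snd z) = \<gamma>' (snd z) \<and> k1 (snd z) = \<nu>\<^sub>1' (snd z) \<and> k2 (snd z) = \<nu>\<^sub>2' (snd z) \<and>
     \<alpha>' (snd z) = curve_deriv c' (snd z) \<bullet> \<mu>' (snd z)"
    by (rule smooth_eventually[OF smooth_snd]) (use ev' in \<open>auto elim!: eventually_mono simp: \<mu>'_def\<close>)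
  have xX: "\<forall>\<^sub>F z in nhds ?p. x z = X z"
    using evp evp'
  proof eventually_elim
    case (elim z)
    then show ?case using assms(8) by (cases z) (simp add: X_def)
  qed
  have T33: "\<forall>\<^sub>F z in nhds ?p. T (fst z) (snd z) $ 3 $ 3 = \<mu>' (snd z) \<bullet> \<mu> (fst z)"
    using evp evp'
  proof eventually_elim
    case (elim z)
    have "fst z \<in> I" "snd z \<in> J" using elim by auto
    note r = frame_matrix_rows(3)[OF assms(7) this]
    have o: "n1 (fst z) \<bullet> n1 (fst z) = 1" "n2 (fst z) \<bullet> n2 (fst z) = 1" "n1 (fst z) \<bullet> n2 (fst z) = 0"
      using elim by auto
    note e = orthonormal_expand_cross3(2-4)[OF o, folded \<mu>_def]
    have "\<mu>' (snd z) = (T (fst z) (snd z) $ 3 $ 1) *\<^sub>R n1 (fst z) + (T (fst z) (snd z) $ 3 $ 2) *\<^sub>R n2 (fst z)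
        + (T (fst z) (snd z) $ 3 $ 3) *\<^sub>R \<mu> (fst z)"
      using r elim by (simp add: \<mu>_def \<mu>'_def)
    moreover have "n1 (fst z) \<bullet> \<mu> (fst z) = 0" "n2 (fst z) \<bullet> \<mu> (fst z) = 0"
      using e(2,3) by (simp_all only: inner_commute)
    ultimately show ?case using e(1) by (simp add: inner_add_left)
  qed
  have eta: "\<forall>\<^sub>F z in nhds ?p. eta_field \<alpha> \<alpha>' T z = (b z, a z)"
    using evp evp' T33
    by eventually_elim (simp add: eta_field_def b_def a_def case_prod_unfold)
  define S where "S = interior I \<times> interior J"
  have S: "open S" "?p \<in> S" "S \<subseteq> I \<times> J"
    unfolding S_def using assms(10,11) interior_subset by (auto intro: open_Times)
  let ?\<psi> = "Phi_fields (\<lambda>_. 1) (\<lambda>_. 0) b a X"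
  have "\<forall>\<^sub>F z in nhds ?p. \<phi> z = ?\<psi> z"
    using phi_eventually[OF S X ab xX eta] eventually_nhds_in_open[OF S(1,2)]
    by eventually_elim (use assms(9) S(3) in auto)
  then have hess: "hess_det \<phi> ?p = hess ?\<psi> ?p"
    by (rule hess_det_eq) (intro smooth_Phi_fields smooth_const ab X)
  \<comment> \<open>The passage between A-equivalence and equivalence of germs needs continuity of
    x, which is known only through the agreement with X near the base point.\<close>
  have cont: "isCont x ?p"
  proof -
    have "isCont X ?p" by (rule smooth_isCont[OF X])
    then show ?thesis using isCont_cong[OF xX] by blast
  qed
  have equiv: "A_equivalent x ?p g (0, 0) \<longleftrightarrow> germ_equiv X ?p g (0, 0)" for g
  proof -
    have "\<forall>\<^sub>F z in nhds ?p. X z = x z" using xX by eventually_elim simp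
    then show ?thesis
      unfolding A_equivalent_iff_germ_equiv[OF cont] using germ_equiv_cong xX by blast
  qed
  have o: "n1 u\<^sub>0 \<bullet> n1 u\<^sub>0 = 1" "n2 u\<^sub>0 \<bullet> n2 u\<^sub>0 = 1" "n1 u\<^sub>0 \<bullet> n2 u\<^sub>0 = 0"
    and o': "k1 v\<^sub>0 \<bullet> k1 v\<^sub>0 = 1" "k2 v\<^sub>0 \<bullet> k2 v\<^sub>0 = 1" "k1 v\<^sub>0 \<bullet> k2 v\<^sub>0 = 0"
    using at at' by auto
  have e: "\<forall>\<^sub>F u in nhds u\<^sub>0. curve_deriv c u \<bullet> n1 u = 0" "\<forall>\<^sub>F u in nhds u\<^sub>0. curve_deriv c u \<bullet> n2 u = 0"
    using ev by (auto elim!: eventually_mono)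
  have e': "\<forall>\<^sub>F v in nhds v\<^sub>0. curve_deriv c' v \<bullet> k1 v = 0" "\<forall>\<^sub>F v in nhds v\<^sub>0. curve_deriv c' v \<bullet> k2 v = 0"
    using ev' by (auto elim!: eventually_mono)
  note cv = at[folded \<mu>_def] and cv' = at'[folded \<mu>'_def]
  have d: "curve_deriv c u\<^sub>0 = \<alpha> u\<^sub>0 *\<^sub>R \<mu> u\<^sub>0" and d': "curve_deriv c' v\<^sub>0 = \<alpha>' v\<^sub>0 *\<^sub>R \<mu>' v\<^sub>0"
    using framed_second_derivative(1)[OF c e o, folded \<mu>_def] framed_second_derivative(1)[OF c' e' o', folded \<mu>'_def]
      cv cv' by simp_all
  obtain A where dd: "curve_deriv (curve_deriv c) u\<^sub>0 =
      A *\<^sub>R \<mu> u\<^sub>0 - \<alpha> u\<^sub>0 *\<^sub>R (m u\<^sub>0 *\<^sub>R n1 u\<^sub>0 + n u\<^sub>0 *\<^sub>R n2 u\<^sub>0)"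
    using framed_second_derivative(2)[OF c e o, folded \<mu>_def] cv by auto
  obtain A' where dd': "curve_deriv (curve_deriv c') v\<^sub>0 =
      A' *\<^sub>R \<mu>' v\<^sub>0 - \<alpha>' v\<^sub>0 *\<^sub>R (m' v\<^sub>0 *\<^sub>R k1 v\<^sub>0 + n' v\<^sub>0 *\<^sub>R k2 v\<^sub>0)"
    using framed_second_derivative(2)[OF c' e' o', folded \<mu>'_def] cv' by auto
  have uv: "u\<^sub>0 \<in> I" "v\<^sub>0 \<in> J" using at at' by auto
  note rows = frame_matrix_rows[OF assms(7) uv]
  have rows': "k1 v\<^sub>0 = (?t $ 1 $ 1) *\<^sub>R n1 u\<^sub>0 + (?t $ 1 $ 2) *\<^sub>R n2 u\<^sub>0 + (?t $ 1 $ 3) *\<^sub>R \<mu> u\<^sub>0"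
    "k2 v\<^sub>0 = (?t $ 2 $ 1) *\<^sub>R n1 u\<^sub>0 + (?t $ 2 $ 2) *\<^sub>R n2 u\<^sub>0 + (?t $ 2 $ 3) *\<^sub>R \<mu> u\<^sub>0"
    "\<mu>' v\<^sub>0 = (?t $ 3 $ 1) *\<^sub>R n1 u\<^sub>0 + (?t $ 3 $ 2) *\<^sub>R n2 u\<^sub>0 + (?t $ 3 $ 3) *\<^sub>R \<mu> u\<^sub>0"
    using rows(1-3) at at' by (simp_all add: \<mu>_def \<mu>'_def)
  have t33: "?t $ 3 $ 3 = \<mu>' v\<^sub>0 \<bullet> \<mu> u\<^sub>0" using eventually_nhds_x_imp_x[OF T33] by simp
  have unit: "\<mu> u\<^sub>0 \<bullet> \<mu> u\<^sub>0 = 1" "\<mu>' v\<^sub>0 \<bullet> \<mu>' v\<^sub>0 = 1"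
    using orthonormal_expand_cross3(2)[OF o] orthonormal_expand_cross3(2)[OF o'] by (simp_all add: \<mu>_def \<mu>'_def)
  have necessary: "\<alpha> u\<^sub>0 * \<alpha>' v\<^sub>0 \<noteq> 0 \<and> \<bar>?t $ 3 $ 3\<bar> = 1"
    if g: "g = S1_plus_germ \<or> g = S1_minus_germ" and eq: "germ_equiv X ?p g (0, 0)" for g
  proof -
    note par = curve_sum_S1_imp_parallel[OF c(1) c'(1) X_def g eq]
    have nz: "\<alpha> u\<^sub>0 \<noteq> 0" "\<alpha>' v\<^sub>0 \<noteq> 0" using par(1,2) d d' by auto
    obtain y1 y2 where y: "y1 \<noteq> 0 \<or> y2 \<noteq> 0" "y1 *\<^sub>R curve_deriv c u\<^sub>0 + y2 *\<^sub>R curve_deriv c' v\<^sub>0 = 0"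
      using par(3) by blast
    let ?w = "y1 *\<^sub>R curve_deriv c u\<^sub>0 + y2 *\<^sub>R curve_deriv c' v\<^sub>0" and ?r = "?t $ 3 $ 3"
    \<comment> \<open>Testing the relation between the velocities against the unit vectors \<mu> and
      \<mu>' gives two linear equations with determinant 1 - t33^2 up to nonzero factors; a
      nontrivial solution forces t33^2 = 1.\<close>
    have "?w \<bullet> \<mu> u\<^sub>0 = 0" "?w \<bullet> \<mu>' v\<^sub>0 = 0" using y(2) by simp_all
    then have 1: "y1 * \<alpha> u\<^sub>0 + y2 * \<alpha>' v\<^sub>0 * ?r = 0" "y1 * \<alpha> u\<^sub>0 * ?r + y2 * \<alpha>' v\<^sub>0 = 0"
      unfolding d d' t33 using unit by (simp_all add: inner_add_left inner_commute[of "\<mu> u\<^sub>0" "\<mu>' v\<^sub>0"])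
    have "y1 * \<alpha> u\<^sub>0 * (1 - ?r * ?r) = 0" "y2 * \<alpha>' v\<^sub>0 * (1 - ?r * ?r) = 0"
      using 1 by algebra+
    with y(1) nz have "?r * ?r = 1" by auto
    then have "\<bar>?r\<bar> = 1" by (auto simp add: square_eq_1_iff)
    with nz show ?thesis by simp
  qed
  have bp: "b ?p = - \<alpha>' v\<^sub>0" "a ?p = \<alpha> u\<^sub>0 * ?t $ 3 $ 3"
    using cv cv' t33 by (simp_all add: b_def a_def)
  define C3 where "C3 \<longleftrightarrow> m u\<^sub>0 * (m' v\<^sub>0 * ?t $ 2 $ 1 - n' v\<^sub>0 * ?t $ 1 $ 1)
          + n u\<^sub>0 * (m' v\<^sub>0 * ?t $ 2 $ 2 - n' v\<^sub>0 * ?t $ 1 $ 2) = 0"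
  define C5 where "C5 \<longleftrightarrow> (\<alpha>' v\<^sub>0 * m u\<^sub>0 + \<alpha> u\<^sub>0 * (m' v\<^sub>0 * ?t $ 1 $ 1 + n' v\<^sub>0 * ?t $ 2 $ 1),
         \<alpha>' v\<^sub>0 * n u\<^sub>0 + \<alpha> u\<^sub>0 * (m' v\<^sub>0 * ?t $ 1 $ 2 + n' v\<^sub>0 * ?t $ 2 $ 2)) \<noteq> (0, 0)"
  have sufficient: "(germ_equiv X ?p S1_plus_germ (0, 0) \<longleftrightarrow> C3 \<and> hess_det \<phi> ?p < 0 \<and> C5) \<and>
      (germ_equiv X ?p S1_minus_germ (0, 0) \<longleftrightarrow> C3 \<and> hess_det \<phi> ?p > 0)"
    if nz: "\<alpha> u\<^sub>0 * \<alpha>' v\<^sub>0 \<noteq> 0" and r: "\<bar>?t $ 3 $ 3\<bar> = 1"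
  proof -
    have nz': "\<alpha> u\<^sub>0 \<noteq> 0" "\<alpha>' v\<^sub>0 \<noteq> 0" using nz by auto
    have r': "?t $ 3 $ 3 \<noteq> 0" using r by auto
    note F = frame_curvature_conditions[OF o rows(4) r nz' rows'[unfolded \<mu>_def] dd[unfolded \<mu>_def] dd',
        folded \<mu>_def]
    have d0: "curve_deriv c u\<^sub>0 \<noteq> 0" using d nz' unit by auto
    have bn: "b ?p \<noteq> 0" "a ?p \<noteq> 0" unfolding bp using nz' r' by auto
    \<comment> \<open>With |t33| = 1 the frame relation is \<mu>' = t33 \<mu>, so \<eta>x =
      -\<alpha>' \<alpha> \<mu> + \<alpha> t33 \<alpha>' t33 \<mu> = 0 at the base point.\<close>
    have null: "b ?p *\<^sub>R curve_deriv c u\<^sub>0 + a ?p *\<^sub>R curve_deriv c' v\<^sub>0 = 0"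
      using rotation_matrix_axis[OF rows(4) r]
      unfolding bp d d' rows'(3) by (simp add: algebra_simps)
    note K = curve_sum_S1_criterion[OF c(1) c'(1) X_def d0 ab bn null, unfolded bp]
    show ?thesis
      unfolding hess K unfolding d F C3_def C5_def by auto
  qed
  show ?thesis
    unfolding S1_plus_singular_point_def S1_minus_singular_point_def equiv C3_def[symmetric] C5_def[symmetric]
    using necessary sufficient by blast
qed

end
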